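(* Let $\mathbf{a},\mathbf{a}^{*}\in l^{2}$ and let $\{t_k\}_{k\in\mathbb{Z}}$ be a sequence of real numbers such that $$\sup_{k\in\mathbb{Z}}|t_k-k|<\frac14 .$$ Then $$\Psi(t)=\sum_{k\in\mathbb{Z}}\Psi(t_k)\frac{G(t)}{G'(t_k)(t-t_k)}$$ uniformly on every compact subset of $\mathbb{R}$.
   Context: $l^{2}$ is the Hilbert space of square-summable complex sequences $\mathbf{a}=(a_n)_{n\in\mathbb{Z}}$ with its natural inner product $\langle\cdot,\cdot\rangle$ (linear in the first argument). $H:l^2\to l^2$ is the bounded operator $H=\pi\widetilde H$, where $\widetilde H$ is the discrete Hilbert transform; explicitly $(H\mathbf{a})_m=\sum_{n\in\mathbb{Z},\,n\neq m}\frac{a_n}{m-n}$, $m\in\mathbb{Z}$. For $t\in\mathbb{R}$, $e^{tH}=\sum_{k=0}^{\infty}\frac{t^kH^k}{k!}$. For given $\mathbf{a},\mathbf{a}^*$ the function $\Psi$ is defined by $\Psi(t)=\left\langle\frac{e^{tH}\mathbf{a}-\mathbf{a}}{t},\mathbf{a}^{*}\right\rangle$ for $t\ne0$ and $\Psi(0)=\langle H\mathbf{a},\mathbf{a}^{*}\rangle$. For the given sequence $\{t_k\}$, $G$ is the entire function $$G(z)=(z-t_0)\prod_{k=1}^{\infty}\left(1-\frac{z}{t_k}\right)\left(1-\frac{z}{t_{-k}}\right).$$ At $t=t_k$ the quotient $\frac{G(t)}{G'(t_k)(t-t_k)}$ is understood as its limit value $1$. *)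

theory Defs
  imports "HOL-Complex_Analysis.Complex_Analysis" "HOL-Real_Asymp.Real_Asymp"
begin

section \<open>The Hilbert space of square-summable two-sided complex sequences\<close>

typedef ell2 = "{a :: int \<Rightarrow> complex. (\<lambda>n. (cmod (a n))\<^sup>2) summable_on UNIV}"
  morphisms coord Abs_ell2
  by (rule exI[of _ "\<lambda>_. 0"]) simp

setup_lifting type_definition_ell2

lemma coord_summable: "(\<lambda>n. (cmod (coord a n))\<^sup>2) summable_on UNIV"
  using coord[of a] by simp

lemma ell2_eqI: "(\<And>n. coord a n = coord b n) \<Longrightarrow> a = b"
  by (metis coord_inject ext)

lemma square_summable_mult:
  fixes a b :: "'i \<Rightarrow> complex"
  assumes "(\<lambda>n. (cmod (a n))\<^sup>2) summable_on A" "(\<lambda>n. (cmod (b n))\<^sup>2) summable_on A"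
  shows "(\<lambda>n. norm (a n * b n)) summable_on A"
proof (rule summable_on_comparison_test)
  show "(\<lambda>n. (cmod (a n))\<^sup>2 + (cmod (b n))\<^sup>2) summable_on A"
    by (intro summable_on_add assms)
  fix n
  have "0 \<le> (cmod (a n) - cmod (b n))\<^sup>2" by simp
  then have "2 * (cmod (a n) * cmod (b n)) \<le> (cmod (a n))\<^sup>2 + (cmod (b n))\<^sup>2"
    unfolding power2_diff by simp
  moreover have "0 \<le> cmod (a n) * cmod (b n)" by simp
  ultimately show "norm (a n * b n) \<le> (cmod (a n))\<^sup>2 + (cmod (b n))\<^sup>2"
    unfolding norm_mult by linarith
qed simp

lemma square_summable_add:
  fixes a b :: "'i \<Rightarrow> complex"
  assumes "(\<lambda>n. (cmod (a n))\<^sup>2) summable_on A" "(\<lambda>n. (cmod (b n))\<^sup>2) summable_on A"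
  shows "(\<lambda>n. (cmod (a n + b n))\<^sup>2) summable_on A"
proof (rule summable_on_comparison_test)
  show "(\<lambda>n. 2 * ((cmod (a n))\<^sup>2 + (cmod (b n))\<^sup>2)) summable_on A"
    by (intro summable_on_cmult_right summable_on_add assms)
  fix n
  have "(cmod (a n + b n))\<^sup>2 \<le> (cmod (a n) + cmod (b n))\<^sup>2"
    by (intro power_mono norm_triangle_ineq) simp
  moreover have "0 \<le> (cmod (a n) - cmod (b n))\<^sup>2" by simp
  ultimately show "(cmod (a n + b n))\<^sup>2 \<le> 2 * ((cmod (a n))\<^sup>2 + (cmod (b n))\<^sup>2)"
    unfolding power2_diff power2_sum by (simp add: algebra_simps)
qed simp

lemma square_summable_scaleR:
  fixes a :: "'i \<Rightarrow> complex"
  assumes "(\<lambda>n. (cmod (a n))\<^sup>2) summable_on A"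
  shows "(\<lambda>n. (cmod (r *\<^sub>R a n))\<^sup>2) summable_on A"
  using summable_on_cmult_right[OF assms, of "r\<^sup>2"] by (simp add: power_mult_distrib)

lift_definition cinner :: "ell2 \<Rightarrow> ell2 \<Rightarrow> complex"
  is "\<lambda>a b. \<Sum>\<^sub>\<infinity>n. a n * cnj (b n)" .

lemma cinner_summable: "(\<lambda>n. coord a n * cnj (coord b n)) summable_on UNIV"
  by (rule abs_summable_summable, rule square_summable_mult)
     (use coord_summable in simp_all)

instantiation ell2 :: real_vector
begin

lift_definition zero_ell2 :: ell2 is "\<lambda>_. 0" by simp
lift_definition plus_ell2 :: "ell2 \<Rightarrow> ell2 \<Rightarrow> ell2" is "\<lambda>a b n. a n + b n"
  by (rule square_summable_add)
lift_definition uminus_ell2 :: "ell2 \<Rightarrow> ell2" is "\<lambda>a n. - a n" by simp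
lift_definition minus_ell2 :: "ell2 \<Rightarrow> ell2 \<Rightarrow> ell2" is "\<lambda>a b n. a n - b n"
  subgoal for a b using square_summable_add[of a UNIV "\<lambda>n. - b n"] by simp
  done
lift_definition scaleR_ell2 :: "real \<Rightarrow> ell2 \<Rightarrow> ell2" is "\<lambda>r a n. r *\<^sub>R a n"
  by (rule square_summable_scaleR)

instance
  by standard (transfer, simp add: algebra_simps)+

end

lemmas coord_simps [simp] =
  zero_ell2.rep_eq plus_ell2.rep_eq uminus_ell2.rep_eq minus_ell2.rep_eq scaleR_ell2.rep_eq

text \<open>Only the real structure is covered by the type classes; the real inner product is
  the real part of the complex one, so both induce the same norm.\<close>

instantiation ell2 :: real_inner
begin

definition inner_ell2 :: "ell2 \<Rightarrow> ell2 \<Rightarrow> real"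
  where "inner_ell2 a b = Re (cinner a b)"
definition norm_ell2 :: "ell2 \<Rightarrow> real"
  where "norm_ell2 a = sqrt (\<Sum>\<^sub>\<infinity>n. (cmod (coord a n))\<^sup>2)"
definition sgn_ell2 :: "ell2 \<Rightarrow> ell2"
  where "sgn_ell2 a = inverse (norm a) *\<^sub>R a"
definition dist_ell2 :: "ell2 \<Rightarrow> ell2 \<Rightarrow> real"
  where "dist_ell2 a b = norm (a - b)"
definition uniformity_ell2 :: "(ell2 \<times> ell2) filter"
  where "uniformity_ell2 = (INF e\<in>{0 <..}. principal {(x, y). dist x y < e})"
definition open_ell2 :: "ell2 set \<Rightarrow> bool"
  where "open_ell2 U \<longleftrightarrow> (\<forall>x\<in>U. eventually (\<lambda>(x', y). x' = x \<longrightarrow> y \<in> U) uniformity)"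

lemma inner_ell2_self: "inner a a = (\<Sum>\<^sub>\<infinity>n. (cmod (coord a n))\<^sup>2)"
proof -
  have "cinner a a = (\<Sum>\<^sub>\<infinity>n. complex_of_real ((cmod (coord a n))\<^sup>2))"
    unfolding cinner.rep_eq by (simp only: complex_norm_square)
  also have "\<dots> = complex_of_real (\<Sum>\<^sub>\<infinity>n. (cmod (coord a n))\<^sup>2)"
    using has_sum_of_real[OF has_sum_infsum[OF coord_summable[of a]]] by (rule infsumI)
  finally show ?thesis by (simp add: inner_ell2_def)
qed

instance
proof
  fix x y z :: ell2 and r :: real
  show "inner x y = inner y x"
  proof -
    have "cinner y x = cnj (cinner x y)"
      unfolding cinner.rep_eq infsum_cnj[symmetric] by (simp add: mult.commute)
    then show ?thesis by (simp add: inner_ell2_def)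
  qed
  show "inner (x + y) z = inner x z + inner y z"
    unfolding inner_ell2_def cinner.rep_eq
    using infsum_add[OF cinner_summable[of x z] cinner_summable[of y z]]
    by (simp add: distrib_right)
  show "inner (r *\<^sub>R x) y = r * inner x y"
    unfolding inner_ell2_def cinner.rep_eq
    using infsum_scaleR_right[of r "\<lambda>n. coord x n * cnj (coord y n)" UNIV] by simp
  show "0 \<le> inner x x"
    unfolding inner_ell2_self by (rule infsum_nonneg) simp
  show "norm x = sqrt (inner x x)"
    by (simp add: norm_ell2_def inner_ell2_self)
  show "inner x x = 0 \<longleftrightarrow> x = 0"
  proof
    assume "inner x x = 0"
    then have "(cmod (coord x n))\<^sup>2 = 0" for n
      unfolding inner_ell2_self
      using nonneg_infsum_le_0D[of "\<lambda>n. (cmod (coord x n))\<^sup>2" UNIV] coord_summable by auto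
    then show "x = 0" by (intro ell2_eqI) simp
  qed (simp add: inner_ell2_self)
qed (simp_all add: sgn_ell2_def dist_ell2_def uniformity_ell2_def open_ell2_def)

end

lemma norm_ell2_square: "(norm a)\<^sup>2 = (\<Sum>\<^sub>\<infinity>n. (cmod (coord a n))\<^sup>2)"
  by (simp add: power2_norm_eq_inner inner_ell2_self)

lemma sum_coord_le_norm: "finite F \<Longrightarrow> (\<Sum>n\<in>F. (cmod (coord a n))\<^sup>2) \<le> (norm a)\<^sup>2"
  unfolding norm_ell2_square
  by (rule finite_sum_le_infsum) (use coord_summable in auto)

lemma coord_le_norm: "cmod (coord a n) \<le> norm a"
  using sum_coord_le_norm[of "{n}" a] by (simp add: power2_le_iff_abs_le)

lemma square_summable_bounded:
  fixes f :: "int \<Rightarrow> complex"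
  assumes "\<And>F. finite F \<Longrightarrow> (\<Sum>n\<in>F. (cmod (f n))\<^sup>2) \<le> C\<^sup>2" "0 \<le> C"
  shows "(\<lambda>n. (cmod (f n))\<^sup>2) summable_on UNIV" "norm (Abs_ell2 f) \<le> C"
proof -
  show *: "(\<lambda>n. (cmod (f n))\<^sup>2) summable_on UNIV"
    by (rule nonneg_bounded_partial_sums_imp_summable_on[where C = "C\<^sup>2"])
       (use assms(1) in \<open>auto simp: eventually_finite_subsets_at_top\<close>)
  have "(norm (Abs_ell2 f))\<^sup>2 = (\<Sum>\<^sub>\<infinity>n. (cmod (f n))\<^sup>2)"
    using * by (simp add: norm_ell2_square Abs_ell2_inverse)
  also have "\<dots> \<le> C\<^sup>2"
    using * assms(1) by (rule infsum_le_finite_sums)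
  finally show "norm (Abs_ell2 f) \<le> C"
    using assms(2) power2_le_imp_le by blast
qed

instance ell2 :: banach
proof
  fix X :: "nat \<Rightarrow> ell2"
  assume "Cauchy X"
  have "Cauchy (\<lambda>i. coord (X i) n)" for n
  proof (rule metric_CauchyI)
    fix e :: real assume "0 < e"
    then obtain M where M: "\<And>i j. M \<le> i \<Longrightarrow> M \<le> j \<Longrightarrow> dist (X i) (X j) < e"
      using \<open>Cauchy X\<close> metric_CauchyD by metis
    have "dist (coord (X i) n) (coord (X j) n) < e" if "M \<le> i" "M \<le> j" for i j
      using M[OF that] coord_le_norm[of "X i - X j" n] by (simp add: dist_norm)
    then show "\<exists>M. \<forall>i\<ge>M. \<forall>j\<ge>M. dist (coord (X i) n) (coord (X j) n) < e" by blast
  qed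
  then have "\<exists>l. (\<lambda>i. coord (X i) n) \<longlonglongrightarrow> l" for n
    using Cauchy_convergent convergent_def by blast
  then obtain f where f: "\<And>n. (\<lambda>i. coord (X i) n) \<longlonglongrightarrow> f n" by metis
  have tail: "\<exists>M. \<forall>i\<ge>M. (\<lambda>n. (cmod (f n - coord (X i) n))\<^sup>2) summable_on UNIV
      \<and> norm (Abs_ell2 (\<lambda>n. f n - coord (X i) n)) \<le> e" if "0 < e" for e :: real
  proof -
    obtain M where M: "\<And>i j. M \<le> i \<Longrightarrow> M \<le> j \<Longrightarrow> dist (X i) (X j) < e"
      using \<open>Cauchy X\<close> \<open>0 < e\<close> metric_CauchyD by metis
    have "(\<Sum>n\<in>F. (cmod (f n - coord (X i) n))\<^sup>2) \<le> e\<^sup>2" if "M \<le> i" "finite F" for i F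
    proof (rule tendsto_upperbound)
      show "(\<lambda>j. \<Sum>n\<in>F. (cmod (coord (X j) n - coord (X i) n))\<^sup>2)
          \<longlonglongrightarrow> (\<Sum>n\<in>F. (cmod (f n - coord (X i) n))\<^sup>2)"
        by (intro tendsto_intros f)
      have "(\<Sum>n\<in>F. (cmod (coord (X j) n - coord (X i) n))\<^sup>2) \<le> e\<^sup>2" if "M \<le> j" for j
      proof -
        have "(\<Sum>n\<in>F. (cmod (coord (X j - X i) n))\<^sup>2) \<le> (norm (X j - X i))\<^sup>2"
          by (rule sum_coord_le_norm) fact
        also have "\<dots> \<le> e\<^sup>2"
          using M[OF \<open>M \<le> j\<close> \<open>M \<le> i\<close>] by (intro power_mono) (auto simp: dist_norm)
        finally show ?thesis by simp
      qed
      then show "\<forall>\<^sub>F j in sequentially. (\<Sum>n\<in>F. (cmod (coord (X j) n - coord (X i) n))\<^sup>2) \<le> e\<^sup>2"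
        using eventually_sequentially by blast
    qed simp
    then show ?thesis
      using square_summable_bounded[of _ e] \<open>0 < e\<close> by (meson less_imp_le)
  qed
  obtain i where "(\<lambda>n. (cmod (f n - coord (X i) n))\<^sup>2) summable_on UNIV"
    using tail[of 1] by auto
  then have "(\<lambda>n. (cmod (f n))\<^sup>2) summable_on UNIV"
    using square_summable_add[OF _ coord_summable[of "X i"]] by fastforce
  then have Y: "coord (Abs_ell2 f) = f" by (simp add: Abs_ell2_inverse)
  have diff: "Abs_ell2 (\<lambda>n. f n - coord (X i) n) = Abs_ell2 f - X i" for i
    by (metis (no_types, lifting) Y coord_inverse ext minus_ell2.rep_eq)
  have "X \<longlonglongrightarrow> Abs_ell2 f"
  proof (rule metric_LIMSEQ_I)
    fix r :: real assume "0 < r"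
    then obtain M where "\<And>i. M \<le> i \<Longrightarrow> norm (Abs_ell2 f - X i) \<le> r / 2"
      using tail[of "r / 2"] diff by auto
    then show "\<exists>M. \<forall>i\<ge>M. dist (X i) (Abs_ell2 f) < r"
      using \<open>0 < r\<close> by (intro exI[of _ M]) (force simp: dist_norm norm_minus_commute)
  qed
  then show "convergent X" by (rule convergentI)
qed


section \<open>The discrete Hilbert transform\<close>

text \<open>The operator is pi times the usual discrete Hilbert transform. Boundedness is shown by
  computing the kernel of the Gram operator: the sum over m of 1 / ((m - n) (m - l)) is
  2 / (n - l)^2 for distinct n and l. The proofs rely on the convention 1 / 0 = 0 for the
  diagonal terms.\<close>

lemma sum_inverse_shift_tendsto_0:
  fixes n :: int
  shows "(\<lambda>N. \<Sum>m\<in>{- int N..int N}. 1 / real_of_int (m - n)) \<longlonglongrightarrow> 0"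
proof -
  define A where "A = (\<lambda>n N. \<Sum>m\<in>{- int N..int N}. 1 / real_of_int (m - n))"
  have step: "A (n + 1) N - A n N = 1 / (- real N - n - 1) - 1 / (real N - n)" for n N
  proof -
    have "A (n + 1) N = (\<Sum>m\<in>{- int N - 1..int N - 1}. 1 / real_of_int (m - n))"
      unfolding A_def
      by (rule sum.reindex_bij_witness[of _ "\<lambda>m. m + 1" "\<lambda>m. m - 1"]) (auto simp: algebra_simps)
    also have "\<dots> + 1 / real_of_int (int N - n) = (\<Sum>m\<in>{- int N - 1..int N}. 1 / real_of_int (m - n))"
    proof -
      have "{- int N - 1..int N} = insert (int N) {- int N - 1..int N - 1}" by auto
      then show ?thesis by simp
    qed
    also have "\<dots> = 1 / real_of_int (- int N - 1 - n) + A n N"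
    proof -
      have "{- int N - 1..int N} = insert (- int N - 1) {- int N..int N}" by auto
      then show ?thesis by (simp add: A_def)
    qed
    finally show ?thesis by (simp add: algebra_simps)
  qed
  have lim: "(\<lambda>N. 1 / (- real N - of_int n - 1) - 1 / (real N - of_int n)) \<longlonglongrightarrow> 0" for n :: int
    by real_asymp
  have lim_iff: "A (n + 1) \<longlonglongrightarrow> 0 \<longleftrightarrow> A n \<longlonglongrightarrow> 0" for n
  proof
    assume "A (n + 1) \<longlonglongrightarrow> 0"
    from tendsto_diff[OF this lim[of n]] show "A n \<longlonglongrightarrow> 0"
      unfolding step[symmetric] by simp
  next
    assume "A n \<longlonglongrightarrow> 0"
    from tendsto_add[OF this lim[of n]] show "A (n + 1) \<longlonglongrightarrow> 0"
      unfolding step[symmetric] by simp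
  qed
  have "A 0 N = 0" for N
  proof -
    have "A 0 N = (\<Sum>m\<in>{- int N..int N}. 1 / real_of_int (- m))"
      unfolding A_def by (rule sum.reindex_bij_witness[of _ uminus uminus]) auto
    also have "\<dots> = - A 0 N" by (simp add: A_def sum_negf)
    finally show ?thesis by simp
  qed
  then have "A 0 = (\<lambda>_. 0)" by (rule ext)
  then have "A 0 \<longlonglongrightarrow> 0" by simp
  then have "A n \<longlonglongrightarrow> 0"
  proof (induction n rule: int_induct[where k = 0])
    case base then show ?case by simp
  next
    case (step1 i) then show ?case using lim_iff[of i] by simp
  next
    case (step2 i) then show ?case using lim_iff[of "i - 1"] by simp
  qed
  then show ?thesis by (simp add: A_def)
qed

lemma gram_tendsto:
  fixes n l :: int
  assumes "n \<noteq> l"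
  shows "(\<lambda>N. \<Sum>m\<in>{- int N..int N}. 1 / real_of_int (m - n) * (1 / real_of_int (m - l)))
    \<longlonglongrightarrow> 2 / (real_of_int (n - l))\<^sup>2"
proof -
  define d where "d = real_of_int (n - l)"
  have "d \<noteq> 0" using assms by (simp add: d_def)
  have kern: "1 / real_of_int (m - n) * (1 / real_of_int (m - l)) =
      1 / d * (1 / real_of_int (m - n) - 1 / real_of_int (m - l))
      + (if m = n then 1 / d\<^sup>2 else 0) + (if m = l then 1 / d\<^sup>2 else 0)" for m
  proof -
    consider "m = n" | "m = l" | "m \<noteq> n" "m \<noteq> l" by blast
    then show ?thesis
    proof cases
      case 1 then show ?thesis using assms \<open>d \<noteq> 0\<close> by (simp add: d_def power2_eq_square)
    next
      case 2
      then have "real_of_int (m - n) = - d" by (simp add: d_def)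
      then show ?thesis using 2 assms by (simp add: power2_eq_square)
    next
      case 3
      then have "real_of_int m - n \<noteq> 0" "real_of_int m - l \<noteq> 0" by auto
      then show ?thesis using 3 \<open>d \<noteq> 0\<close>
        by (simp add: d_def divide_simps)
    qed
  qed
  have "(\<lambda>N. 1 / d * ((\<Sum>m\<in>{- int N..int N}. 1 / real_of_int (m - n))
        - (\<Sum>m\<in>{- int N..int N}. 1 / real_of_int (m - l))) + 1 / d\<^sup>2 + 1 / d\<^sup>2)
      \<longlonglongrightarrow> 1 / d * (0 - 0) + 1 / d\<^sup>2 + 1 / d\<^sup>2"
    by (intro tendsto_intros sum_inverse_shift_tendsto_0)
  moreover have "\<forall>\<^sub>F N in sequentially.
      1 / d * ((\<Sum>m\<in>{- int N..int N}. 1 / real_of_int (m - n))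
        - (\<Sum>m\<in>{- int N..int N}. 1 / real_of_int (m - l))) + 1 / d\<^sup>2 + 1 / d\<^sup>2 =
      (\<Sum>m\<in>{- int N..int N}. 1 / real_of_int (m - n) * (1 / real_of_int (m - l)))"
    using eventually_ge_at_top[of "nat (\<bar>n\<bar> + \<bar>l\<bar>)"]
  proof eventually_elim
    case (elim N)
    then have "n \<in> {- int N..int N}" "l \<in> {- int N..int N}" by auto
    then show ?case
      unfolding kern by (simp add: sum.distrib sum_divide_distrib[symmetric] sum_subtractf[symmetric])
  qed
  ultimately show ?thesis
    using Lim_transform_eventually by (fastforce simp: d_def)
qed

lemma inverse_square_summable_int:
  "(\<lambda>n. 1 / (real_of_int (n - k))\<^sup>2) summable_on UNIV"
proof -
  have nat: "(\<lambda>n. 1 / (real n)\<^sup>2) summable_on UNIV"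
    by (rule summable_nonneg_imp_summable_on)
       (use inverse_power_summable[of 2, where 'a = real] in \<open>simp_all add: inverse_eq_divide\<close>)
  have "(\<lambda>n. 1 / (real_of_int n)\<^sup>2) summable_on range int"
    using nat by (subst summable_on_reindex) (auto simp: o_def)
  moreover have "(\<lambda>n. 1 / (real_of_int n)\<^sup>2) summable_on range (\<lambda>n. - int n)"
    using nat by (subst summable_on_reindex) (auto simp: o_def inj_on_def)
  ultimately have "(\<lambda>n. 1 / (real_of_int n)\<^sup>2) summable_on (range int \<union> range (\<lambda>n. - int n))"
    by (rule summable_on_union)
  moreover have "range int \<union> range (\<lambda>n. - int n) = UNIV"
    by (auto simp: image_iff) (metis int_cases2)
  ultimately have *: "(\<lambda>n. 1 / (real_of_int n)\<^sup>2) summable_on UNIV" by simp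
  have "bij_betw (\<lambda>n. n - k) UNIV (UNIV :: int set)"
    by (rule bij_betwI[of _ _ _ "\<lambda>n. n + k"]) auto
  from summable_on_reindex_bij_betw[OF this, of "\<lambda>n. 1 / (real_of_int n)\<^sup>2"] *
  show ?thesis by simp
qed

lemma infsum_inverse_square_shift:
  "(\<Sum>\<^sub>\<infinity>n. 1 / (real_of_int (n - k))\<^sup>2) = (\<Sum>\<^sub>\<infinity>n. 1 / (real_of_int n)\<^sup>2)"
proof -
  have "bij_betw (\<lambda>n. n - k) UNIV (UNIV :: int set)"
    by (rule bij_betwI[of _ _ _ "\<lambda>n. n + k"]) auto
  from infsum_reindex_bij_betw[OF this, of "\<lambda>n. 1 / (real_of_int n)\<^sup>2"]
  show ?thesis by simp
qed

lemma hilbert_inequality: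
  fixes f :: "int \<Rightarrow> complex"
  defines "c \<equiv> (\<Sum>\<^sub>\<infinity>n. 1 / (real_of_int n)\<^sup>2)"
  assumes "finite F" "finite M"
  shows "(\<Sum>m\<in>M. (cmod (\<Sum>n\<in>F. f n / of_int (m - n)))\<^sup>2) \<le> 3 * c * (\<Sum>n\<in>F. (cmod (f n))\<^sup>2)"
proof -
  have c_nonneg: "0 \<le> c" unfolding c_def by (rule infsum_nonneg) simp
  have c_ge: "(\<Sum>m\<in>B. 1 / (real_of_int (m - k))\<^sup>2) \<le> c" if "finite B" for B k
    unfolding c_def infsum_inverse_square_shift[of k, symmetric]
    by (rule finite_sum_le_infsum) (use inverse_square_summable_int that in auto)
  define S where "S = (\<lambda>N n l. \<Sum>m\<in>{- int N..int N}. 1 / real_of_int (m - n) * (1 / real_of_int (m - l)))"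
  define T where "T = (\<lambda>N. \<Sum>m\<in>{- int N..int N}. (cmod (\<Sum>n\<in>F. f n / of_int (m - n)))\<^sup>2)"
  define s where "s = (\<lambda>n l :: int. (if n = l then c else 0) + 2 / (real_of_int (n - l))\<^sup>2)"
  have T_eq: "T N \<le> (\<Sum>n\<in>F. \<Sum>l\<in>F. cmod (f n) * cmod (f l) * \<bar>S N n l\<bar>)" for N
  proof -
    have "complex_of_real (T N) =
        (\<Sum>m\<in>{- int N..int N}. (\<Sum>n\<in>F. f n / of_int (m - n)) * cnj (\<Sum>n\<in>F. f n / of_int (m - n)))"
      unfolding T_def of_real_sum by (simp only: complex_norm_square)
    also have "\<dots> = (\<Sum>m\<in>{- int N..int N}. \<Sum>n\<in>F. \<Sum>l\<in>F.
        f n * cnj (f l) * of_real (1 / real_of_int (m - n) * (1 / real_of_int (m - l))))"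
      unfolding cnj_sum sum_product by (intro sum.cong refl) simp
    also have "\<dots> = (\<Sum>n\<in>F. \<Sum>m\<in>{- int N..int N}. \<Sum>l\<in>F.
        f n * cnj (f l) * of_real (1 / real_of_int (m - n) * (1 / real_of_int (m - l))))"
      by (rule sum.swap)
    also have "\<dots> = (\<Sum>n\<in>F. \<Sum>l\<in>F. \<Sum>m\<in>{- int N..int N}.
        f n * cnj (f l) * of_real (1 / real_of_int (m - n) * (1 / real_of_int (m - l))))"
      by (rule sum.cong[OF refl], rule sum.swap)
    also have "\<dots> = (\<Sum>n\<in>F. \<Sum>l\<in>F. f n * cnj (f l) * of_real (S N n l))"
      unfolding S_def of_real_sum sum_distrib_left ..
    finally have *: "complex_of_real (T N) = (\<Sum>n\<in>F. \<Sum>l\<in>F. f n * cnj (f l) * of_real (S N n l))" .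
    have "0 \<le> T N" unfolding T_def by (intro sum_nonneg) simp
    then have "T N = cmod (\<Sum>n\<in>F. \<Sum>l\<in>F. f n * cnj (f l) * of_real (S N n l))"
      unfolding *[symmetric] by simp
    also have "\<dots> \<le> (\<Sum>n\<in>F. \<Sum>l\<in>F. cmod (f n) * cmod (f l) * \<bar>S N n l\<bar>)"
      by (rule order_trans[OF norm_sum], rule sum_mono, rule order_trans[OF norm_sum], rule sum_mono)
         (simp add: norm_mult)
    finally show ?thesis .
  qed
  have schur: "(\<Sum>n\<in>F. \<Sum>l\<in>F. cmod (f n) * cmod (f l) * s n l) \<le> 3 * c * (\<Sum>n\<in>F. (cmod (f n))\<^sup>2)"
  proof -
    have s_nonneg: "0 \<le> s n l" for n l using c_nonneg by (simp add: s_def)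
    have s_sym: "s n l = s l n" for n l by (simp add: s_def power2_commute)
    have row: "(\<Sum>l\<in>F. s n l) \<le> 3 * c" if "n \<in> F" for n
    proof -
      have "(\<Sum>l\<in>F. s n l) = c + 2 * (\<Sum>l\<in>F. 1 / (real_of_int (l - n))\<^sup>2)"
        using that \<open>finite F\<close>
        by (simp add: s_def sum.distrib sum_distrib_left power2_commute[of "real_of_int n"])
      then show ?thesis using c_ge[OF \<open>finite F\<close>, of n] by linarith
    qed
    have am: "cmod (f n) * cmod (f l) * s n l \<le> (cmod (f n))\<^sup>2 * s n l / 2 + (cmod (f l))\<^sup>2 * s n l / 2" for n l
    proof -
      have "0 \<le> (cmod (f n) - cmod (f l))\<^sup>2 * s n l" using s_nonneg by simp
      then show ?thesis by (simp add: power2_diff algebra_simps)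
    qed
    have "(\<Sum>n\<in>F. \<Sum>l\<in>F. cmod (f n) * cmod (f l) * s n l)
        \<le> (\<Sum>n\<in>F. \<Sum>l\<in>F. (cmod (f n))\<^sup>2 * s n l / 2 + (cmod (f l))\<^sup>2 * s n l / 2)"
      by (intro sum_mono am)
    also have "\<dots> = (\<Sum>n\<in>F. \<Sum>l\<in>F. (cmod (f n))\<^sup>2 * s n l / 2) + (\<Sum>n\<in>F. \<Sum>l\<in>F. (cmod (f l))\<^sup>2 * s n l / 2)"
      by (simp add: sum.distrib)
    also have "(\<Sum>n\<in>F. \<Sum>l\<in>F. (cmod (f l))\<^sup>2 * s n l / 2) = (\<Sum>n\<in>F. \<Sum>l\<in>F. (cmod (f n))\<^sup>2 * s n l / 2)"
      by (rule trans[OF sum.swap], intro sum.cong refl, subst s_sym, rule refl)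
    also have "(\<Sum>n\<in>F. \<Sum>l\<in>F. (cmod (f n))\<^sup>2 * s n l / 2) + \<dots> = (\<Sum>n\<in>F. (cmod (f n))\<^sup>2 * (\<Sum>l\<in>F. s n l))"
      unfolding sum_distrib_left sum.distrib[symmetric] by (intro sum.cong refl) simp
    also have "\<dots> \<le> (\<Sum>n\<in>F. (cmod (f n))\<^sup>2 * (3 * c))"
      by (intro sum_mono mult_left_mono row) auto
    also have "\<dots> = 3 * c * (\<Sum>n\<in>F. (cmod (f n))\<^sup>2)"
      by (simp add: sum_distrib_left mult.commute)
    finally show ?thesis .
  qed
  define U where "U = (\<lambda>N. \<Sum>n\<in>F. \<Sum>l\<in>F. cmod (f n) * cmod (f l) * (if n = l then c else \<bar>S N n l\<bar>))"
  have U_lim: "U \<longlonglongrightarrow> (\<Sum>n\<in>F. \<Sum>l\<in>F. cmod (f n) * cmod (f l) * s n l)"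
    unfolding U_def
  proof (intro tendsto_sum tendsto_mult tendsto_const)
    fix n l
    show "(\<lambda>N. if n = l then c else \<bar>S N n l\<bar>) \<longlonglongrightarrow> s n l"
    proof (cases "n = l")
      case True then show ?thesis by (simp add: s_def)
    next
      case False
      from tendsto_rabs[OF gram_tendsto[OF False]] False show ?thesis
        by (simp add: s_def S_def)
    qed
  qed
  have T_le_U: "T N \<le> U N" for N
  proof -
    have "\<bar>S N n n\<bar> \<le> c" for n
      using c_ge[of "{- int N..int N}" n] by (simp add: S_def power2_eq_square sum_nonneg)
    then have "(\<Sum>n\<in>F. \<Sum>l\<in>F. cmod (f n) * cmod (f l) * \<bar>S N n l\<bar>) \<le> U N"
      unfolding U_def by (intro sum_mono mult_left_mono) auto
    with T_eq[of N] show ?thesis by linarith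
  qed
  have "(\<Sum>m\<in>M. (cmod (\<Sum>n\<in>F. f n / of_int (m - n)))\<^sup>2) \<le> (\<Sum>n\<in>F. \<Sum>l\<in>F. cmod (f n) * cmod (f l) * s n l)"
  proof (rule tendsto_lowerbound[OF U_lim])
    obtain K where K: "\<And>m. m \<in> M \<Longrightarrow> \<bar>m\<bar> \<le> K"
    proof
      show "\<bar>m\<bar> \<le> Max (abs ` M)" if "m \<in> M" for m
        using that \<open>finite M\<close> by (intro Max_ge) auto
    qed
    have "(\<Sum>m\<in>M. (cmod (\<Sum>n\<in>F. f n / of_int (m - n)))\<^sup>2) \<le> U N" if "nat K \<le> N" for N
    proof -
      have "M \<subseteq> {- int N..int N}" using K that by fastforce
      then have "(\<Sum>m\<in>M. (cmod (\<Sum>n\<in>F. f n / of_int (m - n)))\<^sup>2) \<le> T N"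
        unfolding T_def by (intro sum_mono2) auto
      with T_le_U[of N] show ?thesis by linarith
    qed
    then show "\<forall>\<^sub>F N in sequentially. (\<Sum>m\<in>M. (cmod (\<Sum>n\<in>F. f n / of_int (m - n)))\<^sup>2) \<le> U N"
      using eventually_sequentially by blast
  qed simp
  with schur show ?thesis by linarith
qed

definition discrete_hilbert_seq :: "(int \<Rightarrow> complex) \<Rightarrow> int \<Rightarrow> complex"
  where "discrete_hilbert_seq a m = (\<Sum>\<^sub>\<infinity>n\<in>UNIV - {m}. a n / of_int (m - n))"

lemma discrete_hilbert_has_sum:
  assumes "(\<lambda>n. (cmod (a n))\<^sup>2) summable_on UNIV"
  shows "((\<lambda>n. a n / of_int (m - n)) has_sum discrete_hilbert_seq a m) UNIV"
proof -
  have "(\<lambda>n. (cmod (1 / of_int (m - n)))\<^sup>2) summable_on UNIV"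
  proof -
    have "(cmod (1 / of_int (m - n)))\<^sup>2 = 1 / (real_of_int (n - m))\<^sup>2" for n
      unfolding norm_divide norm_of_int power_divide by (simp add: power2_commute)
    then show ?thesis using inverse_square_summable_int[of m] by simp
  qed
  from abs_summable_summable[OF square_summable_mult[OF assms this]]
  have "(\<lambda>n. a n / of_int (m - n)) summable_on UNIV"
    by simp
  moreover have "discrete_hilbert_seq a m = (\<Sum>\<^sub>\<infinity>n. a n / of_int (m - n))"
    unfolding discrete_hilbert_seq_def by (rule infsum_cong_neutral) auto
  ultimately show ?thesis by simp
qed

lemma discrete_hilbert_bound:
  "\<exists>C\<ge>0. \<forall>a. (\<forall>F. finite F \<longrightarrow>
    (\<Sum>m\<in>F. (cmod (discrete_hilbert_seq (coord a) m))\<^sup>2) \<le> (norm a * C)\<^sup>2)"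
proof -
  define c where "c = (\<Sum>\<^sub>\<infinity>n. 1 / (real_of_int n)\<^sup>2)"
  have "0 \<le> c" unfolding c_def by (rule infsum_nonneg) simp
  have "(\<Sum>m\<in>M. (cmod (discrete_hilbert_seq (coord a) m))\<^sup>2) \<le> (norm a * sqrt (3 * c))\<^sup>2"
    if "finite M" for a M
  proof (rule tendsto_upperbound)
    show "((\<lambda>F. \<Sum>m\<in>M. (cmod (\<Sum>n\<in>F. coord a n / of_int (m - n)))\<^sup>2) \<longlongrightarrow>
        (\<Sum>m\<in>M. (cmod (discrete_hilbert_seq (coord a) m))\<^sup>2)) (finite_subsets_at_top UNIV)"
      using discrete_hilbert_has_sum[OF coord_summable[of a]]
      unfolding has_sum_def by (intro tendsto_intros)
    have "(\<Sum>m\<in>M. (cmod (\<Sum>n\<in>F. coord a n / of_int (m - n)))\<^sup>2) \<le> (norm a * sqrt (3 * c))\<^sup>2"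
      if "finite F" for F
    proof -
      have "(\<Sum>m\<in>M. (cmod (\<Sum>n\<in>F. coord a n / of_int (m - n)))\<^sup>2) \<le> 3 * c * (\<Sum>n\<in>F. (cmod (coord a n))\<^sup>2)"
        unfolding c_def by (rule hilbert_inequality) fact+
      also have "\<dots> \<le> 3 * c * (norm a)\<^sup>2"
        using \<open>0 \<le> c\<close> by (intro mult_left_mono sum_coord_le_norm that) auto
      also have "\<dots> = (norm a * sqrt (3 * c))\<^sup>2"
        using \<open>0 \<le> c\<close> by (simp add: power_mult_distrib)
      finally show ?thesis .
    qed
    then show "\<forall>\<^sub>F F in finite_subsets_at_top UNIV.
        (\<Sum>m\<in>M. (cmod (\<Sum>n\<in>F. coord a n / of_int (m - n)))\<^sup>2) \<le> (norm a * sqrt (3 * c))\<^sup>2"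
      by (intro eventually_finite_subsets_at_top_weakI)
  qed simp
  then show ?thesis using \<open>0 \<le> c\<close> by (intro exI[of _ "sqrt (3 * c)"]) simp
qed

lift_definition discrete_hilbert_fun :: "ell2 \<Rightarrow> ell2" is discrete_hilbert_seq
proof -
  fix a :: "int \<Rightarrow> complex"
  assume a: "(\<lambda>n. (cmod (a n))\<^sup>2) summable_on UNIV"
  obtain C where "C \<ge> 0" and C: "\<And>a F. finite F \<Longrightarrow>
      (\<Sum>m\<in>F. (cmod (discrete_hilbert_seq (coord a) m))\<^sup>2) \<le> (norm a * C)\<^sup>2"
    using discrete_hilbert_bound by blast
  from square_summable_bounded(1)[OF C[of _ "Abs_ell2 a"]] \<open>C \<ge> 0\<close> a
  show "(\<lambda>m. (cmod (discrete_hilbert_seq a m))\<^sup>2) summable_on UNIV"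
    by (simp add: Abs_ell2_inverse)
qed

lemma bounded_linear_discrete_hilbert_fun: "bounded_linear discrete_hilbert_fun"
proof -
  obtain C where "C \<ge> 0" and C: "\<And>a F. finite F \<Longrightarrow>
      (\<Sum>m\<in>F. (cmod (discrete_hilbert_seq (coord a) m))\<^sup>2) \<le> (norm a * C)\<^sup>2"
    using discrete_hilbert_bound by blast
  show ?thesis
  proof (rule bounded_linear_intro[where K = C])
    fix x y :: ell2 and r :: real
    note hs = discrete_hilbert_has_sum[OF coord_summable]
    show "discrete_hilbert_fun (x + y) = discrete_hilbert_fun x + discrete_hilbert_fun y"
    proof (rule ell2_eqI)
      fix m
      show "coord (discrete_hilbert_fun (x + y)) m = coord (discrete_hilbert_fun x + discrete_hilbert_fun y) m"
        using has_sum_unique[OF hs[of "x + y" m]] has_sum_add[OF hs[of x m] hs[of y m]]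
        by (simp add: discrete_hilbert_fun.rep_eq add_divide_distrib)
    qed
    show "discrete_hilbert_fun (r *\<^sub>R x) = r *\<^sub>R discrete_hilbert_fun x"
    proof (rule ell2_eqI)
      fix m
      show "coord (discrete_hilbert_fun (r *\<^sub>R x)) m = coord (r *\<^sub>R discrete_hilbert_fun x) m"
        using has_sum_unique[OF hs[of "r *\<^sub>R x" m]] has_sum_scaleR[OF hs[of x m], of r]
        by (simp add: discrete_hilbert_fun.rep_eq scaleR_conv_of_real)
    qed
    show "norm (discrete_hilbert_fun x) \<le> norm x * C"
      using square_summable_bounded(2)[OF C[of _ x]] \<open>C \<ge> 0\<close>
      by (metis coord_inverse discrete_hilbert_fun.rep_eq mult_nonneg_nonneg norm_ge_zero)
  qed
qed

lift_definition discrete_hilbert :: "ell2 \<Rightarrow>\<^sub>L ell2" is discrete_hilbert_fun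
  by (rule bounded_linear_discrete_hilbert_fun)

lemma coord_discrete_hilbert:
  "coord (discrete_hilbert a) m = (\<Sum>\<^sub>\<infinity>n\<in>UNIV - {m}. coord a n / of_int (m - n))"
  by (simp add: discrete_hilbert.rep_eq discrete_hilbert_fun.rep_eq discrete_hilbert_seq_def)

text \<open>The exponential is the operator-norm convergent power series; the type of bounded
  operators is not an instance of the Banach algebra class, so \<^const>\<open>exp\<close> is not available.\<close>

definition exp_hilbert :: "real \<Rightarrow> ell2 \<Rightarrow>\<^sub>L ell2"
  where "exp_hilbert t =
    (\<Sum>k. (t ^ k / fact k) *\<^sub>R ((blinfun_compose discrete_hilbert) ^^ k) id_blinfun)"


section \<open>The interpolated function and the interpolating kernel\<close>

definition Psi :: "ell2 \<Rightarrow> ell2 \<Rightarrow> real \<Rightarrow> complex"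
  where "Psi a b t =
    (if t = 0 then cinner (discrete_hilbert a) b
     else cinner ((1 / t) *\<^sub>R (exp_hilbert t a - a)) b)"

definition G :: "(int \<Rightarrow> real) \<Rightarrow> complex \<Rightarrow> complex"
  where "G t z = (z - of_real (t 0)) *
    (\<Prod>k. (1 - z / of_real (t (int (Suc k)))) * (1 - z / of_real (t (- int (Suc k)))))"

text \<open>At a node the quotient is replaced by its limit 1.\<close>

definition lagrange_kernel :: "(int \<Rightarrow> real) \<Rightarrow> int \<Rightarrow> real \<Rightarrow> complex"
  where "lagrange_kernel t k x =
    (if x = t k then 1
     else G t (of_real x) / (deriv (G t) (of_real (t k)) * of_real (x - t k)))"

end

theory Submission
  imports Defs
begin

text \<open>Write $U(t)$ for $e^{tH}$. In Fourier series $H$ is multiplication by $i(\pi-\theta)$ on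
$(0,2\pi)$, so $U$ is a unitary group and the functions $F_a(x) = (U(x)a)_0$, $a \in l^2$, form the
space of square-integrable functions on the line with spectrum in $[-\pi,\pi]$. The whole proof is
carried out with the vectors $a$ in place of the functions $F_a$, and Fourier integrals are replaced
by explicit matrices: the entry of $U(t)$ in row $m$ and column $n$ is $\sin(\pi t)/(\pi(t+m-n))$
(\<open>exp_hilbert_single_coord\<close>). This follows from a differential equation, whose verification is the
partial fraction expansion of the cotangent. In particular
$F_a(x) = \sum_n a_n \sin(\pi x)/(\pi(x-n))$, $F_a(n) = (-1)^n a_n$, and
$|F_a(x)| \le \|a\|$ for all real $x$.

The function $\Psi$ is one of these functions: $\Psi = F_v$ with $v_n = (-1)^n\Psi(n)$
(\<open>Psi_eq_coord_exp_hilbert\<close>). So the claim is an interpolation theorem for $F_v$.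

Sampling at the nodes defines the operator $(Sa)_k = (-1)^k F_a(t_k)$, which is the identity when
$t_k = k$. Kadec's argument (\<open>kadec_sampling\<close>) gives $\|a - Sa\| \le q\|a\|$ with
$q = 1 - \cos\pi D + \sin\pi D < 1$ whenever $|t_k - k| \le D < 1/4$. Hence $S$ is bijective with
bounded inverse. Let $S e_k$ be the $k$-th unit vector. Expanding $Sv$ in unit vectors and applying
the inverse of $S$ gives $v = \sum_k (Sv)_k e_k$ in norm, and the bound
$|F_a(x)| \le \|a\|$ turns this into unconditional convergence of
$\Psi(x) = \sum_k (-1)^k\Psi(t_k) F_{e_k}(x)$, uniformly on the line.

It remains to see that $(-1)^k F_{e_k}$ is the Lagrange kernel of $G$
(\<open>kernel_is_dual_function\<close>). Growth estimates for $G$ are avoided as follows. Replace $t_j$ by $j$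
for $|j| > N$. Then $G$ is replaced by $\sin(\pi x)$ times a rational function with simple poles at
$-N,\dots,N$, and its partial fraction decomposition exhibits the corresponding kernel as some
$F_w$ with finitely supported $w$. Kadec's bound holds with the same $q$ for all $N$, so the vectors
$w$ converge to $e_k$ as $N \to \infty$, while the explicit products converge to $G$.\<close>

section \<open>The space of square-summable sequences\<close>

lift_definition single :: "int \<Rightarrow> complex \<Rightarrow> ell2" is "\<lambda>p z n. if n = p then z else 0"
proof -
  fix p :: int and z :: complex
  have "finite {n. (if n = p then z else 0) \<noteq> 0}" by (rule finite_subset[of _ "{p}"]) auto
  then show "(\<lambda>n. (cmod (if n = p then z else 0))\<^sup>2) summable_on UNIV"
    by (intro finite_nonzero_values_imp_summable_on) (auto elim: finite_subset[rotated])
qed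

lemma coord_sum [simp]: "coord (\<Sum>i\<in>I. f i) n = (\<Sum>i\<in>I. coord (f i) n)"
  by (induction I rule: infinite_finite_induct) auto

lemma coord_sum_single:
  assumes "finite F"
  shows "coord (\<Sum>p\<in>F. single p (c p)) n = (if n \<in> F then c n else 0)"
  using assms by (simp add: single.rep_eq)

lemma has_sum_diff':
  fixes f g :: "'i \<Rightarrow> 'b :: real_normed_vector"
  assumes "(f has_sum s) A" "(g has_sum t) A"
  shows "((\<lambda>x. f x - g x) has_sum s - t) A"
  using has_sum_add[OF assms(1), of "\<lambda>x. - g x" "- t"] assms(2) by (simp add: has_sum_uminus)

text \<open>The squared norm of the remainder is the tail of the convergent series of squared moduli.\<close>

lemma has_sum_single: "((\<lambda>n. single n (coord a n)) has_sum a) UNIV"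
proof -
  let ?s = "\<lambda>F. \<Sum>n\<in>F. single n (coord a n)"
  have norm_rest: "(norm (?s F - a))\<^sup>2 = (norm a)\<^sup>2 - (\<Sum>n\<in>F. (cmod (coord a n))\<^sup>2)" if "finite F" for F
  proof -
    have split: "(cmod (coord (?s F - a) n))\<^sup>2
        = (cmod (coord a n))\<^sup>2 - (if n \<in> F then (cmod (coord a n))\<^sup>2 else 0)" for n
      using that by (simp add: single.rep_eq)
    have "((\<lambda>n. (cmod (coord a n))\<^sup>2) has_sum (norm a)\<^sup>2) UNIV"
      unfolding norm_ell2_square by (rule has_sum_infsum[OF coord_summable])
    moreover have "((\<lambda>n. if n \<in> F then (cmod (coord a n))\<^sup>2 else 0)
        has_sum (\<Sum>n\<in>F. (cmod (coord a n))\<^sup>2)) UNIV"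
      by (rule has_sum_cong_neutral[THEN iffD1, OF _ _ _ has_sum_finite[OF that]]) auto
    ultimately have "((\<lambda>n. (cmod (coord a n))\<^sup>2 - (if n \<in> F then (cmod (coord a n))\<^sup>2 else 0))
        has_sum (norm a)\<^sup>2 - (\<Sum>n\<in>F. (cmod (coord a n))\<^sup>2)) UNIV"
      by (rule has_sum_diff')
    from infsumI[OF this] show ?thesis unfolding norm_ell2_square split .
  qed
  have "((\<lambda>F. \<Sum>n\<in>F. (cmod (coord a n))\<^sup>2) \<longlongrightarrow> (norm a)\<^sup>2) (finite_subsets_at_top UNIV)"
    using has_sum_infsum[OF coord_summable[of a]] unfolding norm_ell2_square has_sum_def .
  then have "((\<lambda>F. (norm a)\<^sup>2 - (\<Sum>n\<in>F. (cmod (coord a n))\<^sup>2)) \<longlongrightarrow> 0) (finite_subsets_at_top UNIV)"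
    using tendsto_diff[OF tendsto_const, of _ "(norm a)\<^sup>2" _ "(norm a)\<^sup>2"] by simp
  moreover have "\<forall>\<^sub>F F in finite_subsets_at_top UNIV.
      (norm a)\<^sup>2 - (\<Sum>n\<in>F. (cmod (coord a n))\<^sup>2) = (norm (?s F - a))\<^sup>2"
    by (intro eventually_finite_subsets_at_top_weakI) (simp add: norm_rest)
  ultimately have "((\<lambda>F. (norm (?s F - a))\<^sup>2) \<longlongrightarrow> 0) (finite_subsets_at_top UNIV)"
    by (rule Lim_transform_eventually)
  from tendsto_real_sqrt[OF this] have "((\<lambda>F. norm (?s F - a)) \<longlongrightarrow> 0) (finite_subsets_at_top UNIV)"
    by simp
  then show ?thesis
    unfolding has_sum_def by (simp add: tendsto_norm_zero_iff LIM_zero_iff)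
qed

text \<open>Finitely supported sequences are dense. Scalars are real in the type classes used here, hence
the arbitrary complex entry \<open>z\<close> in place of unit vectors.\<close>

lemma bounded_linear_eq_on_singles:
  assumes "bounded_linear f" "bounded_linear g" "\<And>p z. f (single p z) = g (single p z)"
  shows "f a = g a"
  using has_sum_unique[OF has_sum_bounded_linear[OF assms(1) has_sum_single]]
    has_sum_bounded_linear[OF assms(2) has_sum_single] assms(3) by (simp add: has_sum_unique)

lemma bounded_bilinear_eq_on_singles:
  assumes "bounded_bilinear f" "bounded_bilinear g"
    "\<And>p z q w. f (single p z) (single q w) = g (single p z) (single q w)"
  shows "f a b = g a b"
proof (rule bounded_linear_eq_on_singles[where f = "\<lambda>a. f a b"])
  show "f (single p z) b = g (single p z) b" for p z
    by (rule bounded_linear_eq_on_singles)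
       (use assms in \<open>auto intro: bounded_bilinear.bounded_linear_right\<close>)
qed (use assms in \<open>auto intro: bounded_bilinear.bounded_linear_left\<close>)

lemma bounded_linear_coord: "bounded_linear (\<lambda>a. coord a n)"
  by (rule bounded_linear_intro[where K = 1]) (use coord_le_norm in auto)

lemma norm_single [simp]: "norm (single p z) = cmod z"
proof -
  have "((\<lambda>n. (cmod (coord (single p z) n))\<^sup>2) has_sum (\<Sum>n\<in>{p}. (cmod z)\<^sup>2)) UNIV"
    by (rule has_sum_cong_neutral[THEN iffD1, OF _ _ _ has_sum_finite[of "{p}"]])
       (auto simp: single.rep_eq)
  from infsumI[OF this] have "(norm (single p z))\<^sup>2 = (cmod z)\<^sup>2"
    unfolding norm_ell2_square by simp
  then show ?thesis by simp
qed

lemma ell2_of_bounded_sums: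
  assumes "\<And>F. finite F \<Longrightarrow> (\<Sum>n\<in>F. (cmod (f n))\<^sup>2) \<le> C\<^sup>2" "0 \<le> C"
  obtains a where "\<And>n. coord a n = f n" "norm a \<le> C"
proof
  show "coord (Abs_ell2 f) n = f n" for n
    using square_summable_bounded(1)[OF assms] by (simp add: Abs_ell2_inverse)
  show "norm (Abs_ell2 f) \<le> C"
    by (rule square_summable_bounded(2)[OF assms])
qed

text \<open>Cauchy-Schwarz for the complex inner product, obtained from its finite partial sums.\<close>

lemma norm_cinner_le: "cmod (cinner a b) \<le> norm a * norm b"
proof -
  define v where "v = cinner a b"
  have hs: "((\<lambda>n. coord a n * cnj (coord b n)) has_sum v) UNIV"
    unfolding v_def cinner.rep_eq by (rule has_sum_infsum[OF cinner_summable])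
  have le: "cmod (\<Sum>n\<in>F. coord a n * cnj (coord b n)) \<le> norm a * norm b" if "finite F" for F
  proof -
    have "cmod (\<Sum>n\<in>F. coord a n * cnj (coord b n)) \<le> (\<Sum>n\<in>F. \<bar>cmod (coord a n)\<bar> * \<bar>cmod (coord b n)\<bar>)"
      by (rule order_trans[OF norm_sum]) (simp add: norm_mult)
    also have "\<dots> \<le> L2_set (\<lambda>n. cmod (coord a n)) F * L2_set (\<lambda>n. cmod (coord b n)) F"
      by (rule L2_set_mult_ineq)
    also have "\<dots> \<le> norm a * norm b"
      using sum_coord_le_norm[OF that] by (intro mult_mono) (auto simp: L2_set_def intro: real_le_lsqrt sum_nonneg)
    finally show ?thesis .
  qed
  show ?thesis
    unfolding v_def[symmetric]
    by (rule tendsto_upperbound[OF tendsto_norm[OF hs[unfolded has_sum_def]]])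
       (auto intro: eventually_finite_subsets_at_top_weakI le)
qed

lemma bounded_bilinear_cinner: "bounded_bilinear cinner"
proof
  note cs = cinner_summable
  fix a a' b b' :: ell2 and r :: real
  show "cinner (a + a') b = cinner a b + cinner a' b"
    unfolding cinner.rep_eq using infsum_add[OF cs cs] by (simp add: distrib_right)
  show "cinner a (b + b') = cinner a b + cinner a b'"
    unfolding cinner.rep_eq using infsum_add[OF cs cs, of a b a b'] by (simp add: distrib_left)
  show "cinner (r *\<^sub>R a) b = r *\<^sub>R cinner a b"
    unfolding cinner.rep_eq by (simp flip: infsum_scaleR_right)
  show "cinner a (r *\<^sub>R b) = r *\<^sub>R cinner a b"
    unfolding cinner.rep_eq by (simp flip: infsum_scaleR_right)
  show "\<exists>K. \<forall>a b. cmod (cinner a b) \<le> norm a * norm b * K"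
    by (rule exI[of _ 1]) (simp add: norm_cinner_le)
qed

lemma cinner_single_right [simp]: "cinner a (single q w) = coord a q * cnj w"
proof -
  have "((\<lambda>n. coord a n * cnj (coord (single q w) n)) has_sum (\<Sum>n\<in>{q}. coord a q * cnj w)) UNIV"
    by (rule has_sum_cong_neutral[THEN iffD1, OF _ _ _ has_sum_finite[of "{q}"]])
       (auto simp: single.rep_eq)
  then show ?thesis unfolding cinner.rep_eq by (simp add: infsumI)
qed

lemma coord_discrete_hilbert_single:
  "coord (discrete_hilbert (single p z)) m = z / of_int (m - p)"
proof -
  have "((\<lambda>n. coord (single p z) n / of_int (m - n)) has_sum (\<Sum>n\<in>{p}. z / of_int (m - p))) UNIV"
    by (rule has_sum_cong_neutral[THEN iffD1, OF _ _ _ has_sum_finite[of "{p}"]])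
       (auto simp: single.rep_eq)
  from has_sum_unique[OF this discrete_hilbert_has_sum[OF coord_summable]]
  show ?thesis by (simp add: discrete_hilbert.rep_eq discrete_hilbert_fun.rep_eq)
qed

text \<open>The matrix $1/(m-n)$ is real and antisymmetric. This is the source of the unitarity of the
group.\<close>

lemma discrete_hilbert_skew: "inner (discrete_hilbert a) b = - inner a (discrete_hilbert b)"
proof (rule bounded_bilinear_eq_on_singles[where f = "\<lambda>a b. inner (discrete_hilbert a) b"
      and g = "\<lambda>a b. - inner a (discrete_hilbert b)"])
  show "bounded_bilinear (\<lambda>a b. inner (discrete_hilbert a) b)"
    by (rule bounded_bilinear.comp1[OF bounded_bilinear_inner blinfun.bounded_linear_right])
  show "bounded_bilinear (\<lambda>a b. - inner a (discrete_hilbert b))"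
    using bounded_bilinear.comp[OF bounded_bilinear_inner bounded_linear_ident
      bounded_linear_minus[OF blinfun.bounded_linear_right]] by simp
  fix p q :: int and z w :: complex
  have "inner (single p z) (discrete_hilbert (single q w)) = inner (discrete_hilbert (single q w)) (single p z)"
    by (rule inner_commute)
  also have "\<dots> = Re (w * cnj z / of_int (p - q))"
    by (simp add: inner_ell2_def coord_discrete_hilbert_single)
  also have "\<dots> = - Re (z * cnj w / of_int (q - p))"
  proof -
    have "w * cnj z / of_int (p - q) = - cnj (z * cnj w / of_int (q - p))"
      by (cases "p = q") (auto simp: divide_simps algebra_simps)
    then show ?thesis by (simp only: complex_cnj uminus_complex.sel cnj.sel)
  qed
  finally show "inner (discrete_hilbert (single p z)) (single q w) = - inner (single p z) (discrete_hilbert (single q w))"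
    by (simp add: inner_ell2_def coord_discrete_hilbert_single)
qed


section \<open>The unitary group generated by the discrete Hilbert transform\<close>

abbreviation "hilbert_power k \<equiv> ((blinfun_compose discrete_hilbert) ^^ k) id_blinfun"

lemma norm_hilbert_power: "norm (hilbert_power k) \<le> norm discrete_hilbert ^ k"
proof (induction k)
  case 0 show ?case by (simp add: norm_blinfun_id_le)
next
  case (Suc k)
  have "norm (hilbert_power (Suc k)) \<le> norm discrete_hilbert * norm (hilbert_power k)"
    by (simp add: norm_blinfun_compose)
  also have "\<dots> \<le> norm discrete_hilbert ^ Suc k"
    using Suc by (simp add: mult_left_mono)
  finally show ?case .
qed

lemma norm_exp_hilbert_term:
  assumes "\<bar>t\<bar> \<le> R"
  shows "norm ((t ^ k / fact k) *\<^sub>R hilbert_power k) \<le> (R * norm discrete_hilbert) ^ k /\<^sub>R fact k"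
proof -
  have "norm ((t ^ k / fact k) *\<^sub>R hilbert_power k) = \<bar>t\<bar> ^ k * norm (hilbert_power k) / fact k"
    by (simp add: power_abs)
  also have "\<dots> \<le> R ^ k * norm discrete_hilbert ^ k / fact k"
    using assms norm_hilbert_power by (intro divide_right_mono mult_mono power_mono) auto
  finally show ?thesis by (simp add: power_mult_distrib divide_inverse mult.commute)
qed

lemma exp_hilbert_uniform_limit:
  "uniform_limit {-R..R} (\<lambda>n t. \<Sum>k<n. (t ^ k / fact k) *\<^sub>R hilbert_power k) exp_hilbert sequentially"
proof -
  have "uniform_limit {-R..R} (\<lambda>n t. \<Sum>k<n. (t ^ k / fact k) *\<^sub>R hilbert_power k)
      (\<lambda>t. \<Sum>k. (t ^ k / fact k) *\<^sub>R hilbert_power k) sequentially"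
    by (rule Weierstrass_m_test[where M = "\<lambda>k. (R * norm discrete_hilbert) ^ k /\<^sub>R fact k"])
       (use norm_exp_hilbert_term summable_exp_generic in \<open>auto simp del: norm_scaleR real_scaleR_def\<close>)
  then show ?thesis by (simp add: exp_hilbert_def[abs_def])
qed

lemma exp_hilbert_sums: "(\<lambda>k. (t ^ k / fact k) *\<^sub>R hilbert_power k) sums exp_hilbert t"
  unfolding sums_def
  by (rule tendsto_uniform_limitI[OF exp_hilbert_uniform_limit[of "\<bar>t\<bar>"]]) auto

lemma exp_hilbert_0 [simp]: "exp_hilbert 0 = id_blinfun"
proof -
  have "(\<lambda>k. (0 ^ k / fact k) *\<^sub>R hilbert_power k) sums (\<Sum>k\<in>{0}. (0 ^ k / fact k) *\<^sub>R hilbert_power k)"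
    by (rule sums_finite) auto
  with exp_hilbert_sums[of 0] show ?thesis by (simp add: sums_unique2)
qed

text \<open>Termwise differentiation of the exponential series. The differentiated partial sum with
$n+1$ terms is $H$ applied to the partial sum with $n$ terms, so the uniform convergence of the
series on bounded intervals also controls the derivatives.\<close>

lemma exp_hilbert_has_vector_derivative:
  "((\<lambda>t. exp_hilbert t a) has_vector_derivative discrete_hilbert (exp_hilbert t a)) (at t)"
proof -
  define R where "R = \<bar>t\<bar> + 1"
  define s where "s = (\<lambda>n x. \<Sum>k<n. (x ^ k / fact k) *\<^sub>R hilbert_power k)"
  define f where "f = (\<lambda>k x. (x ^ k / fact k) *\<^sub>R hilbert_power k a)"
  define f' where "f' = (\<lambda>k x h. (h * (real k * x ^ (k - 1)) / fact k) *\<^sub>R hilbert_power k a)"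
  have sum_f': "(\<Sum>k<Suc n. f' k x h) = h *\<^sub>R discrete_hilbert (s n x a)" for n x h
  proof -
    have step: "f' (Suc k) x h = h *\<^sub>R discrete_hilbert (((x ^ k / fact k) *\<^sub>R hilbert_power k) a)" for k
      by (simp add: f'_def blinfun.scaleR_left blinfun.scaleR_right)
    have "(\<Sum>k<Suc n. f' k x h) = f' 0 x h + (\<Sum>k<n. f' (Suc k) x h)"
      by (rule sum.lessThan_Suc_shift)
    also have "\<dots> = h *\<^sub>R discrete_hilbert (s n x a)"
      unfolding step s_def by (simp add: f'_def blinfun.sum_left blinfun.sum_right scaleR_sum_right)
    finally show ?thesis .
  qed
  have "\<exists>g. \<forall>x\<in>{-R..R}. (\<lambda>k. f k x) sums g x \<and>
      (g has_derivative (\<lambda>h. h *\<^sub>R discrete_hilbert (exp_hilbert x a))) (at x within {-R..R})"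
  proof (rule has_derivative_series)
    show "((f k) has_derivative f' k x) (at x within {-R..R})" for k x
      unfolding f_def f'_def
      by (auto intro!: derivative_eq_intros simp: fun_eq_iff)
    show "(\<lambda>k. f k 0) sums a"
      using sums_finite[of "{0}" "\<lambda>k. f k 0"] by (simp add: f_def)
    show "0 \<in> {-R..R}" by (simp add: R_def)
    fix e :: real assume "e > 0"
    define K where "K = norm discrete_hilbert * norm a + 1"
    have "K > 0" by (simp add: K_def add_nonneg_pos)
    then have "\<forall>\<^sub>F n in sequentially. \<forall>x\<in>{-R..R}. dist (s n x) (exp_hilbert x) < e / K"
      using uniform_limitD[OF exp_hilbert_uniform_limit, of "e / K" R] \<open>e > 0\<close> by (simp add: s_def)
    then have "\<forall>\<^sub>F n in sequentially. \<forall>x\<in>{-R..R}. \<forall>h.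
        norm ((\<Sum>k<Suc n. f' k x h) - h *\<^sub>R discrete_hilbert (exp_hilbert x a)) \<le> e * norm h"
    proof eventually_elim
      case (elim n)
      show ?case
      proof (intro ballI allI)
        fix x h assume "x \<in> {-R..R}"
        have "norm ((\<Sum>k<Suc n. f' k x h) - h *\<^sub>R discrete_hilbert (exp_hilbert x a))
            = \<bar>h\<bar> * norm (discrete_hilbert ((s n x - exp_hilbert x) a))"
          unfolding sum_f' by (simp flip: scaleR_diff_right add: blinfun.diff_right blinfun.diff_left)
        also have "\<dots> \<le> \<bar>h\<bar> * (norm discrete_hilbert * (norm (s n x - exp_hilbert x) * norm a))"
          by (intro mult_left_mono order_trans[OF norm_blinfun] norm_blinfun) auto
        also have "\<dots> = \<bar>h\<bar> * (norm (s n x - exp_hilbert x) * (norm discrete_hilbert * norm a))"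
          by simp
        also have "\<dots> \<le> \<bar>h\<bar> * (e / K * K)"
          using elim \<open>x \<in> {-R..R}\<close> \<open>K > 0\<close> \<open>e > 0\<close>
          by (intro mult_left_mono mult_mono) (auto simp: dist_norm K_def less_imp_le)
        finally show "norm ((\<Sum>k<Suc n. f' k x h) - h *\<^sub>R discrete_hilbert (exp_hilbert x a)) \<le> e * norm h"
          using \<open>K > 0\<close> by (simp add: mult.commute)
      qed
    qed
    then show "\<forall>\<^sub>F n in sequentially. \<forall>x\<in>{-R..R}. \<forall>h.
        norm ((\<Sum>k<n. f' k x h) - h *\<^sub>R discrete_hilbert (exp_hilbert x a)) \<le> e * norm h"
      by (rule eventually_sequentially_Suc[THEN iffD1])
  qed simp
  then obtain g where g: "\<And>x. x \<in> {-R..R} \<Longrightarrow> (\<lambda>k. f k x) sums g x"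
    "\<And>x. x \<in> {-R..R} \<Longrightarrow>
      (g has_derivative (\<lambda>h. h *\<^sub>R discrete_hilbert (exp_hilbert x a))) (at x within {-R..R})" by blast
  have g_eq: "g x = exp_hilbert x a" if "x \<in> {-R..R}" for x
  proof -
    have "(\<lambda>k. f k x) sums exp_hilbert x a"
      using bounded_linear.sums[OF blinfun.bounded_linear_left exp_hilbert_sums, of x a]
      by (simp add: f_def blinfun.scaleR_left)
    with g(1)[OF that] show ?thesis by (rule sums_unique2)
  qed
  have t: "t \<in> interior {-R..R}" by (auto simp: R_def)
  then have "(g has_derivative (\<lambda>h. h *\<^sub>R discrete_hilbert (exp_hilbert t a))) (at t)"
    using g(2)[of t] by (simp add: at_within_interior[OF t])
  then have "((\<lambda>x. exp_hilbert x a) has_derivative (\<lambda>h. h *\<^sub>R discrete_hilbert (exp_hilbert t a))) (at t)"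
    by (rule has_derivative_transform_within_open[of _ _ _ _ "interior {-R..R}"])
       (use t g_eq interior_subset in blast)+
  then show ?thesis by (simp add: has_vector_derivative_def)
qed

text \<open>Skew-symmetry makes the derivative of the squared norm vanish.\<close>

lemma norm_exp_hilbert [simp]: "norm (exp_hilbert t a) = norm a"
proof -
  have "((\<lambda>t. inner (exp_hilbert t a) (exp_hilbert t a)) has_vector_derivative
      inner (exp_hilbert t a) (discrete_hilbert (exp_hilbert t a))
      + inner (discrete_hilbert (exp_hilbert t a)) (exp_hilbert t a)) (at t within UNIV)" for t
    by (rule bounded_bilinear.has_vector_derivative[OF bounded_bilinear_inner]
        exp_hilbert_has_vector_derivative)+
  then have "((\<lambda>t. inner (exp_hilbert t a) (exp_hilbert t a)) has_vector_derivative 0) (at t within UNIV)" for t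
    by (simp add: discrete_hilbert_skew)
  then have "((\<lambda>t. inner (exp_hilbert t a) (exp_hilbert t a)) has_derivative (\<lambda>h. 0)) (at t within UNIV)" for t
    by (simp add: has_vector_derivative_def)
  from has_derivative_zero_constant[OF convex_UNIV this]
  obtain c where c: "\<And>t. inner (exp_hilbert t a) (exp_hilbert t a) = c" by auto
  have "(norm (exp_hilbert t a))\<^sup>2 = (norm (exp_hilbert 0 a))\<^sup>2"
    unfolding power2_norm_eq_inner c ..
  then show ?thesis by simp
qed

lemma coord_exp_hilbert_le: "cmod (coord (exp_hilbert t a) n) \<le> norm a"
  using coord_le_norm[of "exp_hilbert t a" n] by simp


section \<open>Cotangent, tangent and cosecant series\<close>

text \<open>Logarithmic derivative of the reflection formula $\Gamma(x)\Gamma(1-x) = \pi/\sin \pi x$.\<close>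

lemma digamma_reflection_real:
  fixes x :: real
  assumes "x \<notin> \<int>"
  shows "Digamma (1 - x) - Digamma x = pi * cot (pi * x)"
proof -
  have refl: "Gamma y * Gamma (1 - y) = pi / sin (pi * y)" for y :: real
  proof -
    have "complex_of_real (Gamma y * Gamma (1 - y)) = Gamma (of_real y) * Gamma (1 - of_real y)"
      by (simp flip: Gamma_complex_of_real)
    also have "\<dots> = of_real (pi / sin (pi * y))"
      unfolding Gamma_reflection_complex by (simp flip: sin_of_real)
    finally show ?thesis by (simp only: of_real_eq_iff)
  qed
  have nonint: "1 - x \<notin> \<int>"
    using assms Ints_diff[of 1 "1 - x"] by auto
  then have pos: "x \<notin> \<int>\<^sub>\<le>\<^sub>0" "1 - x \<notin> \<int>\<^sub>\<le>\<^sub>0"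
    using assms nonpos_Ints_Int by blast+
  have sin_nz: "sin (pi * x) \<noteq> 0"
    using assms by (auto simp: sin_zero_iff_int2 mult.commute)
  have d1: "((\<lambda>y. Gamma y * Gamma (1 - y)) has_field_derivative
      Gamma x * Gamma (1 - x) * (Digamma x - Digamma (1 - x))) (at x)"
    using pos by (auto intro!: derivative_eq_intros simp: algebra_simps)
  have d2: "((\<lambda>y. pi / sin (pi * y)) has_field_derivative
      - (pi * (cos (pi * x) * pi)) / (sin (pi * x) * sin (pi * x))) (at x)"
    using sin_nz by (auto intro!: derivative_eq_intros)
  have "Gamma x * Gamma (1 - x) * (Digamma x - Digamma (1 - x))
      = - (pi * (cos (pi * x) * pi)) / (sin (pi * x) * sin (pi * x))"
    using DERIV_unique[OF d1] d2 by (simp add: refl)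
  then have "pi / sin (pi * x) * (Digamma x - Digamma (1 - x)) = pi / sin (pi * x) * (- (pi * cot (pi * x)))"
    unfolding refl cot_def by simp
  then show ?thesis
    using sin_nz by (subst (asm) mult_cancel_left) simp
qed

lemma cot_series_one_sided:
  fixes x :: real
  assumes "x \<notin> \<int>"
  shows "(\<lambda>n. 1 / (x + real n) - 1 / (1 - x + real n)) sums (pi * cot (pi * x))"
proof -
  have "x \<noteq> 0" "1 - x \<noteq> 0" using assms by auto
  then have "(\<lambda>n. (inverse (of_nat (Suc n)) - inverse (1 - x + of_nat n))
      - (inverse (of_nat (Suc n)) - inverse (x + of_nat n))) sums
      ((Digamma (1 - x) + euler_mascheroni) - (Digamma x + euler_mascheroni))"
    unfolding Digamma_def
    by (intro sums_diff) (simp_all add: summable_Digamma summable_sums del: of_nat_Suc)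
  then show ?thesis
    using digamma_reflection_real[OF assms] by (simp add: inverse_eq_divide)
qed

lemma paired_fractions:
  fixes x k :: real
  assumes "x + k \<noteq> 0" "x - k \<noteq> 0"
  shows "2 * x / (x\<^sup>2 - k\<^sup>2) = 1 / (x + k) + 1 / (x - k)"
proof -
  have "x\<^sup>2 - k\<^sup>2 = (x + k) * (x - k)" by (simp add: power2_eq_square algebra_simps)
  then show ?thesis using assms by (simp add: divide_simps)
qed

text \<open>Pairing $1/(x+n+1)$ with $1/(x-n-1)$ shifts one half of the one-sided series by one index;
this accounts for the terms $1/x$ and $1/(x+N)$ in the partial sums.\<close>

lemma cot_partial_fractions:
  fixes x :: real
  assumes "x \<notin> \<int>"
  shows "(\<lambda>n. 2 * x / (x\<^sup>2 - (real (Suc n))\<^sup>2)) sums (pi * cot (pi * x) - 1 / x)"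
proof -
  have ne: "x \<noteq> of_int k" for k using assms by auto
  have nz: "x + real n \<noteq> 0" "1 - x + real n \<noteq> 0" for n
    using ne[of "- int n"] ne[of "int (Suc n)"] by auto
  have step: "(\<Sum>n<N. 2 * x / (x\<^sup>2 - (real (Suc n))\<^sup>2))
      = (\<Sum>n<N. 1 / (x + real n) - 1 / (1 - x + real n)) - 1 / x + 1 / (x + real N)" for N
  proof (induction N)
    case (Suc N)
    have "1 / (x - real (Suc N)) = - (1 / (1 - x + real N))"
      by (simp add: minus_divide_right[symmetric] flip: divide_minus_right)
    then have "2 * x / (x\<^sup>2 - (real (Suc N))\<^sup>2) = 1 / (x + real (Suc N)) - 1 / (1 - x + real N)"
      using paired_fractions[of x "real (Suc N)"] nz(1)[of "Suc N"] nz(2)[of N] by simp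
    with Suc show ?case by simp
  qed simp
  have "(\<lambda>N. (\<Sum>n<N. 1 / (x + real n) - 1 / (1 - x + real n)) - 1 / x + 1 / (x + real N))
      \<longlonglongrightarrow> pi * cot (pi * x) - 1 / x + 0"
    by (intro tendsto_intros cot_series_one_sided[OF assms, unfolded sums_def]) real_asymp
  then show ?thesis unfolding sums_def step by simp
qed

text \<open>The cotangent series at $x + 1/2$. Integers $x$ are allowed, where the sum is zero; this case is
needed for the sine part of Kadec's expansion.\<close>

lemma tan_partial_fractions:
  fixes x :: real
  assumes "x + 1 / 2 \<notin> \<int>"
  shows "(\<lambda>n. 2 * x / ((real n + 1 / 2)\<^sup>2 - x\<^sup>2)) sums (pi * tan (pi * x))"
proof -
  have ne: "x + 1 / 2 \<noteq> of_int k" for k using assms by auto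
  have nz: "real n + 1 / 2 + x \<noteq> 0" "real n + 1 / 2 - x \<noteq> 0" for n
    using ne[of "- int n"] ne[of "int (Suc n)"] by auto
  have "(\<lambda>n. - (1 / (x + 1 / 2 + real n) - 1 / (1 - (x + 1 / 2) + real n))) sums
      (- (pi * cot (pi * (x + 1 / 2))))"
    by (intro sums_minus cot_series_one_sided assms)
  moreover have "- (1 / (x + 1 / 2 + real n) - 1 / (1 - (x + 1 / 2) + real n))
      = 2 * x / ((real n + 1 / 2)\<^sup>2 - x\<^sup>2)" for n
  proof -
    define k where "k = real n + 1 / 2"
    have "2 * x / (k\<^sup>2 - x\<^sup>2) = - (2 * x / (x\<^sup>2 - k\<^sup>2))"
      by (simp flip: divide_minus_right)
    also have "\<dots> = - (1 / (x + k) + 1 / (x - k))"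
      using nz[of n] by (subst paired_fractions) (auto simp: k_def)
    also have "1 / (x - k) = - (1 / (k - x))"
      by (simp flip: divide_minus_right)
    finally have "2 * x / (k\<^sup>2 - x\<^sup>2) = - (1 / (x + k) - 1 / (k - x))" by simp
    moreover have "x + 1 / 2 + real n = x + k" "1 - (x + 1 / 2) + real n = k - x"
      by (simp_all add: k_def)
    ultimately show ?thesis unfolding k_def[symmetric] by (simp only: minus_diff_eq)
  qed
  moreover have "cot (pi * (x + 1 / 2)) = - tan (pi * x)"
    by (simp add: cot_def tan_def distrib_left sin_add cos_add)
  ultimately show ?thesis by simp
qed

lemma has_sum_int_from_pairs:
  fixes f :: "int \<Rightarrow> real"
  assumes "f summable_on UNIV" "(\<lambda>n. f (int (Suc n)) + f (- int (Suc n))) sums s"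
  shows "(f has_sum (f 0 + s)) UNIV"
proof -
  let ?P = "range (\<lambda>n. int (Suc n))" and ?M = "range (\<lambda>n. - int (Suc n))"
  have part: "((\<lambda>n. f (h n)) has_sum infsum f (range h)) UNIV" if "inj h" for h :: "nat \<Rightarrow> int"
    using has_sum_infsum[OF summable_on_subset_banach[OF assms(1) subset_UNIV[of "range h"]]]
    by (simp add: has_sum_reindex[OF that] o_def)
  have "inj (\<lambda>n. int (Suc n))" "inj (\<lambda>n. - int (Suc n))" by (auto simp: inj_on_def)
  note parts = this[THEN part]
  have "s = infsum f ?P + infsum f ?M"
    using sums_unique2[OF assms(2) sums_add[OF parts[THEN has_sum_imp_sums]]] .
  moreover have "(f has_sum (\<Sum>n\<in>{0}. f n) + (infsum f ?P + infsum f ?M)) ({0} \<union> (?P \<union> ?M))"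
    by (intro has_sum_Un_disjoint has_sum_finite has_sum_infsum summable_on_subset_banach[OF assms(1)]) auto
  moreover have "{0} \<union> (?P \<union> ?M) = UNIV"
  proof -
    have "k \<in> {0} \<union> (?P \<union> ?M)" for k :: int
    proof (cases k rule: int_cases3)
      case (pos n)
      then have "k = int (Suc (n - 1))" by simp
      then show ?thesis by blast
    next
      case (neg n)
      then have "k = - int (Suc (n - 1))" by simp
      then show ?thesis by blast
    qed simp
    then show ?thesis by blast
  qed
  ultimately show ?thesis by simp
qed

text \<open>Let $n$ be an integer nearest to $-x$. Then $|x + m| \ge |m - n| - 1/2 \ge |m - n|/2$ for
$m \ne n$. The bound depends on $x$ only through a shift of the index, so sums over $m$ can be
bounded uniformly in $x$.\<close>

lemma inverse_square_le_round:
  fixes x :: real and m :: int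
  assumes "m \<noteq> round (- x)"
  shows "1 / (x + of_int m)\<^sup>2 \<le> 4 / (of_int (m - round (- x)))\<^sup>2"
proof -
  define n where "n = round (- x)"
  have "\<bar>of_int n + x\<bar> \<le> 1 / 2"
    using of_int_round_abs_le[of "- x"] by (simp add: n_def)
  moreover have "1 \<le> \<bar>real_of_int (m - n)\<bar>" using assms by (simp add: n_def)
  ultimately have "\<bar>real_of_int (m - n)\<bar> / 2 \<le> \<bar>x + of_int m\<bar>"
    using abs_triangle_ineq4[of "x + of_int m" "of_int n + x"] by simp
  then have "(real_of_int (m - n))\<^sup>2 / 4 \<le> (x + of_int m)\<^sup>2"
    using power_mono[of "\<bar>real_of_int (m - n)\<bar> / 2" "\<bar>x + of_int m\<bar>" 2] by (simp add: power_divide)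
  moreover have "0 < (real_of_int (m - n))\<^sup>2 / 4" using assms by (simp add: n_def)
  ultimately have "1 / (x + of_int m)\<^sup>2 \<le> 1 / ((real_of_int (m - n))\<^sup>2 / 4)"
    by (intro frac_le) auto
  then show ?thesis by (simp add: n_def)
qed

lemma summable_on_singleton: "(\<lambda>m. if m = n then c else (0 :: real)) summable_on UNIV"
proof -
  have "finite {m. (if m = n then c else 0) \<noteq> 0}" by (rule finite_subset[of _ "{n}"]) auto
  then show ?thesis
    by (intro finite_nonzero_values_imp_summable_on) (auto elim: finite_subset[rotated])
qed

lemma summable_inverse_square_shift_real:
  fixes x :: real
  shows "(\<lambda>m. 1 / (x + of_int m)\<^sup>2) summable_on UNIV"
proof (rule summable_on_comparison_test)
  let ?n = "round (- x)"
  have "(\<lambda>m. 4 * (1 / (real_of_int (m - ?n))\<^sup>2)) summable_on UNIV"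
    by (intro summable_on_cmult_right inverse_square_summable_int)
  then show "(\<lambda>m. 4 * (1 / (real_of_int (m - ?n))\<^sup>2) + (if m = ?n then 1 / (x + of_int ?n)\<^sup>2 else 0))
      summable_on UNIV"
    by (intro summable_on_add summable_on_singleton)
  show "1 / (x + of_int m)\<^sup>2
      \<le> 4 * (1 / (real_of_int (m - ?n))\<^sup>2) + (if m = ?n then 1 / (x + of_int ?n)\<^sup>2 else 0)" for m
    using inverse_square_le_round[of m x] by auto
qed simp

text \<open>The term $j = 0$ is zero by the convention $1/0 = 0$. Adding the terms with indices $n$ and $-n$
gives the cotangent series divided by $-x$.\<close>

lemma cot_int_series:
  fixes x :: real
  assumes "x \<notin> \<int>"
  shows "((\<lambda>j. 1 / (of_int j * (x + of_int j))) has_sum (1 / x\<^sup>2 - pi * cot (pi * x) / x)) UNIV"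
proof -
  let ?f = "\<lambda>j. 1 / (of_int j * (x + of_int j))"
  have "?f summable_on UNIV"
  proof (rule abs_summable_summable, rule summable_on_comparison_test)
    show "(\<lambda>j. 1 / (real_of_int (j - 0))\<^sup>2 + 1 / (x + of_int j)\<^sup>2) summable_on UNIV"
      by (intro summable_on_add inverse_square_summable_int summable_inverse_square_shift_real)
    fix j :: int
    define u v where "u = 1 / real_of_int j" and "v = 1 / (x + of_int j)"
    have "0 \<le> (\<bar>u\<bar> - \<bar>v\<bar>)\<^sup>2" by simp
    then have "2 * (\<bar>u\<bar> * \<bar>v\<bar>) \<le> u\<^sup>2 + v\<^sup>2"
      unfolding power2_diff by simp
    moreover have "0 \<le> \<bar>u\<bar> * \<bar>v\<bar>" by simp
    ultimately have "\<bar>u\<bar> * \<bar>v\<bar> \<le> u\<^sup>2 + v\<^sup>2" by linarith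
    then show "norm (?f j) \<le> 1 / (real_of_int (j - 0))\<^sup>2 + 1 / (x + of_int j)\<^sup>2"
      by (simp add: u_def v_def power_divide abs_mult)
  qed simp
  moreover have "(\<lambda>n. ?f (int (Suc n)) + ?f (- int (Suc n))) sums (- (pi * cot (pi * x) - 1 / x) / x)"
  proof -
    have ne: "x \<noteq> of_int k" for k using assms by auto
    have "(\<lambda>n. - (2 * x / (x\<^sup>2 - (real (Suc n))\<^sup>2)) / x) sums (- (pi * cot (pi * x) - 1 / x) / x)"
      by (intro sums_divide sums_minus cot_partial_fractions assms)
    moreover have "- (2 * x / (x\<^sup>2 - (real (Suc n))\<^sup>2)) / x = ?f (int (Suc n)) + ?f (- int (Suc n))" for n
    proof -
      define k where "k = real (Suc n)"
      have "k \<noteq> 0" "x + k \<noteq> 0" "x - k \<noteq> 0" "x \<noteq> 0"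
        using ne[of "- int (Suc n)"] ne[of "int (Suc n)"] ne[of 0] by (auto simp: k_def)
      then have "- (2 * x / (x\<^sup>2 - k\<^sup>2)) / x = 1 / (k * (x + k)) + 1 / (- k * (x - k))"
        by (subst paired_fractions) (simp_all add: divide_simps)
      then show ?thesis by (simp add: k_def)
    qed
    ultimately show ?thesis by simp
  qed
  ultimately have "(?f has_sum (?f 0 + - (pi * cot (pi * x) - 1 / x) / x)) UNIV"
    by (rule has_sum_int_from_pairs)
  then show ?thesis
    by (simp add: diff_divide_distrib power2_eq_square)
qed

text \<open>The sign $(-1)^j$, written $\cos \pi j$, is twice the indicator of the even integers minus one.
So the sum follows from $1/\sin \pi x = \cot(\pi x/2) - \cot \pi x$.\<close>

lemma cosec_int_series:
  fixes x :: real
  assumes "x \<notin> \<int>"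
  shows "((\<lambda>j. cos (pi * of_int j) / (of_int j * (x + of_int j))) has_sum
      (1 / x\<^sup>2 - pi / (x * sin (pi * x)))) UNIV"
proof -
  let ?f = "\<lambda>x j. 1 / (of_int j * (x + real_of_int j))"
  have "x / 2 \<notin> \<int>"
    using assms by (metis Ints_add field_sum_of_halves)
  \<comment> \<open>The even terms are a quarter of the cotangent series at half the argument.\<close>
  note has_sum_cmult_right[OF cot_int_series[OF this], of "1 / 4"]
  moreover have "1 / 4 * ?f (x / 2) j = ?f x (2 * j)" for j
  proof -
    have "real_of_int (2 * j) * (x + of_int (2 * j)) = 4 * (of_int j * (x / 2 + of_int j))"
      by (simp add: algebra_simps)
    then show ?thesis by simp
  qed
  moreover have "1 / 4 * (1 / (x / 2)\<^sup>2 - pi * cot (pi * (x / 2)) / (x / 2))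
      = 1 / x\<^sup>2 - pi * cot (pi * x / 2) / (2 * x)"
    by (simp add: power_divide right_diff_distrib)
  ultimately have "((\<lambda>j. ?f x (2 * j)) has_sum (1 / x\<^sup>2 - pi * cot (pi * x / 2) / (2 * x))) UNIV"
    by (simp only:)
  then have "(?f x has_sum (1 / x\<^sup>2 - pi * cot (pi * x / 2) / (2 * x))) (range ((*) 2))"
    by (subst has_sum_reindex) (auto simp: inj_on_def o_def)
  then have "((\<lambda>j. if even j then ?f x j else 0) has_sum (1 / x\<^sup>2 - pi * cot (pi * x / 2) / (2 * x))) UNIV"
    by (rule has_sum_cong_neutral[THEN iffD1, rotated 3]) (auto elim!: evenE)
  from has_sum_add[OF has_sum_cmult_right[OF this, of 2] has_sum_cmult_right[OF cot_int_series[OF assms], of "-1"]]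
  have "((\<lambda>j. 2 * (if even j then ?f x j else 0) + - 1 * ?f x j) has_sum
      (2 * (1 / x\<^sup>2 - pi * cot (pi * x / 2) / (2 * x)) + - 1 * (1 / x\<^sup>2 - pi * cot (pi * x) / x))) UNIV" .
  moreover have "2 * (if even j then ?f x j else 0) + - 1 * ?f x j
      = cos (pi * of_int j) / (of_int j * (x + of_int j))" for j
    by (simp add: cos_npi_int)
  moreover have "2 * (1 / x\<^sup>2 - pi * cot (pi * x / 2) / (2 * x)) + - 1 * (1 / x\<^sup>2 - pi * cot (pi * x) / x)
      = 1 / x\<^sup>2 - pi / (x * sin (pi * x))"
  proof -
    have "sin (pi * x) \<noteq> 0" using assms by (auto simp: sin_zero_iff_int2 mult.commute)
    then have s: "sin (pi * x / 2) \<noteq> 0" "cos (pi * x / 2) \<noteq> 0"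
      using sin_double[of "pi * x / 2"] by auto
    have "cot (pi * x / 2) - cot (pi * x) = 1 / sin (pi * x)"
    proof -
      have "sin (pi * x) = 2 * sin (pi * x / 2) * cos (pi * x / 2)"
        "cos (pi * x) = 2 * (cos (pi * x / 2))\<^sup>2 - 1"
        using sin_double[of "pi * x / 2"] cos_double_cos[of "pi * x / 2"] by simp_all
      then show ?thesis using s by (simp add: cot_def divide_simps power2_eq_square)
    qed
    then have "cot (pi * x / 2) = cot (pi * x) + 1 / sin (pi * x)" by simp
    moreover have "x \<noteq> 0" using assms by auto
    ultimately show ?thesis by (simp add: field_simps)
  qed
  ultimately show ?thesis by (simp only:)
qed


section \<open>The matrix of the exponential\<close>

text \<open>The candidate for the entry of $e^{tH}$ with row index minus column index $m$. It is
$(-1)^m \sin(\pi(t+m))/(\pi(t+m))$ with its removable singularity filled in; the sign $(-1)^m$ of an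
integer power is written $\cos \pi m$ throughout.\<close>

definition exp_entry :: "int \<Rightarrow> real \<Rightarrow> real"
  where "exp_entry m t = (if t = - of_int m then cos (pi * of_int m) else sin (pi * t) / (pi * (t + of_int m)))"

definition exp_entry_deriv :: "int \<Rightarrow> real \<Rightarrow> real"
  where "exp_entry_deriv m t = (if t = - of_int m then 0
    else cos (pi * t) / (t + of_int m) - sin (pi * t) / (pi * (t + of_int m)\<^sup>2))"

lemma cos_pi_int_square: "cos (pi * of_int m) * cos (pi * of_int m) = 1"
  by (simp add: cos_npi_int)

lemma sin_pi_shift: "sin (pi * (t + of_int m)) = cos (pi * of_int m) * sin (pi * t)"
  by (simp add: distrib_left sin_add)

lemma cos_pi_shift: "cos (pi * (t + of_int m)) = cos (pi * of_int m) * cos (pi * t)"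
  by (simp add: distrib_left cos_add)

lemma exp_entry_shift: "exp_entry (m - n) (t + of_int n) = cos (pi * of_int n) * exp_entry m t"
proof (cases "t = - of_int m")
  case True
  then have "t + of_int n = - of_int (m - n)" by simp
  then have "exp_entry (m - n) (t + of_int n) = cos (pi * of_int (m - n))"
    unfolding exp_entry_def by (simp only: if_True simp_thms)
  also have "\<dots> = cos (pi * of_int n) * cos (pi * of_int m)"
    unfolding cos_npi_int by simp
  finally show ?thesis using True by (simp add: exp_entry_def)
next
  case False
  then have "t + of_int n \<noteq> - of_int (m - n)" by (simp add: algebra_simps eq_neg_iff_add_eq_0)
  with False show ?thesis by (simp add: exp_entry_def sin_pi_shift)
qed

lemma exp_entry_int: "exp_entry m (of_int n) = (if n = - m then cos (pi * of_int n) else 0)"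
proof (cases "n = - m")
  case False
  then have "real_of_int n \<noteq> - of_int m" by (metis of_int_eq_iff of_int_minus)
  with False show ?thesis by (simp add: exp_entry_def)
qed (simp add: exp_entry_def)

lemma exp_entry_nonint: "t \<notin> \<int> \<Longrightarrow> exp_entry m t = sin (pi * t) / (pi * (t + of_int m))"
  by (auto simp: exp_entry_def)

lemma exp_entry_has_derivative: "(exp_entry m has_field_derivative exp_entry_deriv m t) (at t)"
proof (cases "t = - of_int m")
  case True
  have "(\<lambda>h::real. (sin (pi * h) / (pi * h) - 1) / h) \<midarrow>0\<rightarrow> 0"
    by real_asymp
  then have "(\<lambda>h. cos (pi * of_int m) * ((sin (pi * h) / (pi * h) - 1) / h)) \<midarrow>0\<rightarrow> cos (pi * of_int m) * 0"
    by (intro tendsto_intros)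
  moreover have "\<forall>\<^sub>F h in at 0. cos (pi * of_int m) * ((sin (pi * h) / (pi * h) - 1) / h)
      = (exp_entry m (t + h) - exp_entry m t) / h"
  proof (rule eventually_mono[OF eventually_neq_at_within[of 0]])
    fix h :: real assume "h \<noteq> 0"
    have "exp_entry m t = cos (pi * of_int m)" using True by (simp add: exp_entry_def)
    moreover have "exp_entry m (t + h) = cos (pi * of_int m) * (sin (pi * h) / (pi * h))"
    proof -
      have "t + h = h + of_int (- m)" using True by simp
      then have "sin (pi * (t + h)) = cos (pi * of_int m) * sin (pi * h)"
        using sin_pi_shift[of h "- m"] by simp
      then show ?thesis using True \<open>h \<noteq> 0\<close> by (simp add: exp_entry_def)
    qed
    ultimately show "cos (pi * of_int m) * ((sin (pi * h) / (pi * h) - 1) / h)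
      = (exp_entry m (t + h) - exp_entry m t) / h"
      by (simp add: algebra_simps)
  qed
  ultimately have "(\<lambda>h. (exp_entry m (t + h) - exp_entry m t) / h) \<midarrow>0\<rightarrow> 0"
    using Lim_transform_eventually by fastforce
  then show ?thesis using True by (simp add: DERIV_def exp_entry_deriv_def)
next
  case False
  then have nz: "t + of_int m \<noteq> 0" by (simp add: eq_neg_iff_add_eq_0)
  have "((\<lambda>t. sin (pi * t) / (pi * (t + of_int m))) has_field_derivative
      (cos (pi * t) * pi * (pi * (t + of_int m)) - sin (pi * t) * pi)
        / (pi * (t + of_int m) * (pi * (t + of_int m)))) (at t)"
    using nz by (auto intro!: derivative_eq_intros)
  also have "(cos (pi * t) * pi * (pi * (t + of_int m)) - sin (pi * t) * pi)
        / (pi * (t + of_int m) * (pi * (t + of_int m)))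
      = cos (pi * t) / (t + of_int m) - sin (pi * t) / (pi * (t + of_int m)\<^sup>2)"
    using nz by (simp add: diff_divide_distrib power2_eq_square)
  finally have "((\<lambda>t. sin (pi * t) / (pi * (t + of_int m))) has_field_derivative
      cos (pi * t) / (t + of_int m) - sin (pi * t) / (pi * (t + of_int m)\<^sup>2)) (at t)" .
  moreover have "\<forall>\<^sub>F s in nhds t. sin (pi * s) / (pi * (s + of_int m)) = exp_entry m s"
    using t1_space_nhds[OF False] by (rule eventually_mono) (simp add: exp_entry_def)
  from DERIV_cong_ev[OF refl this refl]
  have "((\<lambda>t. sin (pi * t) / (pi * (t + of_int m))) has_field_derivative D) (at t)
      \<longleftrightarrow> (exp_entry m has_field_derivative D) (at t)" for D .
  ultimately show ?thesis using False by (simp add: exp_entry_deriv_def)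
qed

lemma abs_exp_entry_le: "\<bar>exp_entry m t\<bar> \<le> 1"
proof (cases "t = - of_int m")
  case False
  have "\<bar>sin (pi * t)\<bar> = \<bar>sin (pi * (t + of_int m))\<bar>"
    unfolding sin_pi_shift by (simp add: abs_mult cos_npi_int)
  also have "\<dots> \<le> \<bar>pi * (t + of_int m)\<bar>" by (rule abs_sin_x_le_abs_x)
  finally show ?thesis using False by (simp add: exp_entry_def divide_le_eq_1)
qed (simp add: exp_entry_def)

text \<open>Square-summability of a column, with a bound that depends on $t$ only through a shift of the
index.\<close>

lemma exp_entry_square_le: "(exp_entry m t)\<^sup>2 \<le> 1 / (of_int (m - round (- t)))\<^sup>2 + (if m = round (- t) then 1 else 0)"
proof (cases "m = round (- t)")
  case True
  then show ?thesis using abs_exp_entry_le[of m t] by (simp add: abs_square_le_1)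
next
  case ne: False
  show ?thesis
  proof (cases "t = - of_int m")
    case True
    with ne show ?thesis by simp
  next
    case False
    have "(exp_entry m t)\<^sup>2 = (sin (pi * t))\<^sup>2 / pi\<^sup>2 * (1 / (t + of_int m)\<^sup>2)"
      using False by (simp add: exp_entry_def power_divide power_mult_distrib)
    also have "\<dots> \<le> 1 / 4 * (4 / (of_int (m - round (- t)))\<^sup>2)"
    proof (intro mult_mono inverse_square_le_round ne)
      have "2\<^sup>2 \<le> pi\<^sup>2" using pi_ge_two by (intro power_mono) auto
      moreover have "(sin (pi * t))\<^sup>2 \<le> 1" by (simp add: abs_square_le_1)
      ultimately show "(sin (pi * t))\<^sup>2 / pi\<^sup>2 \<le> 1 / 4"
        using frac_le[of 1 "(sin (pi * t))\<^sup>2" 4 "pi\<^sup>2"] by simp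
    qed auto
    finally show ?thesis using ne by simp
  qed
qed

lemma exp_entry_square_sum_le:
  assumes "finite F"
  shows "(\<Sum>m\<in>F. (exp_entry (m - p) t)\<^sup>2) \<le> (\<Sum>\<^sub>\<infinity>n. 1 / (real_of_int n)\<^sup>2) + 1"
proof -
  let ?r = "round (- t) + p"
  have "(\<Sum>m\<in>F. (exp_entry (m - p) t)\<^sup>2) \<le> (\<Sum>m\<in>F. 1 / (real_of_int (m - ?r))\<^sup>2 + (if m = ?r then 1 else 0))"
  proof (rule sum_mono)
    fix m
    have "m - p - round (- t) = m - ?r" "m - p = round (- t) \<longleftrightarrow> m = ?r" by auto
    then show "(exp_entry (m - p) t)\<^sup>2 \<le> 1 / (real_of_int (m - ?r))\<^sup>2 + (if m = ?r then 1 else 0)"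
      using exp_entry_square_le[of "m - p" t] by (simp only:)
  qed
  also have "\<dots> = (\<Sum>m\<in>F. 1 / (real_of_int (m - ?r))\<^sup>2) + (\<Sum>m\<in>F. if m = ?r then 1 else 0)"
    by (rule sum.distrib)
  also have "\<dots> \<le> (\<Sum>\<^sub>\<infinity>n. 1 / (real_of_int n)\<^sup>2) + 1"
  proof (rule add_mono)
    show "(\<Sum>m\<in>F. 1 / (real_of_int (m - ?r))\<^sup>2) \<le> (\<Sum>\<^sub>\<infinity>n. 1 / (real_of_int n)\<^sup>2)"
      unfolding infsum_inverse_square_shift[of ?r, symmetric]
      by (rule finite_sum_le_infsum) (use inverse_square_summable_int[of ?r] assms in auto)
  qed (use assms in simp)
  finally show ?thesis .
qed

text \<open>The columns satisfy the differential equation $w' = Hw$ coordinatewise. For $t$ not an integer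
the sum is the cotangent series at $t + m - p$; for an integer $t$ the column has a single nonzero
entry.\<close>

lemma discrete_hilbert_exp_entry:
  "((\<lambda>n. exp_entry (n - p) t / of_int (m - n)) has_sum exp_entry_deriv (m - p) t) UNIV"
proof (cases "t \<in> \<int>")
  case True
  then obtain i where i: "t = of_int i" by (auto elim: Ints_cases)
  have "((\<lambda>n. exp_entry (n - p) t / of_int (m - n)) has_sum
      (\<Sum>n\<in>{p - i}. exp_entry (n - p) t / of_int (m - n))) UNIV"
    by (rule has_sum_cong_neutral[THEN iffD1, OF _ _ _ has_sum_finite[of "{p - i}"]])
       (auto simp: i exp_entry_int)
  moreover have "(\<Sum>n\<in>{p - i}. exp_entry (n - p) t / of_int (m - n)) = exp_entry_deriv (m - p) t"
  proof (cases "t = - of_int (m - p)")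
    case True
    then have "m = p - i" using i by (simp add: eq_neg_iff_add_eq_0 flip: of_int_add)
    then show ?thesis using True by (simp add: exp_entry_deriv_def)
  next
    case False
    then show ?thesis by (simp add: exp_entry_deriv_def i exp_entry_int algebra_simps)
  qed
  ultimately show ?thesis by simp
next
  case False
  define s where "s = t + of_int (m - p)"
  have s: "s \<notin> \<int>"
    using False Ints_diff[of s "of_int (m - p)"] by (auto simp: s_def)
  have ne: "t \<noteq> - of_int (m - p)" "s \<noteq> 0" using False s by auto
  have "((\<lambda>j. - (sin (pi * t) / pi) * (1 / (of_int j * (s + of_int j)))) has_sum
      - (sin (pi * t) / pi) * (1 / s\<^sup>2 - pi * cot (pi * s) / s)) UNIV"
    by (rule has_sum_cmult_right[OF cot_int_series[OF s]])
  moreover have "- (sin (pi * t) / pi) * (1 / s\<^sup>2 - pi * cot (pi * s) / s) = exp_entry_deriv (m - p) t"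
  proof -
    have "cos (pi * of_int (m - p)) \<noteq> 0" unfolding cos_npi_int by simp
    then have "cot (pi * s) = cot (pi * t)"
      unfolding cot_def s_def sin_pi_shift cos_pi_shift by simp
    moreover have "sin (pi * t) \<noteq> 0" using False by (auto simp: sin_zero_iff_int2 mult.commute)
    moreover have "exp_entry_deriv (m - p) t = cos (pi * t) / s - sin (pi * t) / (pi * s\<^sup>2)"
      using ne(1) by (simp only: exp_entry_deriv_def s_def if_False)
    ultimately show ?thesis
      using ne(2) by (simp add: cot_def right_diff_distrib)
  qed
  ultimately have "((\<lambda>j. exp_entry (j + m - p) t / of_int (- j)) has_sum exp_entry_deriv (m - p) t) UNIV"
    using False by (simp add: exp_entry_nonint s_def algebra_simps)
  moreover have "bij_betw (\<lambda>n. n - m) UNIV (UNIV :: int set)"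
    by (rule bij_betwI[of _ _ _ "\<lambda>n. n + m"]) auto
  ultimately show ?thesis
    using has_sum_reindex_bij_betw[of "\<lambda>n. n - m" UNIV UNIV "\<lambda>j. exp_entry (j + m - p) t / of_int (- j)"] by simp
qed

lemma norm_le_if_finite_sums:
  assumes "\<And>F. finite F \<Longrightarrow> (\<Sum>n\<in>F. (cmod (coord a n))\<^sup>2) \<le> C\<^sup>2" "0 \<le> C"
  shows "norm a \<le> C"
  using square_summable_bounded(2)[OF assms] by (simp add: coord_inverse)

lemma inner_sum_single:
  "inner y (\<Sum>n\<in>F. single n (c n)) = Re (\<Sum>n\<in>F. coord y n * cnj (c n))"
  unfolding inner_ell2_def bounded_bilinear.sum_right[OF bounded_bilinear_cinner] cinner_single_right ..

text \<open>Uniqueness for $y' = Ay$ when only the coordinates of $y$ are known to be differentiable. Norm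
bounds are integrated one vector at a time by pairing with finitely supported vectors; iterating
gives $\|y(t)\| \le B(\|A\|t)^k/k!$ for every $k$.\<close>

lemma coordinatewise_ode_zero:
  fixes y :: "real \<Rightarrow> ell2" and A :: "ell2 \<Rightarrow>\<^sub>L ell2"
  assumes zero: "y 0 = 0"
    and deriv: "\<And>n t. ((\<lambda>t. coord (y t) n) has_vector_derivative coord (A (y t)) n) (at t)"
    and bound: "\<And>t. norm (y t) \<le> B"
    and "0 \<le> t"
  shows "y t = 0"
proof -
  have "0 \<le> B" using bound[of 0] norm_ge_zero order_trans by blast
  have main: "norm (y t) \<le> B * (norm A * t) ^ k / fact k" if "0 \<le> t" for k t
    using that
  proof (induction k arbitrary: t)
    case 0
    then show ?case using bound by simp
  next
    case (Suc k)
    define M where "M = B * (norm A * t) ^ Suc k / fact (Suc k)"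
    have "0 \<le> M" using \<open>0 \<le> B\<close> Suc.prems by (simp add: M_def)
    have "norm (y t) \<le> M"
    proof (cases "t = 0")
      case False
      show ?thesis
      proof (rule norm_le_if_finite_sums[OF _ \<open>0 \<le> M\<close>])
        fix F :: "int set" assume "finite F"
        \<comment> \<open>Pairing with the truncation of y(t) turns the coordinatewise equation into a scalar one.\<close>
        define b where "b = (\<Sum>n\<in>F. single n (coord (y t) n))"
        define g where "g = (\<lambda>s. inner (y s) b)"
        have g_eq: "g s = Re (\<Sum>n\<in>F. coord (y s) n * cnj (coord (y t) n))" for s
          unfolding g_def b_def by (rule inner_sum_single)
        have g_deriv: "(g has_vector_derivative inner (A (y s)) b) (at s)" for s
        proof -
          have "((\<lambda>s. \<Sum>n\<in>F. coord (y s) n * cnj (coord (y t) n)) has_vector_derivative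
              (\<Sum>n\<in>F. coord (A (y s)) n * cnj (coord (y t) n))) (at s)"
            by (intro derivative_intros deriv)
          from bounded_linear.has_vector_derivative[OF bounded_linear_Re this]
          show ?thesis unfolding b_def inner_sum_single g_eq[abs_def] .
        qed
        define phi where "phi = (\<lambda>s. norm b * (B * (norm A * s) ^ Suc k / fact (Suc k)))"
        have "norm (g t - g 0) \<le> phi t - phi 0"
        proof (rule differentiable_bound_general)
          show "0 < t" using Suc.prems False by simp
          show "continuous_on {0..t} g"
            using g_deriv by (intro continuous_at_imp_continuous_on ballI)
              (blast intro: has_vector_derivative_continuous)
          show "continuous_on {0..t} phi" unfolding phi_def by (intro continuous_intros) auto
          show "(g has_vector_derivative inner (A (y s)) b) (at s)" for s by (rule g_deriv)
          show "(phi has_vector_derivative norm b * (norm A * (B * (norm A * s) ^ k / fact k))) (at s)" for s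
          proof -
            define c where "c = norm b * (B * norm A ^ Suc k / fact (Suc k))"
            have "phi = (\<lambda>s. c * s ^ Suc k)"
              by (simp add: phi_def c_def power_mult_distrib fun_eq_iff)
            moreover have "c * (real (Suc k) * s ^ (Suc k - Suc 0))
                = norm b * (norm A * (B * (norm A * s) ^ k / fact k))"
            proof -
              have "c * real (Suc k) = norm b * (B * norm A ^ Suc k / fact k)"
                unfolding c_def fact_Suc of_nat_mult by (simp del: of_nat_Suc)
              then have "c * (real (Suc k) * s ^ (Suc k - Suc 0)) = norm b * (B * norm A ^ Suc k / fact k) * s ^ k"
                by (simp flip: mult.assoc del: of_nat_Suc)
              then show ?thesis by (simp add: power_mult_distrib)
            qed
            ultimately show ?thesis
              using DERIV_cmult[OF DERIV_pow, of c "Suc k" s]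
              unfolding has_real_derivative_iff_has_vector_derivative by (simp only:)
          qed
          show "norm (inner (A (y s)) b) \<le> norm b * (norm A * (B * (norm A * s) ^ k / fact k))"
            if "0 < s" for s
          proof -
            have "norm (inner (A (y s)) b) \<le> norm (A (y s)) * norm b"
              by (simp add: Cauchy_Schwarz_ineq2)
            also have "\<dots> \<le> (norm A * norm (y s)) * norm b"
              by (intro mult_right_mono norm_blinfun) auto
            also have "\<dots> \<le> (norm A * (B * (norm A * s) ^ k / fact k)) * norm b"
              using that by (intro mult_right_mono mult_left_mono Suc.IH) auto
            finally show ?thesis by (simp add: mult.commute)
          qed
        qed
        moreover have "g 0 = 0" by (simp add: g_def zero)
        moreover have "phi t = norm b * M" "phi 0 = 0" by (simp_all add: phi_def M_def)
        moreover have g_t: "g t = (\<Sum>n\<in>F. (cmod (coord (y t) n))\<^sup>2)"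
          unfolding g_eq by (simp flip: complex_norm_square of_real_sum)
        moreover have "g t = (norm b)\<^sup>2"
        proof -
          have "(norm b)\<^sup>2 = inner b b" by (rule power2_norm_eq_inner)
          also have "\<dots> = Re (\<Sum>n\<in>F. coord b n * cnj (coord (y t) n))"
            unfolding b_def inner_sum_single ..
          also have "(\<Sum>n\<in>F. coord b n * cnj (coord (y t) n)) = (\<Sum>n\<in>F. coord (y t) n * cnj (coord (y t) n))"
            unfolding b_def coord_sum_single[OF \<open>finite F\<close>] by simp
          finally show ?thesis unfolding g_eq by simp
        qed
        ultimately have "(norm b)\<^sup>2 \<le> norm b * M" "(\<Sum>n\<in>F. (cmod (coord (y t) n))\<^sup>2) = (norm b)\<^sup>2"
          by auto
        moreover from this(1) have "norm b \<le> M"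
          using \<open>0 \<le> M\<close> by (cases "norm b = 0") (simp_all add: power2_eq_square)
        then have "(norm b)\<^sup>2 \<le> M\<^sup>2" by (intro power_mono) auto
        ultimately show "(\<Sum>n\<in>F. (cmod (coord (y t) n))\<^sup>2) \<le> M\<^sup>2" by simp
      qed
    qed (use zero \<open>0 \<le> M\<close> in simp)
    then show ?case by (simp add: M_def)
  qed
  have "(\<lambda>k. B * (inverse (fact k) * (norm A * t) ^ k)) \<longlonglongrightarrow> B * 0"
    by (intro tendsto_intros summable_LIMSEQ_zero summable_exp)
  moreover have "\<forall>k. norm (y t) \<le> B * (inverse (fact k) * (norm A * t) ^ k)"
    using main[OF \<open>0 \<le> t\<close>] by (simp add: field_simps)
  ultimately have "norm (y t) \<le> B * 0"
    using LIMSEQ_le_const by blast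
  then show ?thesis by simp
qed

text \<open>Both sides solve the same coordinatewise equation with the same value at $0$, and both are
bounded in norm uniformly in $t$. Negative times are handled by reversing time and replacing $H$ by
$-H$.\<close>

lemma exp_hilbert_single_coord:
  "coord (exp_hilbert t (single p z)) m = z * of_real (exp_entry (m - p) t)"
proof -
  define C where "C = cmod z * sqrt ((\<Sum>\<^sub>\<infinity>n. 1 / (real_of_int n)\<^sup>2) + 1)"
  have c: "0 \<le> (\<Sum>\<^sub>\<infinity>n. 1 / (real_of_int n)\<^sup>2)" by (rule infsum_nonneg) simp
  have "\<exists>w. (\<forall>n. coord w n = z * of_real (exp_entry (n - p) s)) \<and> norm w \<le> C" for s
  proof -
    have "(\<Sum>n\<in>F. (cmod (z * of_real (exp_entry (n - p) s)))\<^sup>2) \<le> C\<^sup>2" if "finite F" for F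
      using exp_entry_square_sum_le[OF that, of p s] c
      by (simp add: C_def norm_mult power_mult_distrib mult_left_mono flip: sum_distrib_left)
    note sums = this
    have "0 \<le> C" using c by (simp add: C_def)
    show ?thesis by (rule ell2_of_bounded_sums[OF sums \<open>0 \<le> C\<close>]) blast+
  qed
  then obtain w where w: "\<And>s n. coord (w s) n = z * of_real (exp_entry (n - p) s)" "\<And>s. norm (w s) \<le> C"
    by metis
  define y where "y = (\<lambda>s. exp_hilbert s (single p z) - w s)"
  have w0: "w 0 = single p z"
    by (rule ell2_eqI) (use exp_entry_int[of _ 0] in \<open>simp add: w single.rep_eq\<close>)
  have w_deriv: "((\<lambda>s. coord (w s) n) has_vector_derivative coord (discrete_hilbert (w s)) n) (at s)" for n s
  proof -
    have "((\<lambda>l. z * of_real (exp_entry (l - p) s / of_int (n - l))) has_sum z * of_real (exp_entry_deriv (n - p) s)) UNIV"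
      by (intro has_sum_cmult_right has_sum_of_real discrete_hilbert_exp_entry)
    then have "((\<lambda>l. coord (w s) l / of_int (n - l)) has_sum z * of_real (exp_entry_deriv (n - p) s)) UNIV"
      by (simp add: w)
    from has_sum_unique[OF this discrete_hilbert_has_sum[OF coord_summable]]
    have "coord (discrete_hilbert (w s)) n = z * of_real (exp_entry_deriv (n - p) s)"
      by (simp add: discrete_hilbert.rep_eq discrete_hilbert_fun.rep_eq)
    moreover have "((\<lambda>s. z * of_real (exp_entry (n - p) s)) has_vector_derivative z * of_real (exp_entry_deriv (n - p) s)) (at s)"
      by (intro has_vector_derivative_mult_right has_vector_derivative_of_real
          exp_entry_has_derivative)
    ultimately show ?thesis by (simp add: w)
  qed
  have y_deriv: "((\<lambda>s. coord (y s) n) has_vector_derivative coord (discrete_hilbert (y s)) n) (at s)" for n s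
    using has_vector_derivative_diff[OF bounded_linear.has_vector_derivative[OF bounded_linear_coord
        exp_hilbert_has_vector_derivative] w_deriv]
    by (simp add: y_def blinfun.diff_right)
  have y_bound: "norm (y s) \<le> cmod z + C" for s
    using norm_triangle_ineq4[of "exp_hilbert s (single p z)" "w s"] w(2)[of s] by (simp add: y_def)
  have y0: "y 0 = 0" by (simp add: y_def w0)
  have "y t = 0"
  proof (cases "0 \<le> t")
    case True
    then show ?thesis by (rule coordinatewise_ode_zero[OF y0 y_deriv y_bound])
  next
    case False
    have "((\<lambda>s. coord (y (- s)) n) has_vector_derivative coord ((- discrete_hilbert) (y (- s))) n) (at s)" for n s
    proof -
      have "((\<lambda>s. - s) has_vector_derivative (- 1 :: real)) (at s)"
        by (auto intro!: derivative_eq_intros)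
      from vector_diff_chain_at[OF this y_deriv]
      show ?thesis by (simp add: o_def blinfun.minus_left)
    qed
    from coordinatewise_ode_zero[of "\<lambda>s. y (- s)", OF _ this y_bound, of "- t"] False y0
    show ?thesis by simp
  qed
  then show ?thesis by (simp add: y_def flip: w)
qed

lemma coord_exp_hilbert_has_sum:
  "((\<lambda>n. coord a n * of_real (exp_entry (m - n) t)) has_sum coord (exp_hilbert t a) m) UNIV"
proof -
  have "bounded_linear (\<lambda>a. coord (exp_hilbert t a) m)"
    by (rule bounded_linear_compose[OF bounded_linear_coord blinfun.bounded_linear_right])
  from has_sum_bounded_linear[OF this has_sum_single[of a]]
  show ?thesis by (simp add: exp_hilbert_single_coord)
qed

lemma coord_exp_hilbert_int: "coord (exp_hilbert (of_int n) a) m = of_real (cos (pi * of_int n)) * coord a (m + n)"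
proof -
  have "((\<lambda>l. coord a l * of_real (exp_entry (m - l) (of_int n))) has_sum
      (\<Sum>l\<in>{m + n}. coord a l * of_real (exp_entry (m - l) (of_int n)))) UNIV"
    by (rule has_sum_cong_neutral[THEN iffD1, OF _ _ _ has_sum_finite[of "{m + n}"]])
       (auto simp: exp_entry_int)
  from has_sum_unique[OF coord_exp_hilbert_has_sum this] show ?thesis
    by (simp add: exp_entry_int)
qed

text \<open>This is $U(t+n) = U(n)U(t)$, where $U(n)$ is $(-1)^n$ times a shift. It reduces sampling at $t_k$
to sampling at the small number $t_k - k$.\<close>

lemma coord_exp_hilbert_shift:
  "coord (exp_hilbert (t + of_int n) a) m = of_real (cos (pi * of_int n)) * coord (exp_hilbert t a) (m + n)"
proof -
  have "((\<lambda>l. of_real (cos (pi * of_int n)) * (coord a l * of_real (exp_entry (m + n - l) t))) has_sum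
      of_real (cos (pi * of_int n)) * coord (exp_hilbert t a) (m + n)) UNIV"
    by (rule has_sum_cmult_right[OF coord_exp_hilbert_has_sum])
  moreover have "of_real (cos (pi * of_int n)) * (coord a l * of_real (exp_entry (m + n - l) t))
      = coord a l * of_real (exp_entry (m - l) (t + of_int n))" for l
  proof -
    have "m - l = m + n - l - n" by simp
    then have "exp_entry (m - l) (t + of_int n) = cos (pi * of_int n) * exp_entry (m + n - l) t"
      using exp_entry_shift[of "m + n - l" n t] by (simp only:)
    then show ?thesis by simp
  qed
  ultimately have "((\<lambda>l. coord a l * of_real (exp_entry (m - l) (t + of_int n))) has_sum
      of_real (cos (pi * of_int n)) * coord (exp_hilbert t a) (m + n)) UNIV"
    by (simp only:)
  from has_sum_unique[OF coord_exp_hilbert_has_sum this] show ?thesis .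
qed


section \<open>The function Psi from its values at the integers\<close>

lemma bounded_bilinear_Psi: "bounded_bilinear (\<lambda>a b. Psi a b t)"
proof (cases "t = 0")
  case True
  show ?thesis
    unfolding Psi_def using True
    by (simp add: bounded_bilinear.comp1[OF bounded_bilinear_cinner blinfun.bounded_linear_right])
next
  case False
  have "bounded_linear (\<lambda>a. (1 / t) *\<^sub>R (exp_hilbert t a - a))"
    by (intro bounded_linear_scaleR_right[THEN bounded_linear_compose] bounded_linear_sub
        blinfun.bounded_linear_right bounded_linear_ident)
  from bounded_bilinear.comp1[OF bounded_bilinear_cinner this] show ?thesis
    unfolding Psi_def using False by (simp only: if_False)
qed

text \<open>The factor $1/n$ in the difference quotient makes the values at the integers square-summable.\<close>

lemma norm_Psi_int_le:
  "cmod (Psi a b (of_int n)) \<le> norm a * norm b * (if n = 0 then norm discrete_hilbert else 2 / \<bar>of_int n\<bar>)"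
proof (cases "n = 0")
  case True
  have "cmod (cinner (discrete_hilbert a) b) \<le> norm (discrete_hilbert a) * norm b"
    by (rule norm_cinner_le)
  also have "\<dots> \<le> (norm discrete_hilbert * norm a) * norm b"
    by (intro mult_right_mono norm_blinfun) auto
  finally show ?thesis using True by (simp add: Psi_def algebra_simps)
next
  case False
  have "norm (exp_hilbert (of_int n) a - a) \<le> 2 * norm a"
    using norm_triangle_ineq4[of "exp_hilbert (of_int n) a" a] by simp
  then have "norm ((1 / real_of_int n) *\<^sub>R (exp_hilbert (of_int n) a - a)) \<le> 1 / \<bar>of_int n\<bar> * (2 * norm a)"
    by (simp add: divide_right_mono)
  then have "cmod (cinner ((1 / real_of_int n) *\<^sub>R (exp_hilbert (of_int n) a - a)) b)
      \<le> 1 / \<bar>of_int n\<bar> * (2 * norm a) * norm b"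
    by (intro order_trans[OF norm_cinner_le] mult_right_mono) auto
  then show ?thesis using False by (simp add: Psi_def field_simps)
qed

text \<open>The vector $v$ with $F_v(n) = \Psi(n)$ at every integer $n$.\<close>

definition Psi_samples :: "ell2 \<Rightarrow> ell2 \<Rightarrow> ell2"
  where "Psi_samples a b = Abs_ell2 (\<lambda>n. of_real (cos (pi * of_int n)) * Psi a b (of_int n))"

lemma Psi_samples:
  shows coord_Psi_samples: "coord (Psi_samples a b) n = of_real (cos (pi * of_int n)) * Psi a b (of_int n)"
    and norm_Psi_samples_le: "norm (Psi_samples a b)
      \<le> norm a * norm b * sqrt ((norm discrete_hilbert)\<^sup>2 + 4 * (\<Sum>\<^sub>\<infinity>n. 1 / (real_of_int n)\<^sup>2))"
proof -
  let ?f = "\<lambda>n. complex_of_real (cos (pi * of_int n)) * Psi a b (of_int n)"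
  define c where "c = (\<Sum>\<^sub>\<infinity>n. 1 / (real_of_int n)\<^sup>2)"
  define K where "K = (norm discrete_hilbert)\<^sup>2 + 4 * c"
  have "0 \<le> c" unfolding c_def by (rule infsum_nonneg) simp
  then have "0 \<le> K" by (simp add: K_def)
  have bound: "(\<Sum>n\<in>F. (cmod (?f n))\<^sup>2) \<le> (norm a * norm b * sqrt K)\<^sup>2" if "finite F" for F
  proof -
    have term_le: "(cmod (?f n))\<^sup>2 \<le> (norm a * norm b)\<^sup>2 *
        ((if n = 0 then (norm discrete_hilbert)\<^sup>2 else 0) + 4 * (1 / (real_of_int (n - 0))\<^sup>2))" for n
    proof -
      have "cmod (?f n) = cmod (Psi a b (of_int n))"
        by (simp add: norm_mult cos_npi_int)
      then have "(cmod (?f n))\<^sup>2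
          \<le> (norm a * norm b * (if n = 0 then norm discrete_hilbert else 2 / \<bar>of_int n\<bar>))\<^sup>2"
        using norm_Psi_int_le[of a b n] by (simp only:) (intro power_mono, auto)
      then show ?thesis by (simp add: power_mult_distrib power_divide split: if_splits)
    qed
    have "(\<Sum>n\<in>F. (cmod (?f n))\<^sup>2) \<le> (norm a * norm b)\<^sup>2 *
        ((\<Sum>n\<in>F. if n = 0 then (norm discrete_hilbert)\<^sup>2 else 0) + 4 * (\<Sum>n\<in>F. 1 / (real_of_int (n - 0))\<^sup>2))"
      using sum_mono[OF term_le] by (simp only: sum_distrib_left[symmetric] sum.distrib)
    also have "\<dots> \<le> (norm a * norm b)\<^sup>2 * K"
      unfolding K_def
    proof (intro mult_left_mono add_mono)
      show "(\<Sum>n\<in>F. 1 / (real_of_int (n - 0))\<^sup>2) \<le> c"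
        unfolding c_def infsum_inverse_square_shift[of 0, symmetric]
        by (rule finite_sum_le_infsum) (use inverse_square_summable_int[of 0] that in auto)
    qed (use that in auto)
    finally show ?thesis using \<open>0 \<le> K\<close> by (simp add: power_mult_distrib)
  qed
  have nonneg: "0 \<le> norm a * norm b * sqrt K" using \<open>0 \<le> K\<close> by simp
  note * = square_summable_bounded[OF bound nonneg]
  show "coord (Psi_samples a b) n = ?f n"
    using *(1) by (simp add: Psi_samples_def Abs_ell2_inverse)
  show "norm (Psi_samples a b)
      \<le> norm a * norm b * sqrt ((norm discrete_hilbert)\<^sup>2 + 4 * (\<Sum>\<^sub>\<infinity>n. 1 / (real_of_int n)\<^sup>2))"
    using *(2) by (simp add: Psi_samples_def K_def c_def)
qed

text \<open>Boundedness as a bilinear map is needed to extend identities from finitely supported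
sequences.\<close>

lemma bounded_bilinear_Psi_samples: "bounded_bilinear Psi_samples"
proof
  fix a a' b b' :: ell2 and r :: real
  note lin = bounded_bilinear.add_left[OF bounded_bilinear_Psi] bounded_bilinear.add_right[OF bounded_bilinear_Psi]
    bounded_bilinear.scaleR_left[OF bounded_bilinear_Psi] bounded_bilinear.scaleR_right[OF bounded_bilinear_Psi]
  show "Psi_samples (a + a') b = Psi_samples a b + Psi_samples a' b"
    by (rule ell2_eqI) (simp only: coord_simps coord_Psi_samples lin distrib_left)
  show "Psi_samples a (b + b') = Psi_samples a b + Psi_samples a b'"
    by (rule ell2_eqI) (simp only: coord_simps coord_Psi_samples lin distrib_left)
  show "Psi_samples (r *\<^sub>R a) b = r *\<^sub>R Psi_samples a b"
    by (rule ell2_eqI) (simp only: coord_simps coord_Psi_samples lin mult_scaleR_right)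
  show "Psi_samples a (r *\<^sub>R b) = r *\<^sub>R Psi_samples a b"
    by (rule ell2_eqI) (simp only: coord_simps coord_Psi_samples lin mult_scaleR_right)
  show "\<exists>K. \<forall>a b. norm (Psi_samples a b) \<le> norm a * norm b * K"
    using norm_Psi_samples_le by blast
qed

lemma bounded_bilinear_post:
  assumes "bounded_bilinear f" "bounded_linear h"
  shows "bounded_bilinear (\<lambda>a b. h (f a b))"
proof
  interpret f: bounded_bilinear f by fact
  interpret h: bounded_linear h by fact
  fix a a' b b' r
  show "h (f (a + a') b) = h (f a b) + h (f a' b)" by (simp add: f.add_left h.add)
  show "h (f a (b + b')) = h (f a b) + h (f a b')" by (simp add: f.add_right h.add)
  show "h (f (r *\<^sub>R a) b) = r *\<^sub>R h (f a b)" by (simp add: f.scaleR_left h.scaleR)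
  show "h (f a (r *\<^sub>R b)) = r *\<^sub>R h (f a b)" by (simp add: f.scaleR_right h.scaleR)
  obtain K where K: "\<And>a b. norm (f a b) \<le> norm a * norm b * K" using f.bounded by blast
  obtain L where L: "\<And>x. norm (h x) \<le> norm x * L" "0 \<le> L" using h.nonneg_bounded by blast
  show "\<exists>M. \<forall>a b. norm (h (f a b)) \<le> norm a * norm b * M"
  proof (intro exI allI)
    fix a b
    have "norm (h (f a b)) \<le> norm (f a b) * L" by (rule L)
    also have "\<dots> \<le> norm a * norm b * K * L" using L(2) K by (rule mult_right_mono[rotated])
    finally show "norm (h (f a b)) \<le> norm a * norm b * (K * L)" by (simp add: mult.assoc)
  qed
qed

lemma Psi_single:
  "Psi (single p z) (single q w) t = z * cnj w *
    of_real (if t = 0 then 1 / of_int (q - p) else (exp_entry (q - p) t - (if q = p then 1 else 0)) / t)"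
  by (auto simp: Psi_def coord_discrete_hilbert_single exp_hilbert_single_coord single.rep_eq
      scaleR_conv_of_real field_simps)

text \<open>The interpolation series of $\Psi$ at the integers when both sequences are unit vectors. For
$m \ne 0$ only the indices $0$ and $-m$ contribute; for $m = 0$ the series is the one of the
cosecant.\<close>

lemma sampling_series_of_matrix_entry:
  fixes x :: real
  assumes "x \<notin> \<int>"
  shows "((\<lambda>n. cos (pi * of_int n)
      * (if real_of_int n = 0 then 1 / of_int m else (exp_entry m (of_int n) - (if m = 0 then 1 else 0)) / of_int n)
      * exp_entry (- n) x) has_sum (exp_entry m x - (if m = 0 then 1 else 0)) / x) UNIV" (is "(?f has_sum _) UNIV")
proof (cases "m = 0")
  case True
  have "x \<noteq> 0" and sin: "sin (pi * x) \<noteq> 0"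
    using assms by (auto simp: sin_zero_iff_int2 mult.commute)
  have "((\<lambda>j. sin (pi * x) / pi * (cos (pi * of_int j) / (of_int j * (x + of_int j)))) has_sum
      sin (pi * x) / pi * (1 / x\<^sup>2 - pi / (x * sin (pi * x)))) UNIV"
    by (rule has_sum_cmult_right[OF cosec_int_series[OF assms]])
  moreover have "sin (pi * x) / pi * (1 / x\<^sup>2 - pi / (x * sin (pi * x))) = (exp_entry m x - (if m = 0 then 1 else 0)) / x"
    using True \<open>x \<noteq> 0\<close> sin by (simp add: exp_entry_nonint[OF assms] field_simps power2_eq_square)
  moreover have "sin (pi * x) / pi * (cos (pi * of_int j) / (of_int j * (x + of_int j))) = ?f (- j)" for j
    using True exp_entry_int[of 0 "- j"] by (simp add: exp_entry_nonint[OF assms])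
  ultimately have reflected: "((\<lambda>j. ?f (- j)) has_sum (exp_entry m x - (if m = 0 then 1 else 0)) / x) UNIV"
    by (simp only:)
  have "bij_betw uminus UNIV (UNIV :: int set)"
    by (rule bij_betwI[of _ _ _ uminus]) auto
  from has_sum_reindex_bij_betw[OF this, THEN iffD1, OF reflected] show ?thesis .
next
  case False
  have nz: "x \<noteq> 0" "x + of_int m \<noteq> 0"
    using assms by (auto simp: add_eq_0_iff2)
  have "(?f has_sum (\<Sum>n\<in>{0, - m}. ?f n)) UNIV"
    by (rule has_sum_cong_neutral[THEN iffD1, OF _ _ _ has_sum_finite[of "{0, - m}"]])
       (use False in \<open>auto simp: exp_entry_int\<close>)
  moreover have "(\<Sum>n\<in>{0, - m}. ?f n) = 1 / of_int m * exp_entry 0 x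
      + cos (pi * of_int m) * (cos (pi * of_int m) / - of_int m) * exp_entry m x"
    using False exp_entry_int[of m "- m"] by simp
  moreover have "1 / of_int m * exp_entry 0 x + cos (pi * of_int m) * (cos (pi * of_int m) / - of_int m) * exp_entry m x
      = 1 / of_int m * (exp_entry 0 x - exp_entry m x)"
    using cos_pi_int_square[of m] by (simp add: algebra_simps)
  moreover have "1 / of_int m * (exp_entry 0 x - exp_entry m x) = exp_entry m x / x"
    using nz False by (simp add: exp_entry_nonint[OF assms] divide_simps) (simp add: algebra_simps)
  ultimately have "(?f has_sum exp_entry m x / x) UNIV" by (simp only:)
  then show ?thesis using False by simp
qed

text \<open>$\Psi$ has the form $F_v$. Both sides are bounded and bilinear in the two sequences, so it is
enough to compare them on unit vectors.\<close>

lemma Psi_eq_coord_exp_hilbert: "Psi a b x = coord (exp_hilbert x (Psi_samples a b)) 0"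
proof (cases "x \<in> \<int>")
  case True
  then obtain n where n: "x = of_int n" by (auto elim: Ints_cases)
  have "coord (exp_hilbert x (Psi_samples a b)) 0
      = of_real (cos (pi * of_int n) * cos (pi * of_int n)) * Psi a b x"
    unfolding n coord_exp_hilbert_int coord_Psi_samples by (simp only: of_real_mult mult.assoc add_0)
  then show ?thesis by (simp only: cos_pi_int_square of_real_1 mult_1)
next
  case False
  show ?thesis
  proof (rule bounded_bilinear_eq_on_singles[where f = "\<lambda>a b. Psi a b x"
        and g = "\<lambda>a b. coord (exp_hilbert x (Psi_samples a b)) 0"])
    show "bounded_bilinear (\<lambda>a b. coord (exp_hilbert x (Psi_samples a b)) 0)"
      by (rule bounded_bilinear_post[OF bounded_bilinear_Psi_samples
          bounded_linear_compose[OF bounded_linear_coord blinfun.bounded_linear_right]])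
    fix p q z w
    define g where "g = (\<lambda>n. cos (pi * of_int n)
      * (if real_of_int n = 0 then 1 / of_int (q - p)
         else (exp_entry (q - p) (of_int n) - (if q - p = 0 then 1 else 0)) / of_int n) * exp_entry (- n) x)"
    have "((\<lambda>n. z * cnj w * of_real (g n)) has_sum
        z * cnj w * of_real ((exp_entry (q - p) x - (if q - p = 0 then 1 else 0)) / x)) UNIV"
      unfolding g_def by (intro has_sum_cmult_right has_sum_of_real sampling_series_of_matrix_entry False)
    moreover have "z * cnj w * of_real (g n)
        = coord (Psi_samples (single p z) (single q w)) n * of_real (exp_entry (0 - n) x)" for n
      by (simp add: g_def coord_Psi_samples Psi_single)
    moreover have "x \<noteq> 0" using False by auto
    then have "z * cnj w * of_real ((exp_entry (q - p) x - (if q - p = 0 then 1 else 0)) / x)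
        = Psi (single p z) (single q w) x"
      by (simp add: Psi_single)
    ultimately have "((\<lambda>n. coord (Psi_samples (single p z) (single q w)) n * of_real (exp_entry (0 - n) x)) has_sum
        Psi (single p z) (single q w) x) UNIV"
      by (simp only:)
    from has_sum_unique[OF this coord_exp_hilbert_has_sum]
    show "Psi (single p z) (single q w) x = coord (exp_hilbert x (Psi_samples (single p z) (single q w))) 0" .
  qed (rule bounded_bilinear_Psi)
qed


section \<open>Kadec's estimate\<close>

text \<open>In Fourier series this is multiplication by $\cos(nu)$, where $u = \pi - \theta$.\<close>

definition cosine_op :: "nat \<Rightarrow> ell2 \<Rightarrow>\<^sub>L ell2"
  where "cosine_op n = (if n = 0 then id_blinfun
    else (1 / 2) *\<^sub>R (exp_hilbert (real n) + exp_hilbert (- real n)))"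

text \<open>In Fourier series this is multiplication by $i\sin((n+1/2)u)$, where $u = \pi - \theta$.\<close>

definition sine_op :: "nat \<Rightarrow> ell2 \<Rightarrow>\<^sub>L ell2"
  where "sine_op n = (1 / 2) *\<^sub>R (exp_hilbert (real n + 1 / 2) - exp_hilbert (- (real n + 1 / 2)))"

text \<open>Together with \<open>sine_coeff\<close>, the coefficients of Kadec's expansion of $1 - e^{ixu}$ on
$[-\pi,\pi]$ in the orthogonal system $1$, $\cos(nu)$, $i\sin((n+1/2)u)$ with $n$ starting at $1$
for the cosines and at $0$ for the sines. The half-integer frequencies make the coefficients decay
like $1/n^2$.\<close>

definition cosine_coeff :: "real \<Rightarrow> nat \<Rightarrow> real"
  where "cosine_coeff x n = (if n = 0 then 1 - exp_entry 0 x
    else 2 * cos (pi * real n) * x * sin (pi * x) / (pi * ((real n)\<^sup>2 - x\<^sup>2)))"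

definition sine_coeff :: "real \<Rightarrow> nat \<Rightarrow> real"
  where "sine_coeff x n = - (2 * cos (pi * real n) * x * cos (pi * x) / (pi * ((real n + 1 / 2)\<^sup>2 - x\<^sup>2)))"

lemma norm_cosine_op: "norm (cosine_op n a) \<le> norm a"
proof (cases "n = 0")
  case False
  have "norm (cosine_op n a) = 1 / 2 * norm (exp_hilbert (real n) a + exp_hilbert (- real n) a)"
    using False by (simp add: cosine_op_def blinfun.scaleR_left blinfun.add_left)
  also have "\<dots> \<le> 1 / 2 * (norm a + norm a)"
    using norm_triangle_ineq[of "exp_hilbert (real n) a" "exp_hilbert (- real n) a"] by simp
  finally show ?thesis by simp
qed (simp add: cosine_op_def)

lemma norm_sine_op: "norm (sine_op n a) \<le> norm a"
proof -
  have "norm (sine_op n a) = 1 / 2 * norm (exp_hilbert (real n + 1 / 2) a - exp_hilbert (- (real n + 1 / 2)) a)"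
    by (simp add: sine_op_def blinfun.scaleR_left blinfun.diff_left)
  also have "\<dots> \<le> 1 / 2 * (norm a + norm a)"
    using norm_triangle_ineq4[of "exp_hilbert (real n + 1 / 2) a" "exp_hilbert (- (real n + 1 / 2)) a"] by simp
  finally show ?thesis by simp
qed

lemma coord_cosine_op_single:
  "coord (cosine_op n (single p z)) m = z * of_real
    (if n = 0 then (if m = p then 1 else 0) else (exp_entry (m - p) (real n) + exp_entry (m - p) (- real n)) / 2)"
  by (auto simp: cosine_op_def blinfun.scaleR_left blinfun.add_left exp_hilbert_single_coord
      single.rep_eq scaleR_conv_of_real algebra_simps)

lemma coord_sine_op_single:
  "coord (sine_op n (single p z)) m
    = z * of_real ((exp_entry (m - p) (real n + 1 / 2) - exp_entry (m - p) (- (real n + 1 / 2))) / 2)"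
  by (simp add: sine_op_def blinfun.scaleR_left blinfun.diff_left exp_hilbert_single_coord
      scaleR_conv_of_real algebra_simps)

lemma not_Ints_if_small:
  fixes x :: real
  assumes "x \<noteq> 0" "\<bar>x\<bar> < 1 / 2"
  shows "x \<notin> \<int>" "x + 1 / 2 \<notin> \<int>"
proof -
  show "x \<notin> \<int>" using assms by (auto elim!: Ints_cases)
  show "x + 1 / 2 \<notin> \<int>"
  proof
    assume "x + 1 / 2 \<in> \<int>"
    then obtain k where "x + 1 / 2 = of_int k" by (auto elim: Ints_cases)
    then have "0 < real_of_int k" "real_of_int k < 1" using assms(2) by auto
    then show False by simp
  qed
qed

lemma half_not_Ints: "real_of_int m + 1 / 2 \<notin> \<int>"
proof
  assume "real_of_int m + 1 / 2 \<in> \<int>"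
  then obtain k where "real_of_int m + 1 / 2 = of_int k" by (auto elim: Ints_cases)
  then have "0 < real_of_int (k - m)" "real_of_int (k - m) < 1" by auto
  then show False by simp
qed

lemma tan_pi_int: "tan (pi * real_of_int m) = 0"
  by (simp add: tan_def)

text \<open>Here $m$ is the row index minus the column index; only the term with $n = |m|$ is nonzero.\<close>

lemma cosine_series:
  assumes x: "\<bar>x\<bar> < 1 / 2" "x \<noteq> 0"
  shows "(\<lambda>n. cosine_coeff x n
      * (if n = 0 then (if m = 0 then 1 else 0) else (exp_entry m (real n) + exp_entry m (- real n)) / 2))
    sums ((if m = 0 then 1 else 0) - (exp_entry m x + exp_entry m (- x)) / 2)" (is "?f sums _")
proof -
  have nint: "x \<notin> \<int>" "- x \<notin> \<int>" using not_Ints_if_small[of x] not_Ints_if_small[of "- x"] x by auto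
  have exp_entry_int': "exp_entry m (real n) = (if int n = - m then cos (pi * real n) else 0)"
    "exp_entry m (- real n) = (if int n = m then cos (pi * real n) else 0)" for n
    using exp_entry_int[of m "int n"] exp_entry_int[of m "- int n"]
    by (simp_all only: of_int_minus of_int_of_nat_eq mult_minus_right cos_minus neg_equal_iff_equal)
  have "?f sums (\<Sum>n\<in>{nat \<bar>m\<bar>}. ?f n)"
    by (rule sums_finite) (auto simp: exp_entry_int')
  moreover have "(\<Sum>n\<in>{nat \<bar>m\<bar>}. ?f n) = (if m = 0 then 1 else 0) - (exp_entry m x + exp_entry m (- x)) / 2"
  proof (cases "m = 0")
    case True
    have "exp_entry 0 (- x) = exp_entry 0 x" by (simp add: exp_entry_def)
    with True show ?thesis by (simp add: cosine_coeff_def)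
  next
    case False
    define k where "k = real_of_int m"
    have real_abs: "real (nat \<bar>m\<bar>) = \<bar>k\<bar>" by (simp add: k_def)
    have sq: "cos (pi * \<bar>k\<bar>) * cos (pi * \<bar>k\<bar>) = 1"
      using cos_pi_int_square[of "\<bar>m\<bar>"] by (simp add: k_def)
    have "x + k \<noteq> 0" "x - k \<noteq> 0"
      using nint(1) by (auto simp: k_def add_eq_0_iff2)
    note fr = paired_fractions[OF this]
    have "(exp_entry m (real (nat \<bar>m\<bar>)) + exp_entry m (- real (nat \<bar>m\<bar>))) / 2 = cos (pi * \<bar>k\<bar>) / 2"
      using False exp_entry_int'[of "nat \<bar>m\<bar>"] by (cases "0 \<le> m") (simp_all add: k_def)
    then have "(\<Sum>n\<in>{nat \<bar>m\<bar>}. ?f n) = cosine_coeff x (nat \<bar>m\<bar>) * (cos (pi * \<bar>k\<bar>) / 2)"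
      using False by simp
    also have "\<dots> = cos (pi * \<bar>k\<bar>) * cos (pi * \<bar>k\<bar>) * (x * sin (pi * x) / (pi * (k\<^sup>2 - x\<^sup>2)))"
      using False real_abs by (simp add: cosine_coeff_def)
    also have "\<dots> = - (sin (pi * x) / (2 * pi) * (2 * x / (x\<^sup>2 - k\<^sup>2)))"
      unfolding sq using minus_divide_right[of "x * sin (pi * x)" "pi * (k\<^sup>2 - x\<^sup>2)"]
      by (simp add: algebra_simps)
    also have "\<dots> = - ((exp_entry m x + exp_entry m (- x)) / 2)"
      unfolding fr exp_entry_nonint[OF nint(1)] exp_entry_nonint[OF nint(2)] k_def[symmetric]
      using \<open>x + k \<noteq> 0\<close> \<open>x - k \<noteq> 0\<close> by (simp add: divide_simps) (simp add: algebra_simps)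
    finally show ?thesis using False by simp
  qed
  ultimately show ?thesis by simp
qed

text \<open>With $\nu = n + 1/2$ the general term is a multiple of $1/((\nu^2-x^2)(\nu^2-m^2))$. Splitting this
product into a difference leaves the tangent series at $x$ and at the integer $m$, and the second
one is zero.\<close>

lemma sine_series:
  assumes x: "\<bar>x\<bar> < 1 / 2" "x \<noteq> 0"
  shows "(\<lambda>n. sine_coeff x n * ((exp_entry m (real n + 1 / 2) - exp_entry m (- (real n + 1 / 2))) / 2))
    sums (- ((exp_entry m x - exp_entry m (- x)) / 2))" (is "?f sums _")
proof (cases "m = 0")
  case True
  have "exp_entry 0 (- t) = exp_entry 0 t" for t by (simp add: exp_entry_def)
  then show ?thesis unfolding True by (simp only: diff_self) simp
next
  case False
  define k where "k = real_of_int m"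
  have nint: "x \<notin> \<int>" "- x \<notin> \<int>" "x + 1 / 2 \<notin> \<int>"
    using not_Ints_if_small[of x] not_Ints_if_small[of "- x"] x by auto
  have "k \<noteq> 0" using False by (simp add: k_def)
  have xk: "x + k \<noteq> 0" "x - k \<noteq> 0"
    using nint(1) by (auto simp: k_def add_eq_0_iff2)
  define c where "c = 2 * x * k * cos (pi * x) / (pi\<^sup>2 * (x\<^sup>2 - k\<^sup>2))"
  have "x\<^sup>2 - k\<^sup>2 = (x + k) * (x - k)" by (simp add: power2_eq_square algebra_simps)
  then have x2k2: "x\<^sup>2 - k\<^sup>2 \<noteq> 0" using xk by simp
  have "(\<lambda>n. c * (1 / (2 * x) * (2 * x / ((real n + 1 / 2)\<^sup>2 - x\<^sup>2))
      - 1 / (2 * k) * (2 * k / ((real n + 1 / 2)\<^sup>2 - k\<^sup>2)))) sums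
      (c * (1 / (2 * x) * (pi * tan (pi * x)) - 1 / (2 * k) * (pi * tan (pi * k))))"
    by (intro sums_mult sums_diff tan_partial_fractions) (use nint half_not_Ints in \<open>auto simp: k_def\<close>)
  moreover have "c * (1 / (2 * x) * (2 * x / ((real n + 1 / 2)\<^sup>2 - x\<^sup>2))
      - 1 / (2 * k) * (2 * k / ((real n + 1 / 2)\<^sup>2 - k\<^sup>2))) = ?f n" for n
  proof -
    define v where "v = real n + 1 / 2"
    have v: "v \<notin> \<int>" "- v \<notin> \<int>"
      using half_not_Ints[of "int n"] half_not_Ints[of "- int n - 1"] by (auto simp: v_def algebra_simps)
    have v_nz: "v + k \<noteq> 0" "k - v \<noteq> 0" "v - x \<noteq> 0" "v + x \<noteq> 0"
    proof -
      show "v + k \<noteq> 0" "k - v \<noteq> 0" using v(1) by (auto simp: k_def add_eq_0_iff2)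
      show "v - x \<noteq> 0" "v + x \<noteq> 0" using x(1) by (auto simp: v_def)
    qed
    have "v\<^sup>2 - k\<^sup>2 = (v + k) * - (k - v)" "v\<^sup>2 - x\<^sup>2 = (v - x) * (v + x)"
      by (simp_all add: power2_eq_square algebra_simps)
    then have v2: "v\<^sup>2 - k\<^sup>2 \<noteq> 0" "v\<^sup>2 - x\<^sup>2 \<noteq> 0" using v_nz by auto
    have sin_v: "sin (pi * v) = cos (pi * real n)" by (simp add: v_def distrib_left sin_add)
    have "exp_entry m v = cos (pi * real n) / (pi * (v + k))" "exp_entry m (- v) = - (cos (pi * real n) / (pi * (k - v)))"
      using sin_v by (simp_all add: exp_entry_nonint[OF v(1)] exp_entry_nonint[OF v(2)] k_def)
    then have "(exp_entry m v - exp_entry m (- v)) / 2 = cos (pi * real n) / (2 * pi) * (1 / (k + v) + 1 / (k - v))"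
      by (simp only: add.commute[of k v] distrib_left) (simp flip: distrib_left)
    also have "1 / (k + v) + 1 / (k - v) = 2 * k / (k\<^sup>2 - v\<^sup>2)"
      using v_nz by (subst paired_fractions) (auto simp: add.commute)
    also have "2 * k / (k\<^sup>2 - v\<^sup>2) = - (2 * k / (v\<^sup>2 - k\<^sup>2))"
      by (simp flip: divide_minus_right)
    finally have entry: "(exp_entry m v - exp_entry m (- v)) / 2 = cos (pi * real n) / (2 * pi) * - (2 * k / (v\<^sup>2 - k\<^sup>2))" .
    have cc: "cos (pi * real n) * cos (pi * real n) = 1"
      using cos_pi_int_square[of "int n"] by simp
    have regroup: "- (2 * c * x * C / (pi * A)) * (c / (2 * pi) * - (2 * k / B)) = (c * c) * (2 * x * C * k / (pi\<^sup>2 * (A * B)))"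
      for c C A B :: real by (simp add: power2_eq_square mult_ac)
    have "?f n = (cos (pi * real n) * cos (pi * real n)) * (2 * x * cos (pi * x) * k / (pi\<^sup>2 * ((v\<^sup>2 - x\<^sup>2) * (v\<^sup>2 - k\<^sup>2))))"
      unfolding v_def[symmetric] entry sine_coeff_def by (rule regroup)
    also have "\<dots> = 2 * x * cos (pi * x) * k / pi\<^sup>2 * (1 / ((v\<^sup>2 - x\<^sup>2) * (v\<^sup>2 - k\<^sup>2)))"
      unfolding cc by simp
    also have "1 / ((v\<^sup>2 - x\<^sup>2) * (v\<^sup>2 - k\<^sup>2)) = (1 / (v\<^sup>2 - x\<^sup>2) - 1 / (v\<^sup>2 - k\<^sup>2)) / (x\<^sup>2 - k\<^sup>2)"
      using v2 x2k2 by (simp add: divide_simps)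
    finally show ?thesis
      unfolding v_def[symmetric] c_def using x(2) \<open>k \<noteq> 0\<close> by simp
  qed
  moreover have "c * (1 / (2 * x) * (pi * tan (pi * x)) - 1 / (2 * k) * (pi * tan (pi * k)))
      = - ((exp_entry m x - exp_entry m (- x)) / 2)"
  proof -
    have "cos (pi * x) \<noteq> 0"
    proof
      assume "cos (pi * x) = 0"
      then have "sin (pi * (x + 1 / 2)) = 0" by (simp add: distrib_left sin_add)
      then show False using nint(3) by (auto simp: sin_zero_iff_int2 mult.commute)
    qed
    then have "cos (pi * x) * tan (pi * x) = sin (pi * x)" by (simp add: tan_def)
    moreover have "tan (pi * k) = 0" unfolding k_def by (rule tan_pi_int)
    ultimately have "c * (1 / (2 * x) * (pi * tan (pi * x)) - 1 / (2 * k) * (pi * tan (pi * k)))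
        = sin (pi * x) * k / (pi * (x\<^sup>2 - k\<^sup>2))"
      using x(2) by (simp add: c_def power2_eq_square)
    also have "\<dots> = - ((exp_entry m x - exp_entry m (- x)) / 2)"
      unfolding exp_entry_nonint[OF nint(1)] exp_entry_nonint[OF nint(2)] k_def[symmetric] \<open>x\<^sup>2 - k\<^sup>2 = (x + k) * (x - k)\<close>
      using xk by (simp add: divide_simps) (simp add: algebra_simps)
    finally show ?thesis .
  qed
  ultimately show ?thesis by (simp only:)
qed

lemma mult_cos_le_sin:
  fixes y :: real
  assumes "0 \<le> y" "y \<le> pi"
  shows "y * cos y \<le> sin y"
proof -
  have "sin 0 - 0 * cos 0 \<le> sin y - y * cos y"
  proof (rule DERIV_nonneg_imp_nondecreasing[OF assms(1)])
    fix u assume "0 \<le> u" "u \<le> y"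
    then have "0 \<le> u * sin u" using assms by (intro mult_nonneg_nonneg sin_ge_zero) auto
    moreover have "((\<lambda>u. sin u - u * cos u) has_field_derivative u * sin u) (at u)"
      by (auto intro!: derivative_eq_intros)
    ultimately show "\<exists>d. ((\<lambda>u. sin u - u * cos u) has_field_derivative d) (at u) \<and> 0 \<le> d" by blast
  qed
  then show ?thesis by simp
qed

lemma exp_entry_0_antimono:
  assumes "0 \<le> x" "x \<le> y" "y \<le> 1"
  shows "exp_entry 0 y \<le> exp_entry 0 x"
proof (rule DERIV_nonpos_imp_nonincreasing[OF assms(2)])
  fix u assume u: "x \<le> u" "u \<le> y"
  have "exp_entry_deriv 0 u \<le> 0"
  proof (cases "u = 0")
    case False
    then have "0 < u" using u assms by simp
    have "pi * u * cos (pi * u) \<le> sin (pi * u)"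
      by (rule mult_cos_le_sin) (use u assms \<open>0 < u\<close> in auto)
    then have "pi * u * cos (pi * u) / (pi * u\<^sup>2) \<le> sin (pi * u) / (pi * u\<^sup>2)"
      by (intro divide_right_mono) auto
    moreover have "pi * u * cos (pi * u) / (pi * u\<^sup>2) = cos (pi * u) / u"
      using \<open>0 < u\<close> by (simp add: power2_eq_square)
    ultimately show ?thesis using False by (simp add: exp_entry_deriv_def)
  qed (simp add: exp_entry_deriv_def)
  then show "\<exists>d. (exp_entry 0 has_field_derivative d) (at u) \<and> d \<le> 0"
    using exp_entry_has_derivative by blast
qed

lemma mult_cos_pi_mono:
  fixes x y :: real
  assumes "0 \<le> x" "x \<le> y" "y \<le> 1 / 4"
  shows "x * cos (pi * x) \<le> y * cos (pi * y)"
proof (rule DERIV_nonneg_imp_nondecreasing[OF assms(2)])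
  fix u assume u: "x \<le> u" "u \<le> y"
  have "pi * u \<le> pi / 4" "0 \<le> pi * u" using u assms by auto
  moreover from this have "- (pi / 2) \<le> pi * u" using pi_gt_zero by linarith
  ultimately have sc: "sin (pi * u) \<le> sin (pi / 4)" "cos (pi / 4) \<le> cos (pi * u)" "0 \<le> sin (pi * u)"
    by (auto intro!: sin_monotone_2pi_le cos_monotone_0_pi_le sin_ge_zero)
  have "pi * u \<le> 1" using \<open>pi * u \<le> pi / 4\<close> pi_less_4 by linarith
  then have "pi * u * sin (pi * u) \<le> 1 * sin (pi * u)" using sc(3) by (intro mult_right_mono) auto
  also have "\<dots> \<le> cos (pi * u)" using sc by (simp add: sin_45 cos_45)
  finally have "0 \<le> cos (pi * u) - u * (pi * sin (pi * u))" by (simp add: mult_ac)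
  moreover have "((\<lambda>u. u * cos (pi * u)) has_field_derivative cos (pi * u) - u * (pi * sin (pi * u))) (at u)"
    by (auto intro!: derivative_eq_intros simp: algebra_simps)
  ultimately show "\<exists>d. ((\<lambda>u. u * cos (pi * u)) has_field_derivative d) (at u) \<and> 0 \<le> d" by blast
qed

definition cosine_bound :: "real \<Rightarrow> nat \<Rightarrow> real"
  where "cosine_bound D n = (if n = 0 then 1 - exp_entry 0 D
    else 2 * D * sin (pi * D) / (pi * ((real n)\<^sup>2 - D\<^sup>2)))"

definition sine_bound :: "real \<Rightarrow> nat \<Rightarrow> real"
  where "sine_bound D n = 2 * D * cos (pi * D) / (pi * ((real n + 1 / 2)\<^sup>2 - D\<^sup>2))"

text \<open>All moduli are increasing in $|x|$, so the value at $D$ is a common bound. For the constant term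
this is the monotonicity of $\sin y/y$.\<close>

lemma abs_cosine_coeff_le:
  assumes "\<bar>x\<bar> \<le> D" "D < 1 / 4"
  shows "\<bar>cosine_coeff x n\<bar> \<le> cosine_bound D n"
proof (cases "n = 0")
  case True
  have "exp_entry 0 x = exp_entry 0 \<bar>x\<bar>" by (simp add: exp_entry_def abs_if)
  moreover have "exp_entry 0 D \<le> exp_entry 0 \<bar>x\<bar>" by (rule exp_entry_0_antimono) (use assms in auto)
  moreover have "exp_entry 0 x \<le> 1" using abs_exp_entry_le[of 0 x] by simp
  ultimately show ?thesis using True by (simp add: cosine_coeff_def cosine_bound_def)
next
  case False
  define u where "u = \<bar>x\<bar>"
  have u: "0 \<le> u" "u \<le> D" "0 \<le> D" using assms by (auto simp: u_def)
  have "D\<^sup>2 < 1" using u(3) assms(2) by (simp add: abs_square_less_1)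
  moreover have "1 \<le> (real n)\<^sup>2" using False by simp
  ultimately have pos: "0 < (real n)\<^sup>2 - D\<^sup>2" by linarith
  have "u\<^sup>2 \<le> D\<^sup>2" using u by (intro power_mono) auto
  have piD: "0 \<le> pi * u" "pi * u \<le> pi * D" "pi * D \<le> pi / 2" using u assms by auto
  then have "- (pi / 2) \<le> pi * u" "pi * u \<le> pi" using pi_gt_zero by linarith+
  then have s: "0 \<le> sin (pi * u)" "sin (pi * u) \<le> sin (pi * D)"
    using piD by (blast intro: sin_monotone_2pi_le sin_ge_zero)+
  have sin_abs: "\<bar>x * sin (pi * x)\<bar> = u * sin (pi * u)"
  proof -
    have "sin (pi * u) = sin (pi * x) \<or> sin (pi * u) = - sin (pi * x)" by (simp add: u_def abs_if)
    then have "\<bar>sin (pi * x)\<bar> = sin (pi * u)" using s(1) by auto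
    then show ?thesis unfolding abs_mult u_def[symmetric] by simp
  qed
  have "\<bar>cosine_coeff x n\<bar> = 2 * (u * sin (pi * u)) / (pi * ((real n)\<^sup>2 - u\<^sup>2))"
  proof -
    have "\<bar>cosine_coeff x n\<bar> = 2 * \<bar>cos (pi * real n)\<bar> * \<bar>x * sin (pi * x)\<bar> / (pi * \<bar>(real n)\<^sup>2 - x\<^sup>2\<bar>)"
      using False by (simp add: cosine_coeff_def abs_mult)
    moreover have "\<bar>(real n)\<^sup>2 - x\<^sup>2\<bar> = (real n)\<^sup>2 - u\<^sup>2"
      using pos \<open>u\<^sup>2 \<le> D\<^sup>2\<close> by (simp add: u_def)
    ultimately show ?thesis unfolding sin_abs by simp
  qed
  also have "\<dots> \<le> 2 * (D * sin (pi * D)) / (pi * ((real n)\<^sup>2 - D\<^sup>2))"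
    using pos \<open>u\<^sup>2 \<le> D\<^sup>2\<close> u s by (intro frac_le mult_left_mono mult_mono) auto
  finally show ?thesis using False by (simp add: cosine_bound_def mult.assoc)
qed

text \<open>The numerator $x\cos(\pi x)$ increases on $[0,1/4]$ and the denominator decreases.\<close>

lemma abs_sine_coeff_le:
  assumes "\<bar>x\<bar> \<le> D" "D < 1 / 4"
  shows "\<bar>sine_coeff x n\<bar> \<le> sine_bound D n"
proof -
  define u where "u = \<bar>x\<bar>"
  have u: "0 \<le> u" "u \<le> D" "0 \<le> D" using assms by (auto simp: u_def)
  have "D\<^sup>2 < (1 / 2)\<^sup>2" using u(3) assms(2) by (intro power_strict_mono) auto
  moreover have "(1 / 2)\<^sup>2 \<le> (real n + 1 / 2)\<^sup>2" by (intro power_mono) auto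
  ultimately have pos: "0 < (real n + 1 / 2)\<^sup>2 - D\<^sup>2" by linarith
  have "u\<^sup>2 \<le> D\<^sup>2" using u by (intro power_mono) auto
  have "0 \<le> pi * u" "pi * u \<le> pi / 2" using u assms by auto
  moreover from this have "- (pi / 2) \<le> pi * u" using pi_gt_zero by linarith
  ultimately have c: "0 \<le> cos (pi * u)" by (intro cos_ge_zero)
  have mono: "u * cos (pi * u) \<le> D * cos (pi * D)"
    by (rule mult_cos_pi_mono) (use u assms in auto)
  have cos_abs: "\<bar>x * cos (pi * x)\<bar> = u * cos (pi * u)"
  proof -
    have "cos (pi * u) = cos (pi * x)" by (simp add: u_def abs_if)
    then show ?thesis using c unfolding abs_mult u_def[symmetric] by simp
  qed
  have "\<bar>sine_coeff x n\<bar> = 2 * (u * cos (pi * u)) / (pi * ((real n + 1 / 2)\<^sup>2 - u\<^sup>2))"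
  proof -
    have "\<bar>sine_coeff x n\<bar>
        = 2 * \<bar>cos (pi * real n)\<bar> * \<bar>x * cos (pi * x)\<bar> / (pi * \<bar>(real n + 1 / 2)\<^sup>2 - x\<^sup>2\<bar>)"
      by (simp add: sine_coeff_def abs_mult)
    moreover have "\<bar>(real n + 1 / 2)\<^sup>2 - x\<^sup>2\<bar> = (real n + 1 / 2)\<^sup>2 - u\<^sup>2"
      using pos \<open>u\<^sup>2 \<le> D\<^sup>2\<close> by (simp add: u_def)
    ultimately show ?thesis unfolding cos_abs by simp
  qed
  also have "\<dots> \<le> 2 * (D * cos (pi * D)) / (pi * ((real n + 1 / 2)\<^sup>2 - D\<^sup>2))"
    using pos \<open>u\<^sup>2 \<le> D\<^sup>2\<close> u mono mult_nonneg_nonneg[OF u(1) c] by (intro frac_le mult_left_mono) auto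
  finally show ?thesis by (simp add: sine_bound_def mult.assoc)
qed

text \<open>All coefficients have the same sign up to the factor $(-1)^n$, so the sum of their moduli is the
value of the expansion at the end point $u = \pi$; it is computed from the cotangent series.\<close>

lemma cosine_bound_sums:
  assumes "0 < D" "D < 1 / 4"
  shows "cosine_bound D sums (1 - cos (pi * D))"
proof -
  have D: "D \<notin> \<int>" using not_Ints_if_small[of D] assms by simp
  have s: "sin (pi * D) \<noteq> 0" using D by (auto simp: sin_zero_iff_int2 mult.commute)
  have "(\<lambda>n. - (sin (pi * D) / pi) * (2 * D / (D\<^sup>2 - (real (Suc n))\<^sup>2))) sums
      (- (sin (pi * D) / pi) * (pi * cot (pi * D) - 1 / D))"
    by (intro sums_mult cot_partial_fractions D)
  moreover have "- (sin (pi * D) / pi) * (2 * D / (D\<^sup>2 - (real (Suc n))\<^sup>2)) = cosine_bound D (Suc n)" for n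
  proof -
    have "(real (Suc n))\<^sup>2 - D\<^sup>2 = - (D\<^sup>2 - (real (Suc n))\<^sup>2)" by simp
    then have "cosine_bound D (Suc n) = 2 * D * sin (pi * D) / (pi * - (D\<^sup>2 - (real (Suc n))\<^sup>2))"
      by (simp only: cosine_bound_def nat.distinct if_False)
    also have "\<dots> = - (sin (pi * D) / pi) * (2 * D / (D\<^sup>2 - (real (Suc n))\<^sup>2))"
      unfolding mult_minus_right divide_minus_right by (simp add: mult_ac)
    finally show ?thesis ..
  qed
  moreover have "- (sin (pi * D) / pi) * (pi * cot (pi * D) - 1 / D) = exp_entry 0 D - cos (pi * D)"
    using s assms(1) by (simp add: cot_def exp_entry_nonint[OF D] field_simps)
  ultimately have "(\<lambda>n. cosine_bound D (Suc n)) sums (exp_entry 0 D - cos (pi * D))" by (simp only:)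
  then have "cosine_bound D sums (exp_entry 0 D - cos (pi * D) + cosine_bound D 0)" by (rule sums_Suc)
  then show ?thesis by (simp add: cosine_bound_def)
qed

lemma sine_bound_sums:
  assumes "0 < D" "D < 1 / 4"
  shows "sine_bound D sums sin (pi * D)"
proof -
  have "(\<lambda>n. cos (pi * D) / pi * (2 * D / ((real n + 1 / 2)\<^sup>2 - D\<^sup>2))) sums
      (cos (pi * D) / pi * (pi * tan (pi * D)))"
    by (intro sums_mult tan_partial_fractions) (use not_Ints_if_small[of D] assms in auto)
  moreover have "cos (pi * D) \<noteq> 0"
  proof -
    have "0 < cos (pi * D)" using assms by (intro cos_gt_zero) auto
    then show ?thesis by simp
  qed
  then have "cos (pi * D) / pi * (pi * tan (pi * D)) = sin (pi * D)" by (simp add: tan_def)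
  moreover have "cos (pi * D) / pi * (2 * D / ((real n + 1 / 2)\<^sup>2 - D\<^sup>2)) = sine_bound D n" for n
    by (simp add: sine_bound_def)
  ultimately show ?thesis by (simp only:)
qed

text \<open>The inequality $\sin \pi D < \cos \pi D$ is where the bound $1/4$ enters.\<close>

lemma kadec_constant_less_1:
  assumes "0 < D" "D < 1 / 4"
  shows "1 - cos (pi * D) + sin (pi * D) < 1"
proof -
  have "0 < pi * D" "pi * D < pi / 4" using assms by auto
  moreover from this have "- (pi / 2) \<le> pi * D" using pi_gt_zero by linarith
  ultimately have "sin (pi * D) < sin (pi / 4)" "cos (pi / 4) < cos (pi * D)"
    by (auto intro!: sin_monotone_2pi cos_monotone_0_pi)
  then show ?thesis by (simp add: sin_45 cos_45)
qed

text \<open>Minkowski's inequality for a series of contractions whose coefficients may depend on the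
coordinate. Only a bound \<open>g n\<close> that is uniform in the coordinate matters, which is what makes the
argument work for a different displacement at each node.\<close>

lemma L2_set_series_le:
  fixes W :: "nat \<Rightarrow> ell2 \<Rightarrow>\<^sub>L ell2"
  assumes "finite F" "\<And>n. norm (W n a) \<le> norm a" "\<And>k n. \<bar>c k n\<bar> \<le> g n" "g sums s"
    "\<And>k. (\<lambda>n. of_real (c k n) * coord (W n a) k) sums X k"
  shows "L2_set (\<lambda>k. cmod (X k)) F \<le> s * norm a"
proof -
  have g: "0 \<le> g n" for n using assms(3)[of undefined n] abs_ge_zero order_trans by blast
  have coord: "L2_set (\<lambda>k. cmod (coord b k)) F \<le> norm b" for b
    unfolding L2_set_def using sum_coord_le_norm[OF assms(1), of b] by (intro real_le_lsqrt sum_nonneg) auto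
  have part: "L2_set (\<lambda>k. cmod (\<Sum>n<N. of_real (c k n) * coord (W n a) k)) F \<le> (\<Sum>n<N. g n) * norm a" for N
  proof (induction N)
    case (Suc N)
    have "L2_set (\<lambda>k. cmod (\<Sum>n<Suc N. of_real (c k n) * coord (W n a) k)) F
        \<le> L2_set (\<lambda>k. cmod (\<Sum>n<N. of_real (c k n) * coord (W n a) k) + g N * cmod (coord (W N a) k)) F"
    proof (rule L2_set_mono)
      fix k
      have "cmod (\<Sum>n<Suc N. of_real (c k n) * coord (W n a) k)
          \<le> cmod (\<Sum>n<N. of_real (c k n) * coord (W n a) k) + cmod (of_real (c k N) * coord (W N a) k)"
        by (simp add: norm_triangle_ineq)
      also have "cmod (of_real (c k N) * coord (W N a) k) \<le> g N * cmod (coord (W N a) k)"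
        unfolding norm_mult norm_of_real by (intro mult_right_mono assms(3)) simp
      finally show "cmod (\<Sum>n<Suc N. of_real (c k n) * coord (W n a) k)
          \<le> cmod (\<Sum>n<N. of_real (c k n) * coord (W n a) k) + g N * cmod (coord (W N a) k)" by simp
    qed simp
    also have "\<dots> \<le> L2_set (\<lambda>k. cmod (\<Sum>n<N. of_real (c k n) * coord (W n a) k)) F
        + L2_set (\<lambda>k. g N * cmod (coord (W N a) k)) F"
      by (rule L2_set_triangle_ineq)
    also have "L2_set (\<lambda>k. g N * cmod (coord (W N a) k)) F = g N * L2_set (\<lambda>k. cmod (coord (W N a) k)) F"
      by (rule L2_set_right_distrib[symmetric]) (rule g)
    also have "g N * L2_set (\<lambda>k. cmod (coord (W N a) k)) F \<le> g N * norm a"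
      by (intro mult_left_mono order_trans[OF coord assms(2)] g)
    finally show ?case using Suc by (simp add: distrib_right)
  qed (simp add: L2_set_def)
  have "(\<Sum>n<N. g n) \<le> s" for N
    using assms(4) g by (metis sum_le_suminf sums_iff finite_lessThan)
  then have le: "L2_set (\<lambda>k. cmod (\<Sum>n<N. of_real (c k n) * coord (W n a) k)) F \<le> s * norm a" for N
    by (intro order_trans[OF part] mult_right_mono) auto
  have "(\<lambda>N. L2_set (\<lambda>k. cmod (\<Sum>n<N. of_real (c k n) * coord (W n a) k)) F)
      \<longlonglongrightarrow> L2_set (\<lambda>k. cmod (X k)) F"
    unfolding L2_set_def by (intro tendsto_intros assms(5)[unfolded sums_def])
  then show ?thesis
    by (rule LIMSEQ_le_const2) (use le in blast)
qed

lemma coefficient_series_summable: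
  fixes W :: "nat \<Rightarrow> ell2 \<Rightarrow>\<^sub>L ell2"
  assumes "\<And>n a. norm (W n a) \<le> norm a" "\<And>n. \<bar>c n\<bar> \<le> g n" "summable g"
  shows "summable (\<lambda>n. c n *\<^sub>R W n)"
proof (rule summable_comparison_test'[OF assms(3)])
  fix n
  have "norm (W n) \<le> 1" using assms(1)[of n] by (intro norm_blinfun_bound) auto
  then have "\<bar>c n\<bar> * norm (W n) \<le> g n * 1"
    using assms(2)[of n] order_trans[OF abs_ge_zero assms(2)[of n]] by (intro mult_mono) auto
  then show "norm (c n *\<^sub>R W n) \<le> g n" by simp
qed

text \<open>Kadec's expansion with operators in place of functions. Both series converge in operator norm,
so the identity has to be checked only on single entries.\<close>

lemma exp_hilbert_trigonometric_expansion:
  assumes x: "\<bar>x\<bar> \<le> D" and D: "0 < D" "D < 1 / 4"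
  shows "summable (\<lambda>n. of_real (cosine_coeff x n) * coord (cosine_op n a) k)"
    and "summable (\<lambda>n. of_real (sine_coeff x n) * coord (sine_op n a) k)"
    and "coord (a - exp_hilbert x a) k
      = (\<Sum>n. of_real (cosine_coeff x n) * coord (cosine_op n a) k)
      + (\<Sum>n. of_real (sine_coeff x n) * coord (sine_op n a) k)"
proof -
  define E1 where "E1 = (\<Sum>n. cosine_coeff x n *\<^sub>R cosine_op n)"
  define E2 where "E2 = (\<Sum>n. sine_coeff x n *\<^sub>R sine_op n)"
  have E1: "(\<lambda>n. cosine_coeff x n *\<^sub>R cosine_op n) sums E1"
    unfolding E1_def
    by (rule summable_sums, rule coefficient_series_summable[OF norm_cosine_op abs_cosine_coeff_le[OF x D(2)]
        sums_summable[OF cosine_bound_sums[OF D]]])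
  have E2: "(\<lambda>n. sine_coeff x n *\<^sub>R sine_op n) sums E2"
    unfolding E2_def
    by (rule summable_sums, rule coefficient_series_summable[OF norm_sine_op abs_sine_coeff_le[OF x D(2)]
        sums_summable[OF sine_bound_sums[OF D]]])
  have "bounded_linear (\<lambda>L :: ell2 \<Rightarrow>\<^sub>L ell2. coord (L b) k)" for b k
    by (rule bounded_linear_compose[OF bounded_linear_coord blinfun.bounded_linear_left])
  note evaluate = this[THEN bounded_linear.sums]
  have sums:
    "(\<lambda>n. of_real (cosine_coeff x n) * coord (cosine_op n b) k) sums coord (E1 b) k"
    "(\<lambda>n. of_real (sine_coeff x n) * coord (sine_op n b) k) sums coord (E2 b) k" for b k
    using evaluate[OF E1] evaluate[OF E2] by (simp_all add: blinfun.scaleR_left scaleR_conv_of_real)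
  have "a - exp_hilbert x a = E1 a + E2 a"
  proof (rule bounded_linear_eq_on_singles[where f = "\<lambda>a. a - exp_hilbert x a" and g = "\<lambda>a. E1 a + E2 a"])
    show "bounded_linear (\<lambda>a. a - exp_hilbert x a)" "bounded_linear (\<lambda>a. E1 a + E2 a)"
      by (intro bounded_linear_sub bounded_linear_add bounded_linear_ident blinfun.bounded_linear_right)+
    fix p z
    show "single p z - exp_hilbert x (single p z) = E1 (single p z) + E2 (single p z)"
    proof (rule ell2_eqI)
      fix k
      define m where "m = k - p"
      have "coord (E1 (single p z)) k + coord (E2 (single p z)) k
          = z * of_real ((if m = 0 then 1 else 0) - exp_entry m x)"
      proof (cases "x = 0")
        case True
        have "exp_entry m 0 = (if m = 0 then 1 else 0)" using exp_entry_int[of m 0] by auto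
        moreover have "cosine_coeff x n = 0" "sine_coeff x n = 0" for n
          using exp_entry_int[of 0 0] True by (auto simp: cosine_coeff_def sine_coeff_def)
        note sums[unfolded this]
        then have "(\<lambda>n. 0) sums coord (E1 (single p z)) k" "(\<lambda>n. 0) sums coord (E2 (single p z)) k"
          by simp_all
        then have "coord (E1 (single p z)) k = 0" "coord (E2 (single p z)) k = 0"
          by (blast intro: sums_unique2 sums_zero)+
        ultimately show ?thesis using True by simp
      next
        case False
        have "\<bar>x\<bar> < 1 / 2" using x D by simp
        note series = cosine_series[OF this False, of m] sine_series[OF this False, of m]
        have km: "k = p \<longleftrightarrow> m = 0" by (simp add: m_def)
        have regroup: "of_real c * (z * of_real e) = z * of_real (c * e)" for c e :: real
          by simp
        have "coord (E1 (single p z)) k = z * of_real ((if m = 0 then 1 else 0) - (exp_entry m x + exp_entry m (- x)) / 2)"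
          using sums(1)[of "single p z" k] sums_mult[OF sums_of_real[OF series(1)], of z]
          unfolding coord_cosine_op_single km m_def[symmetric] regroup by (rule sums_unique2)
        moreover have "coord (E2 (single p z)) k = z * of_real (- ((exp_entry m x - exp_entry m (- x)) / 2))"
          using sums(2)[of "single p z" k] sums_mult[OF sums_of_real[OF series(2)], of z]
          unfolding coord_sine_op_single m_def[symmetric] regroup by (rule sums_unique2)
        ultimately have "coord (E1 (single p z)) k + coord (E2 (single p z)) k
            = z * of_real ((if m = 0 then 1 else 0) - (exp_entry m x + exp_entry m (- x)) / 2
              + - ((exp_entry m x - exp_entry m (- x)) / 2))"
          by (simp only: of_real_add distrib_left)
        also have "(if m = 0 then 1 else 0) - (exp_entry m x + exp_entry m (- x)) / 2 + - ((exp_entry m x - exp_entry m (- x)) / 2)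
            = (if m = 0 then 1 else 0) - exp_entry m x"
          by (simp add: field_simps)
        finally show ?thesis .
      qed
      moreover have "coord (single p z - exp_hilbert x (single p z)) k
          = z * of_real ((if m = 0 then 1 else 0) - exp_entry m x)"
        by (simp add: exp_hilbert_single_coord single.rep_eq m_def algebra_simps)
      ultimately show "coord (single p z - exp_hilbert x (single p z)) k
          = coord (E1 (single p z) + E2 (single p z)) k" by simp
    qed
  qed
  then have "coord (a - exp_hilbert x a) k = coord (E1 a) k + coord (E2 a) k" by simp
  then show "coord (a - exp_hilbert x a) k
      = (\<Sum>n. of_real (cosine_coeff x n) * coord (cosine_op n a) k)
      + (\<Sum>n. of_real (sine_coeff x n) * coord (sine_op n a) k)"
    unfolding sums[THEN sums_unique] .
  show "summable (\<lambda>n. of_real (cosine_coeff x n) * coord (cosine_op n a) k)"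
    "summable (\<lambda>n. of_real (sine_coeff x n) * coord (sine_op n a) k)"
    using sums[THEN sums_summable] by auto
qed

text \<open>The positive bound \<open>D\<close> is part of the definition because it has to be shared by a sequence and
its truncations.\<close>

definition near_integers :: "(int \<Rightarrow> real) \<Rightarrow> real \<Rightarrow> bool"
  where "near_integers t D \<longleftrightarrow> 0 < D \<and> D < 1 / 4 \<and> (\<forall>k. \<bar>t k - of_int k\<bar> \<le> D)"

definition kadec_constant :: "real \<Rightarrow> real"
  where "kadec_constant D = 1 - cos (pi * D) + sin (pi * D)"

lemma near_integersD:
  assumes "near_integers t D"
  shows "0 < D" "D < 1 / 4" "\<bar>t k - of_int k\<bar> \<le> D" "\<bar>t k - of_int k\<bar> < 1 / 4"
proof -
  show *: "0 < D" "D < 1 / 4" "\<bar>t k - of_int k\<bar> \<le> D"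
    using assms by (auto simp: near_integers_def)
  then show "\<bar>t k - of_int k\<bar> < 1 / 4" by linarith
qed

lemma near_integers_eq_int:
  assumes "near_integers t D" "t j = of_int k"
  shows "j = k"
proof -
  have "\<bar>real_of_int (k - j)\<bar> < 1 / 4" using near_integersD(4)[OF assms(1), of j] assms(2) by simp
  then have "\<bar>real_of_int (k - j)\<bar> < 1" by linarith
  then show ?thesis by linarith
qed

lemma near_integers_inj:
  assumes "near_integers t D" "t j = t k"
  shows "j = k"
proof -
  have "\<bar>real_of_int (k - j)\<bar> < 1"
    using near_integersD(4)[OF assms(1), of j] near_integersD(4)[OF assms(1), of k] assms(2)
    unfolding of_int_diff by linarith
  then show ?thesis by linarith
qed

lemma near_integers_ne_half:
  assumes "near_integers t D"
  shows "t j \<noteq> 1 / 2"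
proof
  assume "t j = 1 / 2"
  then have "\<bar>1 / 2 - real_of_int j\<bar> < 1 / 4" using near_integersD(4)[OF assms, of j] by (simp only:)
  then have "0 < real_of_int j" "real_of_int j < 1" by linarith+
  then show False by simp
qed

lemma kadec_constant_bounds:
  assumes "near_integers t D"
  shows "0 \<le> kadec_constant D" "kadec_constant D < 1"
proof -
  note D = near_integersD(1,2)[OF assms]
  have "0 \<le> sin (pi * D)" "cos (pi * D) \<le> 1" using D by (auto intro!: sin_ge_zero)
  then show "0 \<le> kadec_constant D" by (simp add: kadec_constant_def)
  show "kadec_constant D < 1" unfolding kadec_constant_def by (rule kadec_constant_less_1[OF D])
qed

text \<open>By \<open>coord_exp_hilbert_shift\<close> the coordinate $k$ equals $(-1)^k F_a(t_k)$. This form shows that the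
operator is close to the identity.\<close>

definition sample_at :: "(int \<Rightarrow> real) \<Rightarrow> ell2 \<Rightarrow> ell2"
  where "sample_at t a = Abs_ell2 (\<lambda>k. coord (exp_hilbert (t k - of_int k) a) k)"

text \<open>Kadec's estimate: each coordinate of $a - Sa$ is expanded with its own displacement
$t_k - k$, and the two series contribute $1 - \cos \pi D$ and $\sin \pi D$.\<close>

lemma kadec_sampling:
  assumes nodes: "near_integers t D"
  shows coord_sample_at:
      "coord (sample_at t a) k = of_real (cos (pi * of_int k)) * coord (exp_hilbert (t k) a) 0"
    and norm_diff_sample_at: "norm (a - sample_at t a) \<le> kadec_constant D * norm a"
proof -
  note t = near_integersD(3)[OF nodes] and D = near_integersD(1,2)[OF nodes]
  define X where "X = (\<lambda>k. \<Sum>n. of_real (cosine_coeff (t k - of_int k) n) * coord (cosine_op n a) k)"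
  define Y where "Y = (\<lambda>k. \<Sum>n. of_real (sine_coeff (t k - of_int k) n) * coord (sine_op n a) k)"
  have X: "(\<lambda>n. of_real (cosine_coeff (t k - of_int k) n) * coord (cosine_op n a) k) sums X k" for k
    unfolding X_def by (rule summable_sums) (rule exp_hilbert_trigonometric_expansion(1)[OF t D])
  have Y: "(\<lambda>n. of_real (sine_coeff (t k - of_int k) n) * coord (sine_op n a) k) sums Y k" for k
    unfolding Y_def by (rule summable_sums) (rule exp_hilbert_trigonometric_expansion(2)[OF t D])
  have XY: "coord (a - exp_hilbert (t k - of_int k) a) k = X k + Y k" for k
    unfolding X_def Y_def by (rule exp_hilbert_trigonometric_expansion(3)[OF t D])
  define q where "q = kadec_constant D"
  have "0 \<le> q" unfolding q_def by (rule kadec_constant_bounds[OF nodes])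
  have bound: "(\<Sum>k\<in>F. (cmod (coord (a - exp_hilbert (t k - of_int k) a) k))\<^sup>2) \<le> (q * norm a)\<^sup>2"
    if "finite F" for F
  proof -
    have "L2_set (\<lambda>k. cmod (coord (a - exp_hilbert (t k - of_int k) a) k)) F
        \<le> L2_set (\<lambda>k. cmod (X k) + cmod (Y k)) F"
      unfolding XY by (intro L2_set_mono norm_triangle_ineq) simp
    also have "\<dots> \<le> L2_set (\<lambda>k. cmod (X k)) F + L2_set (\<lambda>k. cmod (Y k)) F"
      by (rule L2_set_triangle_ineq)
    also have "\<dots> \<le> (1 - cos (pi * D)) * norm a + sin (pi * D) * norm a"
      by (intro add_mono L2_set_series_le[OF that norm_cosine_op abs_cosine_coeff_le[OF t D(2)] cosine_bound_sums[OF D] X]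
          L2_set_series_le[OF that norm_sine_op abs_sine_coeff_le[OF t D(2)] sine_bound_sums[OF D] Y])
    also have "\<dots> = q * norm a" by (simp add: q_def kadec_constant_def algebra_simps)
    finally have "L2_set (\<lambda>k. cmod (coord (a - exp_hilbert (t k - of_int k) a) k)) F \<le> q * norm a" .
    then have "(L2_set (\<lambda>k. cmod (coord (a - exp_hilbert (t k - of_int k) a) k)) F)\<^sup>2 \<le> (q * norm a)\<^sup>2"
      by (intro power_mono) auto
    then show ?thesis by (simp add: L2_set_def sum_nonneg)
  qed
  have nonneg: "0 \<le> q * norm a" using \<open>0 \<le> q\<close> by simp
  obtain r where r: "\<And>k. coord r k = coord (a - exp_hilbert (t k - of_int k) a) k" "norm r \<le> q * norm a"
    using ell2_of_bounded_sums[OF bound nonneg] by blast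
  have "(\<lambda>k. coord (exp_hilbert (t k - of_int k) a) k) = coord (a - r)" by (simp add: r fun_eq_iff)
  then have "sample_at t a = a - r" unfolding sample_at_def by (simp only: coord_inverse)
  with r show "norm (a - sample_at t a) \<le> kadec_constant D * norm a" by (simp add: q_def)
  have "coord (exp_hilbert (t k - of_int k + of_int k) a) 0
      = of_real (cos (pi * of_int k)) * coord (sample_at t a) k"
    unfolding coord_exp_hilbert_shift \<open>sample_at t a = a - r\<close> by (simp add: r)
  then show "coord (sample_at t a) k = of_real (cos (pi * of_int k)) * coord (exp_hilbert (t k) a) 0"
    using cos_pi_int_square[of k] by (simp flip: mult.assoc of_real_mult)
qed


section \<open>Invertibility of sampling\<close>

lemma sample_at_diff:
  assumes "near_integers t D"
  shows "sample_at t (a - b) = sample_at t a - sample_at t b"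
  by (rule ell2_eqI)
     (simp only: coord_simps coord_sample_at[OF assms] blinfun.diff_right right_diff_distrib)

lemma sample_at_sum:
  assumes "near_integers t D"
  shows "sample_at t (\<Sum>i\<in>I. f i) = (\<Sum>i\<in>I. sample_at t (f i))"
  by (rule ell2_eqI)
     (simp only: coord_sum coord_sample_at[OF assms] blinfun.sum_right sum_distrib_left)

lemma norm_le_sample_at:
  assumes "near_integers t D"
  shows "norm a \<le> norm (sample_at t a) / (1 - kadec_constant D)"
proof -
  have "norm a \<le> norm (a - sample_at t a) + norm (sample_at t a)"
    using norm_triangle_ineq[of "a - sample_at t a" "sample_at t a"] by simp
  then have "norm a * (1 - kadec_constant D) \<le> norm (sample_at t a)"
    using norm_diff_sample_at[OF assms, of a] by (simp add: algebra_simps)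
  then show ?thesis using kadec_constant_bounds(2)[OF assms] by (simp add: le_divide_eq)
qed

text \<open>A solution of $Sb = d$ is a fixed point of the contraction $x \mapsto d + x - Sx$.\<close>

lemma sample_at_surjective:
  assumes "near_integers t D"
  obtains b where "sample_at t b = d"
proof -
  have "\<exists>!x. d + x - sample_at t x = x"
  proof (rule banach_fix_type[OF kadec_constant_bounds[OF assms]], intro allI)
    fix x y
    have eq: "(d + x - sample_at t x) - (d + y - sample_at t y) = (x - y) - sample_at t (x - y)"
      by (simp add: sample_at_diff[OF assms])
    show "dist (d + x - sample_at t x) (d + y - sample_at t y) \<le> kadec_constant D * dist x y"
      unfolding dist_norm eq by (rule norm_diff_sample_at[OF assms])
  qed
  then obtain b where "d + b - sample_at t b = b" by blast
  then have "sample_at t b = d" by (simp add: algebra_simps)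
  then show ?thesis by (rule that)
qed

text \<open>The interpolation series has complex coefficients, whereas the vector space structure of
\<open>ell2\<close> is real.\<close>

lift_definition scaleC :: "complex \<Rightarrow> ell2 \<Rightarrow> ell2" is "\<lambda>z a n. z * a n"
  by (simp add: norm_mult power_mult_distrib summable_on_cmult_right)

lemma coord_exp_hilbert_scaleC: "coord (exp_hilbert x (scaleC z a)) m = z * coord (exp_hilbert x a) m"
proof -
  have "((\<lambda>n. z * (coord a n * of_real (exp_entry (m - n) x))) has_sum z * coord (exp_hilbert x a) m) UNIV"
    by (rule has_sum_cmult_right[OF coord_exp_hilbert_has_sum])
  then have "((\<lambda>n. coord (scaleC z a) n * of_real (exp_entry (m - n) x)) has_sum z * coord (exp_hilbert x a) m) UNIV"
    by (simp add: scaleC.rep_eq mult.assoc)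
  with coord_exp_hilbert_has_sum show ?thesis by (rule has_sum_unique)
qed

lemma sample_at_scaleC:
  assumes "near_integers t D"
  shows "sample_at t (scaleC z a) = scaleC z (sample_at t a)"
  by (rule ell2_eqI)
     (simp only: coord_sample_at[OF assms] coord_exp_hilbert_scaleC scaleC.rep_eq mult.left_commute)


section \<open>The generating function\<close>

definition partial_G :: "(int \<Rightarrow> real) \<Rightarrow> nat \<Rightarrow> complex \<Rightarrow> complex"
  where "partial_G t N z = (z - of_real (t 0)) *
    (\<Prod>k<N. (1 - z / of_real (t (int (Suc k)))) * (1 - z / of_real (t (- int (Suc k)))))"

text \<open>Up to a constant the partial product is the monic polynomial whose zeros are the nodes of index at
most $N$ in modulus. The same holds for the partial products of the sine, which are the case $t_j = j$.\<close>

lemma partial_G_factor: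
  assumes "\<And>k. k \<noteq> 0 \<Longrightarrow> t k \<noteq> 0"
  obtains c where "c \<noteq> 0" "\<And>z. partial_G t N z = c * (\<Prod>k\<in>{- int N..int N}. z - of_real (t k))"
proof -
  have "\<exists>c. c \<noteq> 0 \<and> (\<forall>z. partial_G t N z = c * (\<Prod>k\<in>{- int N..int N}. z - of_real (t k)))"
  proof (induction N)
    case 0
    show ?case by (rule exI[of _ 1]) (simp add: partial_G_def)
  next
    case (Suc N)
    then obtain c where c: "c \<noteq> 0" "\<And>z. partial_G t N z = c * (\<Prod>k\<in>{- int N..int N}. z - of_real (t k))"
      by blast
    define a b where "a = complex_of_real (t (int (Suc N)))" and "b = complex_of_real (t (- int (Suc N)))"
    have "a \<noteq> 0" "b \<noteq> 0" using assms[of "int (Suc N)"] assms[of "- int (Suc N)"] by (auto simp: a_def b_def)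
    have set: "{- int (Suc N)..int (Suc N)} = insert (int (Suc N)) (insert (- int (Suc N)) {- int N..int N})"
      by auto
    show ?case
    proof (intro exI[of _ "c / (a * b)"] conjI allI)
      show "c / (a * b) \<noteq> 0" using c(1) \<open>a \<noteq> 0\<close> \<open>b \<noteq> 0\<close> by simp
      fix z
      have "partial_G t (Suc N) z = partial_G t N z * ((1 - z / a) * (1 - z / b))"
        by (simp add: partial_G_def a_def b_def)
      also have "(1 - z / a) * (1 - z / b) = (z - a) * (z - b) / (a * b)"
        using \<open>a \<noteq> 0\<close> \<open>b \<noteq> 0\<close> by (simp add: divide_simps) (simp add: algebra_simps)
      also have "partial_G t N z * ((z - a) * (z - b) / (a * b))
          = c / (a * b) * ((z - a) * ((z - b) * (\<Prod>k\<in>{- int N..int N}. z - of_real (t k))))"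
        unfolding c(2) by simp
      also have "(z - a) * ((z - b) * (\<Prod>k\<in>{- int N..int N}. z - of_real (t k)))
          = (\<Prod>k\<in>{- int (Suc N)..int (Suc N)}. z - of_real (t k))"
        unfolding set by (subst prod.insert, simp, simp, subst prod.insert, simp_all add: a_def b_def)
      finally show "partial_G t (Suc N) z = c / (a * b) * (\<Prod>k\<in>{- int (Suc N)..int (Suc N)}. z - of_real (t k))" .
    qed
  qed
  then show ?thesis using that by blast
qed

text \<open>The linear term of the product of two factors is $z(t_k + t_{-k})/(t_k t_{-k})$; it is of order
$1/k^2$ since $t_k + t_{-k}$ stays bounded.\<close>

lemma G_factor_close_to_1:
  assumes "near_integers t D" "cmod z \<le> R"
  shows "cmod ((1 - z / of_real (t (int (Suc k)))) * (1 - z / of_real (t (- int (Suc k)))) - 1)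
    \<le> (R + 2 * R\<^sup>2) * (1 / (real (Suc k))\<^sup>2)"
proof -
  define a b n where "a = t (int (Suc k))" and "b = t (- int (Suc k))" and "n = real (Suc k)"
  have "\<bar>a - n\<bar> < 1 / 4" "\<bar>b - - n\<bar> < 1 / 4"
    using near_integersD(4)[OF assms(1), of "int (Suc k)"] near_integersD(4)[OF assms(1), of "- int (Suc k)"]
    by (simp_all only: a_def b_def n_def of_int_minus of_int_of_nat_eq)
  moreover have "1 \<le> n" by (simp add: n_def)
  ultimately have ab: "3 / 4 * n \<le> a" "3 / 4 * n \<le> - b" "\<bar>a + b\<bar> \<le> 1 / 2" by linarith+
  have "3 / 4 * n * (3 / 4 * n) \<le> a * - b"
    using ab \<open>1 \<le> n\<close> by (intro mult_mono) auto
  moreover have "0 \<le> n * n" by simp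
  ultimately have "n\<^sup>2 / 2 \<le> - (a * b)"
    unfolding power2_eq_square mult_minus_right by linarith
  moreover have "0 < n\<^sup>2" using \<open>1 \<le> n\<close> by simp
  ultimately have prod: "n\<^sup>2 / 2 \<le> \<bar>a * b\<bar>" "a * b \<noteq> 0" by auto
  have "0 \<le> R" using assms(2) norm_ge_zero order_trans by blast
  have "(1 - z / of_real a) * (1 - z / of_real b) - 1 = (z\<^sup>2 - z * of_real (a + b)) / of_real (a * b)"
    using prod(2) by (simp add: divide_simps) (simp add: algebra_simps power2_eq_square)
  then have "cmod ((1 - z / of_real a) * (1 - z / of_real b) - 1) = cmod (z\<^sup>2 - z * of_real (a + b)) / \<bar>a * b\<bar>"
    by (simp only: norm_divide norm_of_real)
  also have "\<dots> \<le> (R\<^sup>2 + R * (1 / 2)) / (n\<^sup>2 / 2)"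
  proof (rule frac_le)
    have "cmod (z\<^sup>2 - z * of_real (a + b)) \<le> cmod z ^ 2 + cmod z * \<bar>a + b\<bar>"
      using norm_triangle_ineq4[of "z\<^sup>2" "z * of_real (a + b)"]
      by (simp only: norm_power norm_mult norm_of_real)
    also have "\<dots> \<le> R\<^sup>2 + R * (1 / 2)"
      using ab(3) assms(2) \<open>0 \<le> R\<close> by (intro add_mono power_mono mult_mono) auto
    finally show "cmod (z\<^sup>2 - z * of_real (a + b)) \<le> R\<^sup>2 + R * (1 / 2)" .
  qed (use prod \<open>0 < n\<^sup>2\<close> \<open>0 \<le> R\<close> in auto)
  also have "\<dots> = 2 * (R\<^sup>2 + R * (1 / 2)) / n\<^sup>2" by simp
  also have "2 * (R\<^sup>2 + R * (1 / 2)) = R + 2 * R\<^sup>2" by simp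
  also have "(R + 2 * R\<^sup>2) / n\<^sup>2 = (R + 2 * R\<^sup>2) * (1 / n\<^sup>2)" by simp
  finally show ?thesis by (simp only: a_def b_def n_def)
qed

text \<open>Locally uniform convergence of the product of pairs of factors. The value at $1/2$ serves as a
point of comparison that is neither an integer nor a node.\<close>

lemma G_properties:
  assumes nodes: "near_integers t D"
  shows partial_G_tendsto: "(\<lambda>N. partial_G t N z) \<longlonglongrightarrow> G t z"
    and G_has_derivative: "(G t has_field_derivative deriv (G t) z) (at z)"
    and G_half_nonzero: "G t (1 / 2) \<noteq> 0"
proof -
  define f where
    "f = (\<lambda>k (z :: complex). (1 - z / of_real (t (int (Suc k)))) * (1 - z / of_real (t (- int (Suc k)))))"
  have close: "cmod (f k z - 1) \<le> (R + 2 * R\<^sup>2) * (1 / (real (Suc k))\<^sup>2)" if "cmod z \<le> R" for k z R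
    unfolding f_def by (rule G_factor_close_to_1[OF nodes that])
  have "summable (\<lambda>k. 1 / (real (Suc k))\<^sup>2)"
    using inverse_power_summable[of 2, where 'a = real]
    by (subst summable_Suc_iff) (simp add: inverse_eq_divide)
  then have summable: "summable (\<lambda>k. C * (1 / (real (Suc k))\<^sup>2))" for C by (rule summable_mult)
  have "summable (\<lambda>k. norm (f k z - 1))" for z
    by (rule summable_comparison_test'[OF summable[of "cmod z + 2 * (cmod z)\<^sup>2"], of 0])
       (use close[of z "cmod z"] in simp)
  then have conv: "convergent_prod (\<lambda>k. f k z)" for z
    by (intro abs_convergent_prod_imp_convergent_prod) (simp add: abs_convergent_prod_conv_summable)
  have lim: "(\<lambda>N. \<Prod>k<N. f k z) \<longlonglongrightarrow> (\<Prod>k. f k z)" for z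
    using convergent_prod_LIMSEQ[OF conv[of z]] by (simp add: LIMSEQ_lessThan_iff_atMost)
  have hol: "(\<lambda>z. \<Prod>k<N. f k z) holomorphic_on S" for N S
    unfolding f_def by (intro holomorphic_intros) (use near_integers_eq_int[OF nodes, of _ 0] in force)+
  have unif: "uniform_limit (cball 0 R) (\<lambda>N z. \<Prod>k<N. f k z) (\<lambda>z. \<Prod>k. f k z) sequentially" for R
  proof -
    have "uniformly_convergent_on (cball 0 R) (\<lambda>N z. \<Sum>k<N. norm (f k z - 1))"
      by (rule Weierstrass_m_test'[OF _ summable[of "R + 2 * R\<^sup>2"]]) (use close in simp)
    moreover have "continuous_on (cball 0 R) (f k)" for k
      unfolding f_def by (intro continuous_intros) (use near_integers_eq_int[OF nodes, of _ 0] in force)+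
    ultimately have "uniformly_convergent_on (cball 0 R) (\<lambda>N z. \<Prod>k<N. f k z)"
      by (intro uniformly_convergent_on_prod') auto
    then obtain l where l: "uniform_limit (cball 0 R) (\<lambda>N z. \<Prod>k<N. f k z) l sequentially"
      by (auto simp: uniformly_convergent_on_def)
    have "l z = (\<Prod>k. f k z)" if "z \<in> cball 0 R" for z
      by (rule LIMSEQ_unique[OF tendsto_uniform_limitI[OF l that] lim])
    from uniform_limit_cong'[THEN iffD1, OF refl this l] show ?thesis .
  qed
  show "(\<lambda>N. partial_G t N z) \<longlonglongrightarrow> G t z"
    unfolding partial_G_def G_def using tendsto_mult[OF tendsto_const lim] by (simp add: f_def)
  show "(G t has_field_derivative deriv (G t) z) (at z)"
  proof -
    define R where "R = cmod z + 1"
    have "(\<lambda>z. \<Prod>k. f k z) holomorphic_on ball 0 R"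
    proof (rule holomorphic_uniform_limit[OF _ unif[of R]])
      show "\<forall>\<^sub>F N in sequentially. continuous_on (cball 0 R) (\<lambda>z. \<Prod>k<N. f k z)
          \<and> (\<lambda>z. \<Prod>k<N. f k z) holomorphic_on ball 0 R"
        using hol holomorphic_on_imp_continuous_on by (intro always_eventually allI conjI) blast+
    qed auto
    then have "(\<lambda>z. (z - of_real (t 0)) * (\<Prod>k. f k z)) holomorphic_on ball 0 R"
      by (intro holomorphic_intros)
    then have "G t holomorphic_on ball 0 R" by (simp add: G_def[abs_def] f_def)
    then show ?thesis
      by (rule holomorphic_derivI) (auto simp: R_def)
  qed
  show "G t (1 / 2) \<noteq> 0"
  proof -
    have "f k (1 / 2) \<noteq> 0" for k
    proof -
      have "complex_of_real (t j) \<noteq> 1 / 2" for j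
        using near_integers_ne_half[OF nodes, of j] by (metis of_real_1 of_real_divide of_real_eq_iff of_real_numeral)
      moreover have "t (int (Suc k)) \<noteq> 0" "t (- int (Suc k)) \<noteq> 0"
        using near_integers_eq_int[OF nodes, of _ 0] by force+
      ultimately show ?thesis by (simp add: f_def divide_simps)
    qed
    then have "(\<Prod>k. f k (1 / 2)) \<noteq> 0" by (rule prodinf_nonzero[OF conv])
    moreover have "1 / 2 - complex_of_real (t 0) \<noteq> 0"
      using near_integers_ne_half[OF nodes, of 0] by (metis eq_iff_diff_eq_0 of_real_1 of_real_divide of_real_eq_iff of_real_numeral)
    ultimately show ?thesis by (simp add: G_def f_def)
  qed
qed

lemma G_node:
  assumes "near_integers t D"
  shows "G t (of_real (t k)) = 0"
proof (rule LIMSEQ_unique[OF partial_G_tendsto[OF assms]])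
  have "t j \<noteq> 0" if "j \<noteq> 0" for j using near_integers_eq_int[OF assms, of j 0] that by auto
  then have "partial_G t N (of_real (t k)) = 0" if "nat \<bar>k\<bar> \<le> N" for N
  proof (rule partial_G_factor[of t N])
    fix c assume "\<And>z. partial_G t N z = c * (\<Prod>k\<in>{- int N..int N}. z - of_real (t k))"
    moreover have "k \<in> {- int N..int N}" using that by auto
    ultimately show ?thesis by auto
  qed
  then show "(\<lambda>N. partial_G t N (of_real (t k))) \<longlonglongrightarrow> 0"
    by (intro tendsto_eventually eventually_sequentiallyI[of "nat \<bar>k\<bar>"])
qed

lemma near_integers_of_int:
  assumes "near_integers t D"
  shows "near_integers of_int D"
  using assms by (simp add: near_integers_def)

lemma partial_G_nonzero:
  assumes "near_integers t D" "\<And>k. z \<noteq> of_real (t k)"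
  shows "partial_G t N z \<noteq> 0"
proof -
  have "t j \<noteq> 0" if "j \<noteq> 0" for j using near_integers_eq_int[OF assms(1), of j 0] that by auto
  then show ?thesis
    by (rule partial_G_factor[of t N]) (use assms(2) in auto)
qed

lemma partial_G_node:
  assumes "near_integers t D" "\<bar>j\<bar> \<le> int N"
  shows "partial_G t N (of_real (t j)) = 0"
proof -
  have "t i \<noteq> 0" if "i \<noteq> 0" for i using near_integers_eq_int[OF assms(1), of i 0] that by auto
  then show ?thesis
  proof (rule partial_G_factor[of t N])
    fix c assume "\<And>z. partial_G t N z = c * (\<Prod>k\<in>{- int N..int N}. z - of_real (t k))"
    moreover have "j \<in> {- int N..int N}" using assms(2) by auto
    ultimately show ?thesis by auto
  qed
qed


section \<open>Dual functions of the sampling operator\<close>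

text \<open>The sum on the right, multiplied by the denominator, is the Lagrange interpolation polynomial of
$p$ on $A$.\<close>

lemma partial_fractions_simple_poles:
  fixes A :: "'a :: field set" and p :: "'a poly"
  assumes "finite A" "degree p < card A" "x \<notin> A"
  shows "poly p x / (\<Prod>a\<in>A. x - a) = (\<Sum>a\<in>A. poly p a / (\<Prod>b\<in>A - {a}. a - b) / (x - a))"
proof -
  define c where "c = (\<lambda>a. poly p a / (\<Prod>b\<in>A - {a}. a - b))"
  define L where "L = (\<Sum>a\<in>A. smult (c a) (\<Prod>b\<in>A - {a}. [:- b, 1:]))"
  have poly_L: "poly L y = (\<Sum>a\<in>A. c a * (\<Prod>b\<in>A - {a}. y - b))" for y
    by (simp add: L_def poly_sum poly_prod)
  have "L = p"
  proof (rule poly_eqI_degree[of A])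
    show "poly L a = poly p a" if "a \<in> A" for a
    proof -
      have "(\<Prod>b\<in>A - {a'}. a - b) = 0" if "a' \<in> A" "a' \<noteq> a" for a'
        using \<open>finite A\<close> \<open>a \<in> A\<close> that by (intro prod_zero) auto
      then have "poly L a = (\<Sum>a'\<in>A. if a' = a then c a * (\<Prod>b\<in>A - {a}. a - b) else 0)"
        unfolding poly_L by (intro sum.cong) auto
      also have "\<dots> = c a * (\<Prod>b\<in>A - {a}. a - b)" using \<open>finite A\<close> that by simp
      also have "\<dots> = poly p a" using \<open>finite A\<close> by (simp add: c_def)
      finally show ?thesis .
    qed
    have "degree L \<le> card A - 1"
      unfolding L_def
    proof (rule degree_sum_le[OF \<open>finite A\<close>])
      fix a assume "a \<in> A"
      have "degree (smult (c a) (\<Prod>b\<in>A - {a}. [:- b, 1:])) \<le> degree (\<Prod>b\<in>A - {a}. [:- b, 1:])"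
        by (rule degree_smult_le)
      also have "\<dots> \<le> (\<Sum>b\<in>A - {a}. degree [:- b, 1:])"
        using degree_prod_sum_le[of "A - {a}" "\<lambda>b. [:- b, 1:]"] \<open>finite A\<close> by (simp add: o_def)
      also have "\<dots> = card A - 1" using \<open>finite A\<close> \<open>a \<in> A\<close> by simp
      finally show "degree (smult (c a) (\<Prod>b\<in>A - {a}. [:- b, 1:])) \<le> card A - 1" .
    qed
    then show "degree L < card A" using assms(2) by linarith
  qed (use assms in simp)
  have "poly p x / (\<Prod>a\<in>A. x - a) = (\<Sum>a\<in>A. c a * (\<Prod>b\<in>A - {a}. x - b) / (\<Prod>a\<in>A. x - a))"
    unfolding \<open>L = p\<close>[symmetric] poly_L by (rule sum_divide_distrib)
  also have "\<dots> = (\<Sum>a\<in>A. c a / (x - a))"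
  proof (rule sum.cong[OF refl])
    fix a assume "a \<in> A"
    then have "(\<Prod>a\<in>A. x - a) = (x - a) * (\<Prod>b\<in>A - {a}. x - b)"
      using \<open>finite A\<close> by (rule prod.remove[rotated])
    moreover have "(\<Prod>b\<in>A - {a}. x - b) \<noteq> 0" using assms by auto
    ultimately show "c a * (\<Prod>b\<in>A - {a}. x - b) / (\<Prod>a\<in>A. x - a) = c a / (x - a)" by simp
  qed
  finally show ?thesis by (simp add: c_def)
qed

text \<open>Dividing $\sin(\pi x)/\pi$ times the $N$-th partial product of $G$ by $x - t_k$ and by the
$N$-th partial product of the sine leaves $\sin(\pi x)/\pi$ times a rational function whose poles are at
most simple and lie in $\{-N,\dots,N\}$. Its residues are the coordinates of $c$. If a node $t_j$ is itself an integer, the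
corresponding residue is zero.\<close>

lemma finite_interpolant:
  assumes nodes: "near_integers t D" and k: "\<bar>k\<bar> \<le> int N"
  obtains c where
    "\<And>n. int N < \<bar>n\<bar> \<Longrightarrow> coord c n = 0"
    "\<And>j. \<bar>j\<bar> \<le> int N \<Longrightarrow> j \<noteq> k \<Longrightarrow> t j = of_int j \<Longrightarrow> coord c j = 0"
    "\<And>x. x \<notin> \<int> \<Longrightarrow> of_real (x - t k) * coord (exp_hilbert x c) 0
      = of_real (sin (pi * x) / pi) * partial_G t N (of_real x) / partial_G of_int N (of_real x)"
proof -
  define I where "I = {- int N..int N}"
  define A where "A = (of_int ` I :: complex set)"
  have inj: "inj_on (of_int :: int \<Rightarrow> complex) I" by (auto simp: inj_on_def)
  have I: "finite I" "k \<in> I" using k by (auto simp: I_def)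
  have A: "finite A" "card A = card I" using I inj by (simp_all add: A_def card_image)
  define p where "p = (\<Prod>j\<in>I - {k}. [:- complex_of_real (t j), 1:])"
  have "degree p \<le> (\<Sum>j\<in>I - {k}. degree [:- complex_of_real (t j), 1:])"
    unfolding p_def using degree_prod_sum_le[of "I - {k}" "\<lambda>j. [:- complex_of_real (t j), 1:]"] I(1)
    by (simp add: o_def)
  also have "\<dots> = card I - 1" using I by simp
  finally have deg: "degree p < card A" using I A(2) card_gt_0_iff[of I] by fastforce
  have poly_p: "poly p z = (\<Prod>j\<in>I - {k}. z - of_real (t j))" for z by (simp add: p_def poly_prod)
  have nonzero: "t j \<noteq> 0" if "j \<noteq> 0" for j using near_integers_eq_int[OF nodes, of j 0] that by auto
  obtain g where g: "g \<noteq> 0" "\<And>z. partial_G t N z = g * (\<Prod>j\<in>I. z - of_real (t j))"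
    using partial_G_factor[of t N, OF nonzero] unfolding I_def by blast
  obtain h where h: "h \<noteq> 0" "\<And>z. partial_G of_int N z = h * (\<Prod>j\<in>I. z - of_int j)"
    using partial_G_factor[of of_int N] unfolding I_def by auto
  \<comment> \<open>The factor \<open>g / h\<close> passes from monic polynomials to the partial products.\<close>
  define r where "r = (\<lambda>n. g / h * (poly p (of_int n) / (\<Prod>b\<in>A - {of_int n}. of_int n - b)))"
  define c where "c = (\<Sum>n\<in>I. single n (r n))"
  have coord_c: "coord c n = (if n \<in> I then r n else 0)" for n
    unfolding c_def by (rule coord_sum_single[OF I(1)])
  have interp: "of_real (x - t k) * coord (exp_hilbert x c) 0
      = of_real (sin (pi * x) / pi) * partial_G t N (of_real x) / partial_G of_int N (of_real x)"
    if x: "x \<notin> \<int>" for x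
  proof -
    have "complex_of_real x \<notin> A"
    proof
      assume "complex_of_real x \<in> A"
      then obtain n where "complex_of_real x = of_int n" by (auto simp: A_def)
      then have "x = of_int n" by (metis of_real_eq_iff of_real_of_int_eq)
      with x show False by simp
    qed
    note pf = partial_fractions_simple_poles[OF A(1) deg this]
    have "coord (exp_hilbert x c) 0 = (\<Sum>n\<in>I. r n * of_real (exp_entry (- n) x))"
      unfolding c_def blinfun.sum_right coord_sum exp_hilbert_single_coord by simp
    also have "\<dots> = (\<Sum>n\<in>I. of_real (sin (pi * x) / pi) * (g / h)
        * (poly p (of_int n) / (\<Prod>b\<in>A - {of_int n}. of_int n - b) / (of_real x - of_int n)))"
      by (rule sum.cong[OF refl]) (simp add: exp_entry_nonint[OF x] r_def field_simps)
    also have "\<dots> = of_real (sin (pi * x) / pi) * (g / h) *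
        (\<Sum>a\<in>A. poly p a / (\<Prod>b\<in>A - {a}. a - b) / (of_real x - a))"
      unfolding A_def sum.reindex[OF inj] o_def sum_distrib_left ..
    also have "\<dots> = of_real (sin (pi * x) / pi) * (g / h) * (poly p (of_real x) / (\<Prod>a\<in>A. of_real x - a))"
      unfolding pf ..
    also have "(\<Prod>a\<in>A. of_real x - a) = (\<Prod>j\<in>I. of_real x - of_int j)"
      unfolding A_def prod.reindex[OF inj] o_def ..
    finally have "coord (exp_hilbert x c) 0 = of_real (sin (pi * x) / pi) * (g / h)
        * (poly p (of_real x) / (\<Prod>j\<in>I. of_real x - of_int j))" .
    moreover have "of_real (x - t k) * poly p (of_real x) = (\<Prod>j\<in>I. of_real x - complex_of_real (t j))"
      unfolding poly_p using prod.remove[OF I, of "\<lambda>j. of_real x - complex_of_real (t j)"] by simp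
    ultimately have "of_real (x - t k) * coord (exp_hilbert x c) 0 = of_real (sin (pi * x) / pi)
        * (g * (\<Prod>j\<in>I. of_real x - complex_of_real (t j))) / (h * (\<Prod>j\<in>I. of_real x - of_int j))"
      by (simp add: mult_ac)
    then show ?thesis unfolding g(2) h(2) .
  qed
  show ?thesis
  proof (rule that[of c])
    show "coord c n = 0" if "int N < \<bar>n\<bar>" for n
      using that by (auto simp: coord_c I_def)
    show "coord c j = 0" if "\<bar>j\<bar> \<le> int N" "j \<noteq> k" "t j = of_int j" for j
    proof -
      have "poly p (of_int j) = 0"
        unfolding poly_p using that I(1) by (intro prod_zero) (auto simp: I_def intro!: bexI[of _ j])
      then show ?thesis by (simp add: coord_c r_def)
    qed
  qed (rule interp)
qed

text \<open>For the truncated node sequence, $F_c$ vanishes at every node except the $k$-th. Its value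
there cannot be zero, since sampling is injective and $c \ne 0$, so $c$ can be normalised.\<close>

lemma truncated_interpolant:
  assumes nodes: "near_integers t D" and k: "\<bar>k\<bar> \<le> int N"
  obtains w b where
    "sample_at (\<lambda>j. if \<bar>j\<bar> \<le> int N then t j else of_int j) w = single k 1"
    "\<And>x. x \<notin> \<int> \<Longrightarrow> of_real (x - t k) * coord (exp_hilbert x w) 0
      = b * (of_real (sin (pi * x) / pi) * partial_G t N (of_real x) / partial_G of_int N (of_real x))"
proof -
  define s where "s = (\<lambda>j. if \<bar>j\<bar> \<le> int N then t j else of_int j)"
  have s: "near_integers s D" using nodes by (auto simp: near_integers_def s_def)
  obtain c where c: "\<And>n. int N < \<bar>n\<bar> \<Longrightarrow> coord c n = 0"
    "\<And>j. \<bar>j\<bar> \<le> int N \<Longrightarrow> j \<noteq> k \<Longrightarrow> t j = of_int j \<Longrightarrow> coord c j = 0"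
    "\<And>x. x \<notin> \<int> \<Longrightarrow> of_real (x - t k) * coord (exp_hilbert x c) 0
      = of_real (sin (pi * x) / pi) * partial_G t N (of_real x) / partial_G of_int N (of_real x)"
    using finite_interpolant[OF nodes k] by blast
  define \<beta> where "\<beta> = coord (sample_at s c) k"
  have sample: "sample_at s c = single k \<beta>"
  proof (rule ell2_eqI)
    fix j
    have "coord (exp_hilbert (s j) c) 0 = 0" if "j \<noteq> k"
    proof (cases "s j \<in> \<int>")
      case True
      then obtain i where "s j = of_int i" by (auto elim: Ints_cases)
      then have "s j = of_int j" using near_integers_eq_int[OF s] by blast
      moreover have "coord c j = 0"
        using c(1)[of j] c(2)[of j] \<open>s j = of_int j\<close> that by (cases "\<bar>j\<bar> \<le> int N") (auto simp: s_def)
      ultimately show ?thesis by (simp add: coord_exp_hilbert_int)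
    next
      case False
      then have j: "\<bar>j\<bar> \<le> int N" "s j = t j" by (auto simp: s_def split: if_splits)
      have "partial_G t N (of_real (t j)) = 0" by (rule partial_G_node[OF nodes j(1)])
      then have "of_real (t j - t k) * coord (exp_hilbert (t j) c) 0 = 0"
        using c(3)[of "t j"] False j by simp
      moreover have "t j \<noteq> t k" using near_integers_inj[OF nodes] that by blast
      ultimately show ?thesis using j by simp
    qed
    then show "coord (sample_at s c) j = coord (single k \<beta>) j"
      by (cases "j = k") (auto simp: \<beta>_def coord_sample_at[OF s] single.rep_eq)
  qed
  have half: "(1 / 2 :: real) \<notin> \<int>" using half_not_Ints[of 0] by simp
  have "\<beta> \<noteq> 0"
  proof
    assume "\<beta> = 0"
    then have "norm (sample_at s c) = 0" unfolding sample by simp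
    then have "c = 0" using norm_le_sample_at[OF s, of c] by simp
    then have "partial_G t N (of_real (1 / 2)) = 0 \<or> partial_G of_int N (of_real (1 / 2)) = 0"
      using c(3)[OF half] by (auto simp: blinfun.zero_right)
    moreover have "complex_of_real (1 / 2) \<noteq> of_real (u j)" if "near_integers u D" for u :: "int \<Rightarrow> real" and j
      using near_integers_ne_half[OF that, of j] by (metis of_real_eq_iff)
    ultimately show False
      using partial_G_nonzero[OF nodes] partial_G_nonzero[OF near_integers_of_int[OF nodes]]
        nodes near_integers_of_int[OF nodes] by metis
  qed
  show ?thesis
  proof (rule that[of "scaleC (1 / \<beta>) c" "1 / \<beta>", folded s_def])
    show "sample_at s (scaleC (1 / \<beta>) c) = single k 1"
      unfolding sample_at_scaleC[OF s] sample
      by (rule ell2_eqI) (use \<open>\<beta> \<noteq> 0\<close> in \<open>simp add: scaleC.rep_eq single.rep_eq\<close>)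
    show "of_real (x - t k) * coord (exp_hilbert x (scaleC (1 / \<beta>) c)) 0
      = 1 / \<beta> * (of_real (sin (pi * x) / pi) * partial_G t N (of_real x) / partial_G of_int N (of_real x))"
      if "x \<notin> \<int>" for x
      unfolding coord_exp_hilbert_scaleC c(3)[OF that, symmetric] by simp
  qed
qed

lemma filterlim_symmetric_intervals:
  "filterlim (\<lambda>N. {- int N..int N}) (finite_subsets_at_top UNIV) sequentially"
  unfolding filterlim_finite_subsets_at_top
proof (intro allI impI)
  fix X :: "int set" assume X: "finite X \<and> X \<subseteq> UNIV"
  have "X \<subseteq> {- int N..int N}" if "nat (Max (abs ` X)) \<le> N" for N
  proof
    fix j assume "j \<in> X"
    then have "\<bar>j\<bar> \<le> Max (abs ` X)" using X by (intro Max_ge) auto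
    then show "j \<in> {- int N..int N}" using that by auto
  qed
  then show "\<forall>\<^sub>F N in sequentially. finite {- int N..int N} \<and> X \<subseteq> {- int N..int N} \<and> {- int N..int N} \<subseteq> UNIV"
    by (intro eventually_sequentiallyI[of "nat (Max (abs ` X))"]) auto
qed

text \<open>Euler's product for the sine.\<close>

lemma partial_G_of_int_tendsto:
  assumes "x \<notin> \<int>"
  shows "(\<lambda>N. of_real (sin (pi * x) / pi) / partial_G of_int N (of_real x)) \<longlonglongrightarrow> 1"
proof -
  have "x \<noteq> 0" and sin: "sin (pi * x) \<noteq> 0" using assms by (auto simp: sin_zero_iff_int2 mult.commute)
  have eq: "partial_G of_int N (of_real x) = of_real (x * (\<Prod>k=1..N. 1 - x\<^sup>2 / (of_nat k)\<^sup>2))" for N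
  proof -
    have "(\<Prod>k=1..N. 1 - x\<^sup>2 / (of_nat k)\<^sup>2) = (\<Prod>k<N. 1 - x\<^sup>2 / (of_nat (Suc k))\<^sup>2)"
      by (rule prod.reindex_bij_witness[of _ Suc "\<lambda>k. k - 1"]) auto
    moreover have "(1 - of_real x / of_real (of_int (int (Suc k)))) * (1 - of_real x / of_real (of_int (- int (Suc k))))
        = complex_of_real (1 - x\<^sup>2 / (of_nat (Suc k))\<^sup>2)" for k
    proof -
      define n where "n = real (Suc k)"
      have "(1 - u) * (1 - - u) = 1 - u\<^sup>2" for u :: real
        by (simp add: algebra_simps power2_eq_square)
      from this[of "x / n"] have "(1 - x / n) * (1 - x / - n) = 1 - x\<^sup>2 / n\<^sup>2"
        by (simp add: power_divide)
      then have "complex_of_real ((1 - x / n) * (1 - x / - n)) = of_real (1 - x\<^sup>2 / n\<^sup>2)" by (simp only:)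
      then show ?thesis by (simp add: n_def)
    qed
    ultimately show ?thesis unfolding partial_G_def by simp
  qed
  have "(\<lambda>N. (sin (pi * x) / pi) / (x * (\<Prod>k=1..N. 1 - x\<^sup>2 / (of_nat k)\<^sup>2)))
      \<longlonglongrightarrow> (sin (pi * x) / pi) / (sin (pi * x) / pi)"
  proof (intro tendsto_divide tendsto_const)
    from tendsto_divide[OF sin_product_formula_real[of x] tendsto_const[of pi]]
    show "(\<lambda>N. x * (\<Prod>k=1..N. 1 - x\<^sup>2 / (of_nat k)\<^sup>2)) \<longlonglongrightarrow> sin (pi * x) / pi" by simp
  qed (use sin in simp_all)
  then have "(\<lambda>N. complex_of_real ((sin (pi * x) / pi) / (x * (\<Prod>k=1..N. 1 - x\<^sup>2 / (of_nat k)\<^sup>2)))) \<longlonglongrightarrow> of_real 1"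
    using sin by (intro tendsto_of_real) simp
  then show ?thesis unfolding eq by simp
qed

text \<open>The operators for the truncated nodes have inverses that are bounded uniformly in $N$, and they
differ from $S$ at $e$ only in the coordinates of $e - Se$ beyond $N$.\<close>

lemma truncated_samples_converge:
  assumes nodes: "near_integers t D"
    and w: "\<And>N. n0 \<le> N \<Longrightarrow> sample_at (\<lambda>j. if \<bar>j\<bar> \<le> int N then t j else of_int j) (w N) = sample_at t e"
  shows "w \<longlonglongrightarrow> e"
proof -
  define r where "r = e - sample_at t e"
  define \<rho> where "\<rho> = (\<lambda>N. r - (\<Sum>j\<in>{- int N..int N}. single j (coord r j)))"
  have bound: "norm (e - w N) \<le> norm (\<rho> N) / (1 - kadec_constant D)" if "n0 \<le> N" for N
  proof -
    define s where "s = (\<lambda>j. if \<bar>j\<bar> \<le> int N then t j else of_int j)"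
    have s: "near_integers s D" using nodes by (auto simp: near_integers_def s_def)
    have "sample_at s (e - w N) = sample_at s e - sample_at t e"
      unfolding sample_at_diff[OF s] using w[OF that] by (simp add: s_def)
    also have "\<dots> = \<rho> N"
    proof (rule ell2_eqI)
      fix j
      show "coord (sample_at s e - sample_at t e) j = coord (\<rho> N) j"
      proof (cases "\<bar>j\<bar> \<le> int N")
        case True
        then have "j \<in> {- int N..int N}" by auto
        then have "coord (\<rho> N) j = 0" by (simp add: \<rho>_def coord_sum_single del: coord_sum)
        moreover have "s j = t j" using True by (simp add: s_def)
        ultimately show ?thesis by (simp add: coord_sample_at[OF s] coord_sample_at[OF nodes])
      next
        case False
        then have "j \<notin> {- int N..int N}" by auto
        then have "coord (\<rho> N) j = coord e j - coord (sample_at t e) j"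
          unfolding \<rho>_def r_def coord_simps coord_sum_single[OF finite_atLeastAtMost_int]
          by (simp del: atLeastAtMost_iff)
        moreover have "s j = of_int j" using False by (simp add: s_def)
        then have "coord (sample_at s e) j = coord e j"
          using cos_pi_int_square[of j]
          by (simp add: coord_sample_at[OF s] coord_exp_hilbert_int flip: mult.assoc of_real_mult)
        ultimately show ?thesis by simp
      qed
    qed
    finally show ?thesis using norm_le_sample_at[OF s, of "e - w N"] by simp
  qed
  have "((\<lambda>F. \<Sum>j\<in>F. single j (coord r j)) \<longlongrightarrow> r) (finite_subsets_at_top UNIV)"
    using has_sum_single[of r] by (simp add: has_sum_def)
  from filterlim_compose[OF this filterlim_symmetric_intervals]
  have "(\<lambda>N. r - (\<Sum>j\<in>{- int N..int N}. single j (coord r j))) \<longlonglongrightarrow> r - r"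
    by (intro tendsto_diff tendsto_const)
  then have "(\<lambda>N. norm (\<rho> N) / (1 - kadec_constant D)) \<longlonglongrightarrow> norm (0 :: ell2) / (1 - kadec_constant D)"
    using kadec_constant_bounds(2)[OF nodes] by (intro tendsto_intros) (simp_all add: \<rho>_def)
  then have "(\<lambda>N. norm (\<rho> N) / (1 - kadec_constant D)) \<longlonglongrightarrow> 0" by simp
  moreover have "\<forall>\<^sub>F N in sequentially. norm (w N - e) \<le> norm (\<rho> N) / (1 - kadec_constant D)"
    using bound by (intro eventually_sequentiallyI[of n0]) (simp add: norm_minus_commute)
  ultimately have "(\<lambda>N. w N - e) \<longlonglongrightarrow> 0"
    by (rule Lim_null_comparison[rotated])
  then show ?thesis by (simp add: LIM_zero_iff)
qed

lemma continuous_coord_exp_hilbert: "isCont (\<lambda>x. coord (exp_hilbert x a) m) x"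
  by (rule bounded_linear.isCont[OF bounded_linear_coord])
     (rule has_vector_derivative_continuous[OF exp_hilbert_has_vector_derivative])

lemma eventually_not_Ints_at: "\<forall>\<^sub>F y in at (x :: real). y \<notin> \<int>"
proof -
  have "closed (\<int> - {x})" by (rule closed_subset_Ints) auto
  then have "open (- (\<int> - {x}))" by (rule open_Compl)
  then have "\<forall>\<^sub>F y in nhds x. y \<in> - (\<int> - {x})" by (intro eventually_nhds_in_open) auto
  then show ?thesis
    unfolding eventually_at_filter by eventually_elim auto
qed

text \<open>In the limit $N \to \infty$ the truncated identity becomes $(x - t_k)F_e(x) = \gamma G(x)$ for
all $x$ that are not integers, and by continuity for all real $x$. Since $F_e(t_k) = (-1)^k$,
letting $x \to t_k$ gives $\gamma G'(t_k) = (-1)^k$. In particular $G'(t_k) \ne 0$.\<close>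

lemma kernel_is_dual_function:
  assumes nodes: "near_integers t D" and e: "sample_at t e = single k 1"
  shows "coord (exp_hilbert x e) 0 = of_real (cos (pi * of_int k)) * lagrange_kernel t k x"
proof -
  define F where "F = (\<lambda>x. coord (exp_hilbert x e) 0)"
  define Q where "Q = (\<lambda>N w b. sample_at (\<lambda>j. if \<bar>j\<bar> \<le> int N then t j else of_int j) w = single k 1 \<and>
      (\<forall>x. x \<notin> \<int> \<longrightarrow> of_real (x - t k) * coord (exp_hilbert x w) 0
        = b * (of_real (sin (pi * x) / pi) * partial_G t N (of_real x) / partial_G of_int N (of_real x))))"
  have "\<exists>w b. nat \<bar>k\<bar> \<le> N \<longrightarrow> Q N w b" for N
  proof (cases "nat \<bar>k\<bar> \<le> N")
    case True
    then have "\<bar>k\<bar> \<le> int N" by auto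
    then have "\<exists>w b. Q N w b" unfolding Q_def by (rule truncated_interpolant[OF nodes]) blast
    then show ?thesis by blast
  qed blast
  then obtain w b where "\<And>N. nat \<bar>k\<bar> \<le> N \<Longrightarrow> Q N (w N) (b N)" by metis
  then have
    w: "\<And>N. nat \<bar>k\<bar> \<le> N \<Longrightarrow> sample_at (\<lambda>j. if \<bar>j\<bar> \<le> int N then t j else of_int j) (w N) = single k 1"
    and b: "\<And>N x. nat \<bar>k\<bar> \<le> N \<Longrightarrow> x \<notin> \<int> \<Longrightarrow> of_real (x - t k) * coord (exp_hilbert x (w N)) 0
        = b N * (of_real (sin (pi * x) / pi) * partial_G t N (of_real x) / partial_G of_int N (of_real x))"
    by (simp_all add: Q_def)
  have "w \<longlonglongrightarrow> e"
    by (rule truncated_samples_converge[OF nodes, of "nat \<bar>k\<bar>"]) (use w e in simp)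
  then have lhs: "(\<lambda>N. of_real (x - t k) * coord (exp_hilbert x (w N)) 0) \<longlonglongrightarrow> of_real (x - t k) * F x" for x
    unfolding F_def
    by (intro tendsto_mult tendsto_const bounded_linear.tendsto[OF bounded_linear_coord] blinfun.tendsto)
  define P where "P = (\<lambda>x N. of_real (sin (pi * x) / pi) * partial_G t N (of_real x) / partial_G of_int N (of_real x))"
  have P: "P x \<longlonglongrightarrow> G t (of_real x)" if "x \<notin> \<int>" for x
    using tendsto_mult[OF partial_G_of_int_tendsto[OF that] partial_G_tendsto[OF nodes, of "of_real x"]]
    by (simp add: P_def)
  have ev: "\<forall>\<^sub>F N in sequentially. of_real (x - t k) * coord (exp_hilbert x (w N)) 0 = b N * P x N"
    if "x \<notin> \<int>" for x
    using b[OF _ that] by (intro eventually_sequentiallyI[of "nat \<bar>k\<bar>"]) (simp add: P_def)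
  have half: "(1 / 2 :: real) \<notin> \<int>" using half_not_Ints[of 0] by simp
  \<comment> \<open>At 1/2, neither an integer nor a node, the products have a nonzero limit, so the scalars
    \<open>b N\<close> converge.\<close>
  define \<gamma> where "\<gamma> = of_real (1 / 2 - t k) * F (1 / 2) / G t (of_real (1 / 2))"
  have G_half: "G t (of_real (1 / 2)) \<noteq> 0" using G_half_nonzero[OF nodes] by simp
  have "b \<longlonglongrightarrow> \<gamma>"
  proof (rule Lim_transform_eventually)
    show "(\<lambda>N. b N * P (1 / 2) N / P (1 / 2) N) \<longlonglongrightarrow> \<gamma>"
      unfolding \<gamma>_def
      by (intro tendsto_divide P half G_half Lim_transform_eventually[OF lhs ev])
    show "\<forall>\<^sub>F N in sequentially. b N * P (1 / 2) N / P (1 / 2) N = b N"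
      using tendsto_imp_eventually_ne[OF P[OF half] G_half] by eventually_elim simp
  qed
  then have product: "of_real (x - t k) * F x = \<gamma> * G t (of_real x)" if "x \<notin> \<int>" for x
    using LIMSEQ_unique[OF Lim_transform_eventually[OF lhs ev[OF that]] tendsto_mult[OF _ P[OF that]]] by blast
  have cont_F: "(F \<longlongrightarrow> F x) (at x)" for x
    using continuous_coord_exp_hilbert[where a = e and m = 0 and x = x] by (simp add: isCont_def F_def)
  have of_real_at: "filterlim complex_of_real (at (of_real x)) (at x)" for x
    unfolding filterlim_at by (auto intro!: tendsto_intros simp: eventually_at_filter)
  have cont_G: "((\<lambda>x. G t (of_real x)) \<longlongrightarrow> G t (of_real x)) (at x)" for x
    using filterlim_compose[OF DERIV_isCont[OF G_has_derivative[OF nodes], unfolded isCont_def] of_real_at] .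
  have all: "of_real (x - t k) * F x = \<gamma> * G t (of_real x)" for x
  proof (rule tendsto_unique[of "at x"])
    show "((\<lambda>x. of_real (x - t k) * F x) \<longlongrightarrow> of_real (x - t k) * F x) (at x)"
      by (intro tendsto_intros cont_F)
    show "((\<lambda>x. of_real (x - t k) * F x) \<longlongrightarrow> \<gamma> * G t (of_real x)) (at x)"
      using tendsto_mult[OF tendsto_const cont_G, of \<gamma> x]
      by (rule Lim_transform_eventually)
         (use eventually_not_Ints_at in \<open>rule eventually_mono\<close>, use product in simp)
  qed simp
  have "F (t k) = of_real (cos (pi * of_int k)) * coord (sample_at t e) k"
    using cos_pi_int_square[of k]
    by (simp add: F_def coord_sample_at[OF nodes] flip: mult.assoc of_real_mult)
  then have F_node: "F (t k) = of_real (cos (pi * of_int k))" by (simp add: e single.rep_eq)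
  have "((\<lambda>x. \<gamma> * (G t (of_real x) / (of_real x - of_real (t k)))) \<longlongrightarrow> \<gamma> * deriv (G t) (of_real (t k))) (at (t k))"
  proof (intro tendsto_mult tendsto_const)
    have "((\<lambda>z. (G t z - G t (of_real (t k))) / (z - of_real (t k))) \<longlongrightarrow> deriv (G t) (of_real (t k)))
        (at (of_real (t k)))"
      using G_has_derivative[OF nodes] unfolding has_field_derivative_iff .
    from filterlim_compose[OF this of_real_at]
    show "((\<lambda>x. G t (of_real x) / (of_real x - of_real (t k))) \<longlongrightarrow> deriv (G t) (of_real (t k))) (at (t k))"
      by (simp add: G_node[OF nodes])
  qed
  moreover have "\<forall>\<^sub>F x in at (t k). \<gamma> * (G t (of_real x) / (of_real x - of_real (t k))) = F x"
  proof (rule eventually_mono[OF eventually_neq_at_within[of "t k"]])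
    fix x assume "x \<noteq> t k"
    then have "complex_of_real x - of_real (t k) \<noteq> 0" by simp
    moreover have "(of_real x - of_real (t k)) * F x = \<gamma> * G t (of_real x)" using all[of x] by simp
    ultimately show "\<gamma> * (G t (of_real x) / (of_real x - of_real (t k))) = F x" by (simp add: field_simps)
  qed
  ultimately have "(F \<longlongrightarrow> \<gamma> * deriv (G t) (of_real (t k))) (at (t k))"
    by (rule Lim_transform_eventually)
  from tendsto_unique[OF _ cont_F this]
  have \<gamma>: "of_real (cos (pi * of_int k)) = \<gamma> * deriv (G t) (of_real (t k))" by (simp add: F_node)
  have "deriv (G t) (of_real (t k)) \<noteq> 0" using \<gamma> by (auto simp: cos_npi_int split: if_splits)
  have "F x = of_real (cos (pi * of_int k)) * lagrange_kernel t k x"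
  proof (cases "x = t k")
    case True
    then show ?thesis by (simp add: F_node lagrange_kernel_def)
  next
    case False
    then have "complex_of_real (x - t k) \<noteq> 0" by simp
    then have "F x = \<gamma> * G t (of_real x) / of_real (x - t k)" using all[of x] by (simp add: field_simps)
    with False \<open>deriv (G t) (of_real (t k)) \<noteq> 0\<close> show ?thesis
      unfolding \<gamma> lagrange_kernel_def by simp
  qed
  then show ?thesis by (simp add: F_def)
qed


section \<open>The interpolation series\<close>

theorem theorem4p2:
  fixes a astar :: ell2 and t :: "int \<Rightarrow> real"
  assumes "bdd_above (range (\<lambda>k. \<bar>t k - of_int k\<bar>))"
    and "(SUP k. \<bar>t k - of_int k\<bar>) < 1 / 4"
  shows "\<forall>K. compact K \<longrightarrow>
    uniform_limit K (\<lambda>F x. \<Sum>k\<in>F. Psi a astar (t k) * lagrange_kernel t k x) (Psi a astar)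
      (finite_subsets_at_top UNIV)"
proof (intro allI impI)
  fix K :: "real set"
  \<comment> \<open>The supremum can be 0, whereas the estimate is stated for a positive bound below 1/4.\<close>
  define D where "D = (max 0 (SUP k. \<bar>t k - of_int k\<bar>) + 1 / 4) / 2"
  have "\<bar>t k - of_int k\<bar> \<le> (SUP k. \<bar>t k - of_int k\<bar>)" for k
    by (rule cSUP_upper[OF UNIV_I assms(1)])
  then have "\<bar>t k - of_int k\<bar> \<le> D" for k
    using assms(2) order_trans[of "\<bar>t k - of_int k\<bar>" _ D] by (fastforce simp: D_def max_def)
  then have nodes: "near_integers t D"
    using assms(2) by (auto simp: near_integers_def D_def max_def)
  define v where "v = Psi_samples a astar"
  have Psi_v: "Psi a astar x = coord (exp_hilbert x v) 0" for x
    unfolding v_def by (rule Psi_eq_coord_exp_hilbert)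
  have "\<exists>e. sample_at t e = single k 1" for k by (metis sample_at_surjective[OF nodes])
  then obtain e where e: "\<And>k. sample_at t (e k) = single k 1" by metis
  define b where "b = (\<lambda>k. scaleC (coord (sample_at t v) k) (e k))"
  have sample_b: "sample_at t (b k) = single k (coord (sample_at t v) k)" for k
    unfolding b_def sample_at_scaleC[OF nodes] e
    by (rule ell2_eqI) (simp add: scaleC.rep_eq single.rep_eq)
  have term_b: "Psi a astar (t k) * lagrange_kernel t k x = coord (exp_hilbert x (b k)) 0" for k x
  proof -
    have "coord (exp_hilbert x (b k)) 0 = of_real (cos (pi * of_int k) * cos (pi * of_int k))
        * (Psi a astar (t k) * lagrange_kernel t k x)"
      unfolding b_def coord_exp_hilbert_scaleC coord_sample_at[OF nodes] Psi_v[symmetric]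
        kernel_is_dual_function[OF nodes e] of_real_mult by (simp only: mult_ac)
    then show ?thesis unfolding cos_pi_int_square by simp
  qed
  have bound: "cmod ((\<Sum>k\<in>F. Psi a astar (t k) * lagrange_kernel t k x) - Psi a astar x)
      \<le> norm ((\<Sum>k\<in>F. single k (coord (sample_at t v) k)) - sample_at t v) / (1 - kadec_constant D)" for F x
  proof -
    have "(\<Sum>k\<in>F. Psi a astar (t k) * lagrange_kernel t k x) - Psi a astar x
        = coord (exp_hilbert x ((\<Sum>k\<in>F. b k) - v)) 0"
      unfolding term_b unfolding Psi_v by (simp add: blinfun.diff_right blinfun.sum_right)
    then have "cmod ((\<Sum>k\<in>F. Psi a astar (t k) * lagrange_kernel t k x) - Psi a astar x)
        \<le> norm ((\<Sum>k\<in>F. b k) - v)"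
      by (simp only: coord_exp_hilbert_le)
    also have "\<dots> \<le> norm (sample_at t ((\<Sum>k\<in>F. b k) - v)) / (1 - kadec_constant D)"
      by (rule norm_le_sample_at[OF nodes])
    also have "sample_at t ((\<Sum>k\<in>F. b k) - v) = (\<Sum>k\<in>F. single k (coord (sample_at t v) k)) - sample_at t v"
      unfolding sample_at_diff[OF nodes] sample_at_sum[OF nodes] sample_b ..
    finally show ?thesis .
  qed
  have "((\<lambda>F. \<Sum>k\<in>F. single k (coord (sample_at t v) k)) \<longlongrightarrow> sample_at t v) (finite_subsets_at_top UNIV)"
    using has_sum_single[of "sample_at t v"] by (simp add: has_sum_def)
  then have "((\<lambda>F. norm ((\<Sum>k\<in>F. single k (coord (sample_at t v) k)) - sample_at t v) / (1 - kadec_constant D))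
      \<longlongrightarrow> norm (sample_at t v - sample_at t v) / (1 - kadec_constant D)) (finite_subsets_at_top UNIV)"
    using kadec_constant_bounds(2)[OF nodes] by (intro tendsto_intros) simp_all
  then have lim: "((\<lambda>F. norm ((\<Sum>k\<in>F. single k (coord (sample_at t v) k)) - sample_at t v) / (1 - kadec_constant D))
      \<longlongrightarrow> 0) (finite_subsets_at_top UNIV)" by simp
  show "uniform_limit K (\<lambda>F x. \<Sum>k\<in>F. Psi a astar (t k) * lagrange_kernel t k x) (Psi a astar)
      (finite_subsets_at_top UNIV)"
  proof (rule uniform_limitI)
    fix \<epsilon> :: real assume "0 < \<epsilon>"
    from order_tendstoD(2)[OF lim this]
    show "\<forall>\<^sub>F F in finite_subsets_at_top UNIV. \<forall>x\<in>K.
        dist (\<Sum>k\<in>F. Psi a astar (t k) * lagrange_kernel t k x) (Psi a astar x) < \<epsilon>"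
      unfolding dist_norm by eventually_elim (blast intro: order_le_less_trans[OF bound])
  qed
qed

end
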